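(* There exists a universal constant $M$ such that, for every entire maximal surface $S$ of nonpositive curvature in $\mathrm{AdS}^3$ and every pair of points $p,q\in S$, $$1-\lambda(q)\leq e^{M d_S(p,q)}\,(1-\lambda(p))\,,$$ where $\lambda\geq0$ is the nonnegative principal curvature of $S$ and $d_S$ is the distance of the induced metric on $S$.
   Context: $\mathbb{R}^{2,2}$ is $\mathbb{R}^4$ with $\langle x,y\rangle=x^1y^1+x^2y^2-x^3y^3-x^4y^4$; $\mathrm{AdS}^3=\mathrm{P}(\{\langle x,x\rangle<0\})\subset\mathbb{RP}^3$, with the Lorentzian metric of constant curvature $-1$ induced from its double cover $\{x:\langle x,x\rangle=-1\}$; $\partial_\infty\mathrm{AdS}^3=\mathrm{P}(\{\langle x,x\rangle=0\})$. A smooth embedded spacelike surface $S$ (Riemannian induced metric) with unit normal $N$ has shape operator $B=\nabla N$; it is maximal if $\mathrm{tr}\,B=0$. Its principal curvatures (eigenvalues of $B$) are $\pm\lambda$ with $\lambda\ge0$, and its curvature is $-1+\lambda^2$, so nonpositive curvature means $\lambda\leq1$. $S$ is entire if it is a topological disc whose frontier is contained in $\partial_\infty\mathrm{AdS}^3$. *)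

theory Defs
  imports "HOL-Analysis.Analysis"
begin

section \<open>Anti-de Sitter space\<close>

definition form22 :: "real^4 \<Rightarrow> real^4 \<Rightarrow> real" where
  "form22 x y = x$1 * y$1 + x$2 * y$2 - x$3 * y$3 - x$4 * y$4"

text \<open>A point of the real projective space is the line spanned by a nonzero vector.\<close>

definition proj :: "real^4 \<Rightarrow> (real^4) set" where
  "proj x = span {x}"

definition RP3 :: "(real^4) set topology" where
  "RP3 = topology (\<lambda>\<U>. \<U> \<subseteq> proj ` (UNIV - {0}) \<and> open {x. x \<noteq> 0 \<and> proj x \<in> \<U>})"

lemma openin_RP3:
  "openin RP3 \<U> \<longleftrightarrow> \<U> \<subseteq> proj ` (UNIV - {0}) \<and> open {x. x \<noteq> 0 \<and> proj x \<in> \<U>}"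
proof -
  define P where "P = (\<lambda>\<U>. \<U> \<subseteq> proj ` (UNIV - {0}) \<and> open {x. x \<noteq> 0 \<and> proj x \<in> \<U>})"
  have "P (A \<inter> B)" if "P A" "P B" for A B
  proof -
    have "{x. x \<noteq> 0 \<and> proj x \<in> A \<inter> B} =
        {x. x \<noteq> 0 \<and> proj x \<in> A} \<inter> {x. x \<noteq> 0 \<and> proj x \<in> B}" by blast
    moreover have "open \<dots>" using that unfolding P_def by (intro open_Int) blast+
    ultimately show ?thesis using that unfolding P_def by (simp only:) blast
  qed
  moreover have "P (\<Union>K)" if "\<forall>A\<in>K. P A" for K
  proof -
    have "{x. x \<noteq> 0 \<and> proj x \<in> \<Union>K} = (\<Union>A\<in>K. {x. x \<noteq> 0 \<and> proj x \<in> A})" by blast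
    moreover have "open \<dots>" using that unfolding P_def by (intro open_UN) blast
    ultimately show ?thesis using that unfolding P_def by (simp only:) blast
  qed
  ultimately have "istopology P"
    unfolding istopology_def by blast
  moreover have "RP3 = topology P"
    unfolding RP3_def P_def by (rule refl)
  ultimately show ?thesis
    using topology_inverse' [of P] unfolding P_def by presburger
qed

lemma topspace_RP3: "topspace RP3 = proj ` (UNIV - {0})"
proof
  show "topspace RP3 \<subseteq> proj ` (UNIV - {0})"
    using openin_RP3 [of "topspace RP3"] openin_topspace [of RP3] by blast
next
  have "{x::real^4. x \<noteq> 0 \<and> proj x \<in> proj ` (UNIV - {0})} = - {0}" by blast
  moreover have "open (- {0::real^4})" by (rule open_Compl) (rule closed_singleton)
  ultimately have "open {x::real^4. x \<noteq> 0 \<and> proj x \<in> proj ` (UNIV - {0})}"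
    by (simp only:)
  then have "openin RP3 (proj ` (UNIV - {0}))"
    unfolding openin_RP3 by (rule conjI [OF subset_refl])
  then show "proj ` (UNIV - {0}) \<subseteq> topspace RP3"
    by (rule openin_subset)
qed

lemma quotient_map_proj: "quotient_map (top_of_set (UNIV - {0})) RP3 proj"
proof -
  have "openin (top_of_set (UNIV - {0})) {x \<in> UNIV - {0::real^4}. proj x \<in> \<U>} \<longleftrightarrow> openin RP3 \<U>"
    if "\<U> \<subseteq> proj ` (UNIV - {0})" for \<U>
  proof -
    have 1: "open (UNIV - {0::real^4})" by (rule open_Diff) (rule open_UNIV, rule closed_singleton)
    have 2: "{x \<in> UNIV - {0::real^4}. proj x \<in> \<U>} = {x. x \<noteq> 0 \<and> proj x \<in> \<U>}" by blast
    have 3: "{x. x \<noteq> 0 \<and> proj x \<in> \<U>} \<subseteq> UNIV - {0::real^4}" by blast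
    show ?thesis
      unfolding 2 openin_open_eq [OF 1] openin_RP3 using that 3 by blast
  qed
  then show ?thesis
    unfolding quotient_map_def topspace_RP3 topspace_euclidean_subtopology by blast
qed

definition AdS3 :: "(real^4) set set" where
  "AdS3 = proj ` {x. form22 x x < 0}"

definition AdS3_boundary :: "(real^4) set set" where
  "AdS3_boundary = proj ` {x. x \<noteq> 0 \<and> form22 x x = 0}"

section \<open>Embedded surfaces\<close>

primrec Ck_on :: "nat \<Rightarrow> 'a::real_normed_vector set \<Rightarrow> ('a \<Rightarrow> 'b::real_normed_vector) \<Rightarrow> bool" where
  "Ck_on 0 U f \<longleftrightarrow> continuous_on U f"
| "Ck_on (Suc k) U f \<longleftrightarrow> (\<forall>x\<in>U. f differentiable (at x)) \<and>
     (\<forall>v. Ck_on k U (\<lambda>x. frechet_derivative f (at x) v))"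

definition smooth_on :: "'a::real_normed_vector set \<Rightarrow> ('a \<Rightarrow> 'b::real_normed_vector) \<Rightarrow> bool" where
  "smooth_on U f \<longleftrightarrow> (\<forall>k. Ck_on k U f)"

text \<open>Surfaces live in the projective quotient, but their local parametrizations are written
  through lifts to the double cover \<open>{x. form22 x x = -1}\<close>, which is locally isometric to it.
  The parametrization of the surface itself is \<open>proj \<circ> \<phi>\<close>. For \<open>S \<subseteq> AdS3\<close>, every local
  parametrization over a simply connected domain has such a lift.\<close>

definition surface_chart :: "(real^4) set set \<Rightarrow> (real^2) set \<Rightarrow> (real^2 \<Rightarrow> real^4) \<Rightarrow> bool" where
  "surface_chart S U \<phi> \<longleftrightarrow>
     open U \<and> smooth_on U \<phi> \<and>
     (\<forall>u\<in>U. form22 (\<phi> u) (\<phi> u) = -1) \<and>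
     (\<forall>u\<in>U. inj (frechet_derivative \<phi> (at u))) \<and>
     embedding_map (top_of_set U) (subtopology RP3 S) (proj \<circ> \<phi>) \<and>
     openin (subtopology RP3 S) ((proj \<circ> \<phi>) ` U)"

definition smooth_embedded_surface :: "(real^4) set set \<Rightarrow> bool" where
  "smooth_embedded_surface S \<longleftrightarrow>
     S \<subseteq> AdS3 \<and> (\<forall>p\<in>S. \<exists>U \<phi>. surface_chart S U \<phi> \<and> p \<in> (proj \<circ> \<phi>) ` U)"

definition spacelike_surface :: "(real^4) set set \<Rightarrow> bool" where
  "spacelike_surface S \<longleftrightarrow>
     smooth_embedded_surface S \<and>
     (\<forall>U \<phi> u v. surface_chart S U \<phi> \<and> u \<in> U \<and> v \<noteq> 0 \<longrightarrow>
        form22 (frechet_derivative \<phi> (at u) v) (frechet_derivative \<phi> (at u) v) > 0)"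

section \<open>Shape operator and principal curvatures\<close>

definition unit_normal_field ::
  "(real^2) set \<Rightarrow> (real^2 \<Rightarrow> real^4) \<Rightarrow> (real^2 \<Rightarrow> real^4) \<Rightarrow> bool" where
  "unit_normal_field U \<phi> \<nu> \<longleftrightarrow>
     smooth_on U \<nu> \<and>
     (\<forall>u\<in>U. form22 (\<nu> u) (\<nu> u) = -1 \<and> form22 (\<nu> u) (\<phi> u) = 0 \<and>
        (\<forall>v. form22 (\<nu> u) (frechet_derivative \<phi> (at u) v) = 0))"

text \<open>The Levi-Civita connection of \<open>{x. form22 x x = -1}\<close> is the flat derivative followed by the
  orthogonal projection \<open>w \<mapsto> w + form22 w x *\<^sub>R x\<close> onto the tangent space at \<open>x\<close>.\<close>

definition cov_deriv ::
  "(real^2 \<Rightarrow> real^4) \<Rightarrow> (real^2 \<Rightarrow> real^4) \<Rightarrow> real^2 \<Rightarrow> real^2 \<Rightarrow> real^4" where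
  "cov_deriv \<phi> X u v =
     (let w = frechet_derivative X (at u) v in w + form22 w (\<phi> u) *\<^sub>R \<phi> u)"

text \<open>The shape operator \<open>B = \<nabla>N\<close>, transported from the tangent plane of the surface to the
  parameter plane by the isomorphism \<open>d\<phi>\<close>.\<close>

definition shape_operator ::
  "(real^2 \<Rightarrow> real^4) \<Rightarrow> (real^2 \<Rightarrow> real^4) \<Rightarrow> real^2 \<Rightarrow> real^2 \<Rightarrow> real^2" where
  "shape_operator \<phi> \<nu> u v =
     (THE w. frechet_derivative \<phi> (at u) w = cov_deriv \<phi> \<nu> u v)"

definition maximal_surface :: "(real^4) set set \<Rightarrow> bool" where
  "maximal_surface S \<longleftrightarrow>
     spacelike_surface S \<and>
     (\<forall>U \<phi> \<nu> u. surface_chart S U \<phi> \<and> unit_normal_field U \<phi> \<nu> \<and> u \<in> U \<longrightarrow>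
        trace (matrix (shape_operator \<phi> \<nu> u)) = 0)"

text \<open>Both choices of the unit normal are admitted here. They change all principal curvatures by a
  sign, which for a maximal surface leaves the set \<open>{\<lambda>, -\<lambda>}\<close> of principal curvatures unchanged.\<close>

definition is_principal_curvature :: "(real^4) set set \<Rightarrow> (real^4) set \<Rightarrow> real \<Rightarrow> bool" where
  "is_principal_curvature S p k \<longleftrightarrow>
     (\<exists>U \<phi> \<nu> u v. surface_chart S U \<phi> \<and> unit_normal_field U \<phi> \<nu> \<and> u \<in> U \<and> proj (\<phi> u) = p \<and>
        v \<noteq> 0 \<and> shape_operator \<phi> \<nu> u v = k *\<^sub>R v)"

definition nonneg_principal_curvature :: "(real^4) set set \<Rightarrow> (real^4) set \<Rightarrow> real" where
  "nonneg_principal_curvature S p = (THE k. k \<ge> 0 \<and> is_principal_curvature S p k)"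

section \<open>Curvature of the induced metric\<close>

definition partial_deriv :: "2 \<Rightarrow> (real^2 \<Rightarrow> 'b::real_normed_vector) \<Rightarrow> real^2 \<Rightarrow> 'b" where
  "partial_deriv i f u = frechet_derivative f (at u) (axis i 1)"

definition induced_metric :: "(real^2 \<Rightarrow> real^4) \<Rightarrow> real^2 \<Rightarrow> real^2^2" where
  "induced_metric \<phi> u = (\<chi> i j. form22 (partial_deriv i \<phi> u) (partial_deriv j \<phi> u))"

text \<open>\<open>christoffel g k i j\<close> is the symbol with upper index \<open>k\<close> and lower indices \<open>i\<close>, \<open>j\<close>.\<close>

definition christoffel :: "(real^2 \<Rightarrow> real^2^2) \<Rightarrow> 2 \<Rightarrow> 2 \<Rightarrow> 2 \<Rightarrow> real^2 \<Rightarrow> real" where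
  "christoffel g k i j u =
     (\<Sum>l\<in>UNIV. matrix_inv (g u) $ k $ l *
        (partial_deriv i (\<lambda>x. g x $ j $ l) u + partial_deriv j (\<lambda>x. g x $ i $ l) u
          - partial_deriv l (\<lambda>x. g x $ i $ j) u)) / 2"

text \<open>\<open>riemann g l i j k\<close> is the coefficient of \<open>\<partial>\<^sub>l\<close> in \<open>R(\<partial>\<^sub>i, \<partial>\<^sub>j)\<partial>\<^sub>k\<close>, where
  \<open>R(X,Y) = \<nabla>\<^sub>X\<nabla>\<^sub>Y - \<nabla>\<^sub>Y\<nabla>\<^sub>X - \<nabla>\<^bsub>[X,Y]\<^esub>\<close>.\<close>

definition riemann :: "(real^2 \<Rightarrow> real^2^2) \<Rightarrow> 2 \<Rightarrow> 2 \<Rightarrow> 2 \<Rightarrow> 2 \<Rightarrow> real^2 \<Rightarrow> real" where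
  "riemann g l i j k u =
     partial_deriv i (christoffel g l j k) u - partial_deriv j (christoffel g l i k) u
     + (\<Sum>m\<in>UNIV. christoffel g m j k u * christoffel g l i m u
                 - christoffel g m i k u * christoffel g l j m u)"

definition gauss_curvature :: "(real^2 \<Rightarrow> real^2^2) \<Rightarrow> real^2 \<Rightarrow> real" where
  "gauss_curvature g u = (\<Sum>l\<in>UNIV. riemann g l 1 2 2 u * g u $ l $ 1) / det (g u)"

definition nonpositive_curvature :: "(real^4) set set \<Rightarrow> bool" where
  "nonpositive_curvature S \<longleftrightarrow>
     (\<forall>U \<phi> u. surface_chart S U \<phi> \<and> u \<in> U \<longrightarrow> gauss_curvature (induced_metric \<phi>) u \<le> 0)"

section \<open>Entire surfaces and the induced distance\<close>

text \<open>The frontier of a surface is its closure in the projective space minus the surface itself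
  (not its topological boundary, which contains the surface).\<close>

definition entire :: "(real^4) set set \<Rightarrow> bool" where
  "entire S \<longleftrightarrow>
     subtopology RP3 S homeomorphic_space top_of_set (ball (0::real^2) 1) \<and>
     RP3 closure_of S - S \<subseteq> AdS3_boundary"

definition speed :: "(real \<Rightarrow> real^4) \<Rightarrow> real \<Rightarrow> real" where
  "speed c t = sqrt (form22 (vector_derivative c (at t)) (vector_derivative c (at t)))"

text \<open>Curves are again given by lifts to the double cover. Integrability of the speed must be
  required: \<open>valid_path\<close> allows the derivative to be unbounded near the finitely many exceptional
  parameters, and \<open>integral\<close> would assign length 0 to a curve of infinite length.\<close>

definition surface_curve ::
  "(real^4) set set \<Rightarrow> (real^4) set \<Rightarrow> (real^4) set \<Rightarrow> (real \<Rightarrow> real^4) \<Rightarrow> bool" where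
  "surface_curve S p q c \<longleftrightarrow>
     valid_path c \<and> (\<forall>t\<in>{0..1}. form22 (c t) (c t) = -1 \<and> proj (c t) \<in> S) \<and>
     proj (c 0) = p \<and> proj (c 1) = q \<and> speed c integrable_on {0..1}"

definition surface_dist :: "(real^4) set set \<Rightarrow> (real^4) set \<Rightarrow> (real^4) set \<Rightarrow> real" where
  "surface_dist S p q = Inf {integral {0..1} (speed c) | c. surface_curve S p q c}"

end

theory Submission
  imports Defs
begin

text \<open>Write \<open>\<lambda>\<close> for the principal curvature and \<open>h = \<lambda>\<^sup>2\<close>. Integrating along curves, it suffices to
  prove a gradient bound \<open>|\<nabla>\<lambda>| \<le> C (1 - \<lambda>\<^sup>2)\<close> with a universal constant.

  Away from umbilics the principal directions, rescaled by \<open>\<lambda>\<^bsup>-1/2\<^esup>\<close>, commute (Codazzi). They are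
  orthonormal for the flat metric \<open>\<lambda> I\<close>, and the Gauss equation becomes
  \<open>\<Delta> ln \<lambda> = 2 (\<lambda> - 1/\<lambda>)\<close> for the flat Laplacian. For \<open>W = |\<nabla> ln \<lambda>|\<^sup>2\<close> the two-dimensional
  Bochner formula gives an exact expression for \<open>\<Delta> ln W\<close>, and with \<open>f = 1 - \<lambda>\<^sup>2\<close> it follows that
  \<open>Z = \<lambda>\<^sup>3 W / f\<^sup>2 = |\<nabla>\<lambda>|\<^sup>2 / f\<^sup>2\<close> satisfies an inequality \<open>\<Delta> ln Z \<ge> 8 Z - C\<close> for the Laplacian
  of \<open>I\<close>, up to a gradient term that is harmless at a maximum; so \<open>Z\<close> is bounded where it is maximal.

  To localize, \<open>Z\<close> is multiplied by \<open>(3 - G)\<^sup>2\<close>, where \<open>G\<close> is the squared size of the timelike part of the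
  moving frame \<open>(x, N)\<close> relative to the frame at a base point. Since \<open>\<Delta>x = 2 x\<close>, \<open>\<Delta>N = 2 \<lambda>\<^sup>2 N\<close> and
  \<open>\<lambda> \<le> 1\<close>, the gradient and the Laplacian of \<open>G\<close> are bounded where \<open>G \<le> 3\<close>, and that set is compact
  because an entire surface is closed in anti-de Sitter space. A further factor \<open>\<lambda>\<^bsup>\<alpha>\<^esup>\<close>, with \<open>\<alpha>\<close> tending
  to 0 in the end, keeps the maximum away from the umbilics and costs nothing because
  \<open>\<Delta> ln \<lambda>\<close> is bounded for the Laplacian of \<open>I\<close>.\<close>

section \<open>Smooth functions and directional derivatives\<close>

text \<open>Three things obstruct a direct maximum principle: \<open>S\<close> is not compact,
  \<open>\<lambda>\<close> fails to be smooth at umbilics, and \<open>1 - \<lambda>^2\<close> may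
  vanish. As to the first, \<open>G\<close> equals 2 at its own base point while the cutoff level is
  3, so the same cutoff, with value 1 at the base point, serves at every point of every surface;
  hence the universal constant. As to the second, all global objects are built from
  \<open>curv\<close>, which is \<open>\<lambda>^2\<close> and smooth, and principal frames appear
  only near a maximum with \<open>\<lambda> > 0\<close>. As to the third, \<open>f\<close> is
  replaced by \<open>1 + e - \<lambda>^2\<close> with \<open>e > 0\<close> tending to 0. The power
  \<open>\<lambda>^3\<close> in front of \<open>W\<close> turns the flat gradient of
  \<open>ln \<lambda>\<close> into the gradient of \<open>\<lambda>\<close> for the induced metric:
  two factors from the logarithm, one from the metric. The good term \<open>8 Z\<close> comes
  entirely from the Laplacian of \<open>- 2 ln f\<close>.\<close>

abbreviation dd :: "('a::real_normed_vector \<Rightarrow> 'b::real_normed_vector) \<Rightarrow> 'a \<Rightarrow> 'a \<Rightarrow> 'b" where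
  "dd f x \<equiv> frechet_derivative f (at x)"

lemma has_derivative_dd:
  "f differentiable (at x) \<Longrightarrow> (f has_derivative dd f x) (at x)"
  by (simp add: frechet_derivative_works)

lemma dd_eqI: "(f has_derivative f') (at x) \<Longrightarrow> dd f x = f'"
  by (rule frechet_derivative_at [symmetric])

lemma dd_cong_open:
  assumes "open U" "x \<in> U" "\<And>y. y \<in> U \<Longrightarrow> f y = g y"
  shows "dd f x = dd g x"
proof -
  have "(f has_derivative f') (at x) \<longleftrightarrow> (g has_derivative f') (at x)" for f'
    using assms has_derivative_transform_within_open [of f f' x UNIV U g]
      has_derivative_transform_within_open [of g f' x UNIV U f] by metis
  then show ?thesis unfolding frechet_derivative_def by simp
qed

lemma differentiable_cong_open:
  assumes "open U" "x \<in> U" "\<And>y. y \<in> U \<Longrightarrow> f y = g y" "f differentiable (at x)"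
  shows "g differentiable (at x)"
  using assms has_derivative_transform_within_open [of f _ x UNIV U g]
  unfolding differentiable_def by metis

lemma Ck_on_cong:
  assumes "open U" "\<And>y. y \<in> U \<Longrightarrow> f y = g y" "Ck_on k U f"
  shows "Ck_on k U g"
  using assms(2,3)
proof (induction k arbitrary: f g)
  case 0
  then show ?case using continuous_on_cong by force
next
  case (Suc k)
  show ?case unfolding Ck_on.simps
  proof (intro conjI ballI allI)
    fix x assume "x \<in> U" then show "g differentiable at x"
      using Suc.prems differentiable_cong_open [OF \<open>open U\<close>] by (metis Ck_on.simps(2))
  next
    fix v
    have "Ck_on k U (\<lambda>x. dd f x v)" using Suc.prems by simp
    then show "Ck_on k U (\<lambda>x. dd g x v)"
      by (rule Suc.IH [rotated]) (metis dd_cong_open [OF \<open>open U\<close>] Suc.prems(1))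
  qed
qed

lemma Ck_on_subset: "Ck_on k U f \<Longrightarrow> V \<subseteq> U \<Longrightarrow> Ck_on k V f"
  by (induction k arbitrary: f) (auto intro: continuous_on_subset)

lemma Ck_on_Suc_D: "Ck_on (Suc k) U f \<Longrightarrow> Ck_on k U f"
proof (induction k arbitrary: f)
  case 0
  then show ?case
    by (auto intro!: continuous_at_imp_continuous_on differentiable_imp_continuous_within)
next
  case (Suc k)
  have "Ck_on k U (\<lambda>x. dd f x v)" for v using Suc.IH Suc.prems by simp
  then show ?case using Suc.prems by simp
qed

lemma Ck_on_add:
  assumes "open U"
  shows "Ck_on k U f \<Longrightarrow> Ck_on k U g \<Longrightarrow> Ck_on k U (\<lambda>x. f x + g x)"
proof (induction k arbitrary: f g)
  case 0
  then show ?case by (auto intro: continuous_intros)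
next
  case (Suc k)
  show ?case unfolding Ck_on.simps
  proof (intro conjI ballI allI)
    fix x assume "x \<in> U" then show "(\<lambda>x. f x + g x) differentiable at x" using Suc.prems by auto
  next
    fix v
    have "Ck_on k U (\<lambda>x. dd f x v + dd g x v)" using Suc by simp
    moreover have "dd f x v + dd g x v = dd (\<lambda>x. f x + g x) x v" if "x \<in> U" for x
    proof -
      have "((\<lambda>x. f x + g x) has_derivative (\<lambda>v. dd f x v + dd g x v)) (at x)"
        using Suc.prems that by (intro has_derivative_add has_derivative_dd) auto
      from dd_eqI [OF this] show ?thesis by simp
    qed
    ultimately show "Ck_on k U (\<lambda>x. dd (\<lambda>x. f x + g x) x v)"
      using Ck_on_cong [OF \<open>open U\<close>] by (smt (verit, best))
  qed
qed

lemma Ck_on_bilinear: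
  assumes "open U" "bounded_bilinear B"
  shows "Ck_on k U f \<Longrightarrow> Ck_on k U g \<Longrightarrow> Ck_on k U (\<lambda>x. B (f x) (g x))"
proof (induction k arbitrary: f g)
  case 0
  then show ?case using bounded_bilinear.continuous_on [OF assms(2)] by auto
next
  case (Suc k)
  have d: "((\<lambda>x. B (f x) (g x)) has_derivative (\<lambda>v. B (f x) (dd g x v) + B (dd f x v) (g x))) (at x)"
    if "x \<in> U" for x
    using Suc.prems that by (intro bounded_bilinear.FDERIV [OF assms(2)] has_derivative_dd) auto
  show ?case unfolding Ck_on.simps
  proof (intro conjI ballI allI)
    fix x assume "x \<in> U" then show "(\<lambda>x. B (f x) (g x)) differentiable at x"
      using d differentiable_def by blast
  next
    fix v
    have "Ck_on k U (\<lambda>x. B (f x) (dd g x v) + B (dd f x v) (g x))"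
      using Suc.prems by (intro Ck_on_add [OF assms(1)] Suc.IH) (auto intro: Ck_on_Suc_D simp del: Ck_on.simps, auto)
    then show "Ck_on k U (\<lambda>x. dd (\<lambda>x. B (f x) (g x)) x v)"
      by (rule Ck_on_cong [OF assms(1), rotated]) (simp add: dd_eqI [OF d])
  qed
qed

lemma Ck_on_const: "Ck_on k U (\<lambda>x. c)"
  by (induction k arbitrary: c) (auto simp: dd_eqI [OF has_derivative_const])

lemma Ck_on_bounded_linear:
  assumes "open U" "bounded_linear L"
  shows "Ck_on k U f \<Longrightarrow> Ck_on k U (\<lambda>x. L (f x))"
proof (induction k arbitrary: f)
  case 0
  then show ?case using bounded_linear.continuous_on [OF assms(2)] by auto
next
  case (Suc k)
  have d: "((\<lambda>x. L (f x)) has_derivative (\<lambda>v. L (dd f x v))) (at x)" if "x \<in> U" for x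
    using Suc.prems that by (intro bounded_linear.has_derivative [OF assms(2)] has_derivative_dd) auto
  show ?case unfolding Ck_on.simps
  proof (intro conjI ballI allI)
    fix x assume "x \<in> U" then show "(\<lambda>x. L (f x)) differentiable at x"
      using d differentiable_def by blast
  next
    fix v
    have "Ck_on k U (\<lambda>x. L (dd f x v))" using Suc by simp
    then show "Ck_on k U (\<lambda>x. dd (\<lambda>x. L (f x)) x v)"
      by (rule Ck_on_cong [OF assms(1), rotated]) (simp add: dd_eqI [OF d])
  qed
qed

lemma smooth_on_cong:
  "open U \<Longrightarrow> (\<And>y. y \<in> U \<Longrightarrow> f y = g y) \<Longrightarrow> smooth_on U f \<Longrightarrow> smooth_on U g"
  unfolding smooth_on_def using Ck_on_cong by metis

lemma smooth_on_subset: "smooth_on U f \<Longrightarrow> V \<subseteq> U \<Longrightarrow> smooth_on V f"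
  unfolding smooth_on_def using Ck_on_subset by metis

lemma smooth_on_differentiable: "smooth_on U f \<Longrightarrow> x \<in> U \<Longrightarrow> f differentiable (at x)"
  unfolding smooth_on_def by (metis Ck_on.simps(2))

lemma smooth_on_has_derivative: "smooth_on U f \<Longrightarrow> x \<in> U \<Longrightarrow> (f has_derivative dd f x) (at x)"
  by (simp add: has_derivative_dd smooth_on_differentiable)

lemma smooth_on_dd: "smooth_on U f \<Longrightarrow> smooth_on U (\<lambda>x. dd f x v)"
  unfolding smooth_on_def by (metis Ck_on.simps(2))

lemma smooth_on_continuous: "smooth_on U f \<Longrightarrow> continuous_on U f"
  unfolding smooth_on_def by (metis Ck_on.simps(1))

lemma smooth_on_const: "smooth_on U (\<lambda>x. c)"
  unfolding smooth_on_def using Ck_on_const by blast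

lemma smooth_on_add: "open U \<Longrightarrow> smooth_on U f \<Longrightarrow> smooth_on U g \<Longrightarrow> smooth_on U (\<lambda>x. f x + g x)"
  unfolding smooth_on_def using Ck_on_add by blast

lemma smooth_on_bilinear:
  "open U \<Longrightarrow> bounded_bilinear B \<Longrightarrow> smooth_on U f \<Longrightarrow> smooth_on U g \<Longrightarrow> smooth_on U (\<lambda>x. B (f x) (g x))"
  unfolding smooth_on_def using Ck_on_bilinear by blast

lemma smooth_on_bounded_linear:
  "open U \<Longrightarrow> bounded_linear L \<Longrightarrow> smooth_on U f \<Longrightarrow> smooth_on U (\<lambda>x. L (f x))"
  unfolding smooth_on_def using Ck_on_bounded_linear by blast

lemma smooth_on_mult:
  fixes f g :: "'a::real_normed_vector \<Rightarrow> real"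
  shows "open U \<Longrightarrow> smooth_on U f \<Longrightarrow> smooth_on U g \<Longrightarrow> smooth_on U (\<lambda>x. f x * g x)"
  by (rule smooth_on_bilinear [OF _ bounded_bilinear_mult])

lemma smooth_on_scaleR:
  "open U \<Longrightarrow> smooth_on U f \<Longrightarrow> smooth_on U g \<Longrightarrow> smooth_on U (\<lambda>x. f x *\<^sub>R g x)"
  by (rule smooth_on_bilinear [OF _ bounded_bilinear_scaleR])

lemma smooth_on_minus: "open U \<Longrightarrow> smooth_on U f \<Longrightarrow> smooth_on U (\<lambda>x. - f x)"
  by (rule smooth_on_bounded_linear [OF _ bounded_linear_minus [OF bounded_linear_ident]])

lemma smooth_on_diff: "open U \<Longrightarrow> smooth_on U f \<Longrightarrow> smooth_on U g \<Longrightarrow> smooth_on U (\<lambda>x. f x - g x)"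
  using smooth_on_add [of U f "\<lambda>x. - g x"] smooth_on_minus [of U g] by simp

lemma smooth_on_power:
  fixes f :: "'a::real_normed_vector \<Rightarrow> real"
  shows "open U \<Longrightarrow> smooth_on U f \<Longrightarrow> smooth_on U (\<lambda>x. f x ^ n)"
  by (induction n) (auto intro: smooth_on_mult smooth_on_const)

text \<open>The derivative of the reciprocal is a polynomial in the reciprocal itself and a
  derivative of \<open>f\<close>, so the induction on \<open>k\<close> feeds on its own
  hypothesis.\<close>

lemma smooth_on_inverse:
  fixes f :: "'a::real_normed_vector \<Rightarrow> real"
  assumes U: "open U" and f: "smooth_on U f" and nz: "\<And>x. x \<in> U \<Longrightarrow> f x \<noteq> 0"
  shows "smooth_on U (\<lambda>x. inverse (f x))"
proof -
  have d: "((\<lambda>x. inverse (f x)) has_derivative (\<lambda>v. - (inverse (f x) * dd f x v * inverse (f x)))) (at x)"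
    if "x \<in> U" for x
    using has_derivative_compose [OF smooth_on_has_derivative [OF f that] has_derivative_inverse' [OF nz [OF that]]] .
  have "Ck_on k U (\<lambda>x. inverse (f x))" for k
  proof (induction k)
    case 0
    then show ?case using nz smooth_on_continuous [OF f] by (auto intro!: continuous_intros)
  next
    case (Suc k)
    have 1: "Ck_on k U (\<lambda>x. dd f x v)" for v using smooth_on_dd [OF f] smooth_on_def by blast
    have 2: "Ck_on k U (\<lambda>x. - (inverse (f x) * dd f x v * inverse (f x)))" for v
      by (intro Ck_on_bounded_linear [OF U bounded_linear_minus [OF bounded_linear_ident]]
        Ck_on_bilinear [OF U bounded_bilinear_mult] 1 Suc)
    show ?case unfolding Ck_on.simps
    proof (intro conjI ballI allI)
      show "(\<lambda>x. inverse (f x)) differentiable at x" if "x \<in> U" for x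
        using d that differentiable_def by blast
      show "Ck_on k U (\<lambda>x. dd (\<lambda>x. inverse (f x)) x v)" for v
        by (rule Ck_on_cong [OF U _ 2 [where v = v]]) (simp add: dd_eqI [OF d])
    qed
  qed
  then show ?thesis by (simp add: smooth_on_def)
qed

lemma smooth_on_divide:
  fixes f g :: "'a::real_normed_vector \<Rightarrow> real"
  shows "open U \<Longrightarrow> smooth_on U f \<Longrightarrow> smooth_on U g \<Longrightarrow> (\<And>x. x \<in> U \<Longrightarrow> g x \<noteq> 0) \<Longrightarrow> smooth_on U (\<lambda>x. f x / g x)"
  unfolding divide_inverse by (intro smooth_on_mult smooth_on_inverse)

text \<open>The derivative is written with \<open>inverse (f x) * sqrt (f x)\<close> in place of the
  reciprocal of the root, so that the induction on \<open>k\<close> closes as for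
  \<open>inverse\<close>.\<close>

lemma smooth_on_sqrt:
  fixes f :: "'a::real_normed_vector \<Rightarrow> real"
  assumes U: "open U" and f: "smooth_on U f" and pos: "\<And>x. x \<in> U \<Longrightarrow> f x > 0"
  shows "smooth_on U (\<lambda>x. sqrt (f x))"
proof -
  have d: "((\<lambda>x. sqrt (f x)) has_derivative (\<lambda>v. dd f x v * (inverse (f x) * sqrt (f x)) * (1/2))) (at x)"
    if "x \<in> U" for x
  proof -
    have "inverse (sqrt (f x)) = inverse (f x) * sqrt (f x)"
      using pos [OF that] by (simp add: field_simps)
    then show ?thesis
      using has_derivative_real_sqrt [OF pos [OF that] smooth_on_has_derivative [OF f that]]
      by (simp add: mult.assoc)
  qed
  have "Ck_on k U (\<lambda>x. sqrt (f x))" for k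
  proof (induction k)
    case 0
    then show ?case using smooth_on_continuous [OF f] by (auto intro!: continuous_intros)
  next
    case (Suc k)
    have 1: "Ck_on k U (\<lambda>x. dd f x v)" for v using smooth_on_dd [OF f] smooth_on_def by blast
    have 3: "Ck_on k U (\<lambda>x. inverse (f x))"
      using smooth_on_inverse [OF U f] pos smooth_on_def by (metis less_irrefl)
    have 2: "Ck_on k U (\<lambda>x. dd f x v * (inverse (f x) * sqrt (f x)) * (1/2))" for v
      by (intro Ck_on_bilinear [OF U bounded_bilinear_mult] 1 3 Suc Ck_on_const)
    show ?case unfolding Ck_on.simps
    proof (intro conjI ballI allI)
      show "(\<lambda>x. sqrt (f x)) differentiable at x" if "x \<in> U" for x
        using d that differentiable_def by blast
      show "Ck_on k U (\<lambda>x. dd (\<lambda>x. sqrt (f x)) x v)" for v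
        by (rule Ck_on_cong [OF U _ 2 [where v = v]]) (simp add: dd_eqI [OF d])
    qed
  qed
  then show ?thesis by (simp add: smooth_on_def)
qed

lemma smooth_on_ln:
  fixes f :: "'a::real_normed_vector \<Rightarrow> real"
  assumes U: "open U" and f: "smooth_on U f" and pos: "\<And>x. x \<in> U \<Longrightarrow> f x > 0"
  shows "smooth_on U (\<lambda>x. ln (f x))"
proof -
  have d: "((\<lambda>x. ln (f x)) has_derivative (\<lambda>v. dd f x v * inverse (f x))) (at x)" if "x \<in> U" for x
    using has_derivative_ln [OF pos smooth_on_has_derivative [OF f], of x] that
    by (simp add: field_simps)
  have 2: "smooth_on U (\<lambda>x. dd f x v * inverse (f x))" for v
    using pos by (intro smooth_on_mult U smooth_on_dd smooth_on_inverse f) force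
  have "Ck_on k U (\<lambda>x. ln (f x))" for k
  proof (cases k)
    case 0
    have "\<forall>x\<in>U. f x \<noteq> 0" using pos by force
    then show ?thesis using 0 smooth_on_continuous [OF f] by (auto intro!: continuous_intros)
  next
    case (Suc k)
    show ?thesis unfolding Suc Ck_on.simps
    proof (intro conjI ballI allI)
      show "(\<lambda>x. ln (f x)) differentiable at x" if "x \<in> U" for x
        using d that differentiable_def by blast
      show "Ck_on k U (\<lambda>x. dd (\<lambda>x. ln (f x)) x v)" for v
        by (rule Ck_on_cong [OF U _ 2 [where v = v, unfolded smooth_on_def, rule_format]]) (simp add: dd_eqI [OF d])
    qed
  qed
  then show ?thesis by (simp add: smooth_on_def)
qed

section \<open>Symmetry of second derivatives\<close>

lemma line_has_real_derivative:
  fixes g :: "'a::real_normed_vector \<Rightarrow> real"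
  assumes "g differentiable (at (y + a *\<^sub>R d))"
  shows "((\<lambda>a. g (y + a *\<^sub>R d)) has_real_derivative dd g (y + a *\<^sub>R d) d) (at a)"
proof -
  have "((\<lambda>a. y + a *\<^sub>R d) has_derivative (\<lambda>h. h *\<^sub>R d)) (at a)"
    by (auto intro!: derivative_eq_intros)
  from diff_chain_at [OF this has_derivative_dd [OF assms]]
  have *: "((\<lambda>a. g (y + a *\<^sub>R d)) has_derivative (\<lambda>h. dd g (y + a *\<^sub>R d) (h *\<^sub>R d))) (at a)"
    by (simp add: o_def)
  have "linear (dd g (y + a *\<^sub>R d))"
    using has_derivative_dd [OF assms] has_derivative_linear by blast
  then have "(\<lambda>h. dd g (y + a *\<^sub>R d) (h *\<^sub>R d)) = (*) (dd g (y + a *\<^sub>R d) d)"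
    by (simp add: linear_cmul mult.commute fun_eq_iff)
  with * show ?thesis by (simp add: has_field_derivative_def)
qed

text \<open>Two applications of the mean value theorem to the second difference over a
  parallelogram: in direction \<open>v\<close> to the difference of two opposite sides, then in
  direction \<open>w\<close> to the derivative of \<open>f\<close> along \<open>v\<close>. The
  left-hand side is symmetric in \<open>v\<close> and \<open>w\<close>, the right-hand side a priori
  is not.\<close>

lemma mixed_difference_mvt:
  fixes f :: "'a::real_normed_vector \<Rightarrow> real"
  assumes f: "smooth_on U f" and s: "s > 0"
    and cv: "\<And>a b. 0 \<le> a \<Longrightarrow> a \<le> s \<Longrightarrow> 0 \<le> b \<Longrightarrow> b \<le> s \<Longrightarrow> x + a *\<^sub>R v + b *\<^sub>R w \<in> U"
  shows "\<exists>a b. 0 \<le> a \<and> a \<le> s \<and> 0 \<le> b \<and> b \<le> s \<and>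
     f (x + s *\<^sub>R v + s *\<^sub>R w) - f (x + s *\<^sub>R v) - f (x + s *\<^sub>R w) + f x
       = s * s * dd (\<lambda>y. dd f y v) (x + a *\<^sub>R v + b *\<^sub>R w) w"
proof -
  have lin: "((\<lambda>a. g (y + a *\<^sub>R d)) has_real_derivative dd g (y + a *\<^sub>R d) d) (at a)"
    if "smooth_on U g" "y + a *\<^sub>R d \<in> U" for g :: "'a \<Rightarrow> real" and y d a
    by (rule line_has_real_derivative [OF smooth_on_differentiable [OF that]])
  define F where "F = (\<lambda>a. f (x + s *\<^sub>R w + a *\<^sub>R v) - f (x + a *\<^sub>R v))"
  define F' where "F' = (\<lambda>a. dd f (x + s *\<^sub>R w + a *\<^sub>R v) v - dd f (x + a *\<^sub>R v) v)"
  have inU: "x + s *\<^sub>R w + a *\<^sub>R v \<in> U" "x + a *\<^sub>R v \<in> U" if "0 \<le> a" "a \<le> s" for a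
    using cv [OF that, of s] cv [OF that, of 0] s by (auto simp: algebra_simps)
  have "\<exists>z>0. z < s \<and> F s - F 0 = (s - 0) * F' z"
    unfolding F_def F'_def by (rule MVT2 [OF s]) (intro DERIV_diff lin f inU)
  then obtain a where a: "0 < a" "a < s" and Fa: "F s - F 0 = s * F' a" by auto
  define g where "g = (\<lambda>y. dd f y v)"
  have g: "smooth_on U g" unfolding g_def by (rule smooth_on_dd [OF f])
  have "\<exists>z>0. z < s \<and> g (x + a *\<^sub>R v + s *\<^sub>R w) - g (x + a *\<^sub>R v + 0 *\<^sub>R w)
      = (s - 0) * dd g (x + a *\<^sub>R v + z *\<^sub>R w) w"
    by (rule MVT2 [OF s]) (use a cv in \<open>auto intro!: lin g\<close>)
  then obtain b where b: "0 < b" "b < s"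
    and Gb: "g (x + a *\<^sub>R v + s *\<^sub>R w) - g (x + a *\<^sub>R v) = s * dd g (x + a *\<^sub>R v + b *\<^sub>R w) w" by auto
  have "F' a = s * dd g (x + a *\<^sub>R v + b *\<^sub>R w) w"
    using Gb unfolding F'_def g_def by (simp add: algebra_simps)
  then have "F s - F 0 = s * s * dd g (x + a *\<^sub>R v + b *\<^sub>R w) w" using Fa by simp
  moreover have "F s - F 0 = f (x + s *\<^sub>R v + s *\<^sub>R w) - f (x + s *\<^sub>R v) - f (x + s *\<^sub>R w) + f x"
    unfolding F_def by (simp add: algebra_simps)
  ultimately show ?thesis using a b unfolding g_def
    by (intro exI [of _ a] exI [of _ b]) auto
qed

text \<open>The second difference is \<open>s * s\<close> times either mixed derivative, each taken
  somewhere in a small parallelogram. If the two differed at \<open>x\<close>, continuity would keep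
  them apart there.\<close>

lemma dd_commute_real:
  fixes f :: "'a::real_normed_vector \<Rightarrow> real"
  assumes U: "open U" and f: "smooth_on U f" and x: "x \<in> U"
  shows "dd (\<lambda>y. dd f y v) x w = dd (\<lambda>y. dd f y w) x v"
proof (rule ccontr)
  define P where "P = (\<lambda>z. dd (\<lambda>y. dd f y v) z w)"
  define Q where "Q = (\<lambda>z. dd (\<lambda>y. dd f y w) z v)"
  assume "dd (\<lambda>y. dd f y v) x w \<noteq> dd (\<lambda>y. dd f y w) x v"
  then have e: "\<bar>P x - Q x\<bar> / 2 > 0" (is "?e > 0") unfolding P_def Q_def by simp
  have "continuous_on U P" "continuous_on U Q"
    unfolding P_def Q_def by (intro smooth_on_continuous smooth_on_dd f)+
  then have "isCont P x" "isCont Q x"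
    using U x continuous_on_eq_continuous_at by blast+
  then obtain d1 d2 where d1: "d1 > 0" "\<And>y. dist y x < d1 \<Longrightarrow> dist (P y) (P x) < ?e"
      and d2: "d2 > 0" "\<And>y. dist y x < d2 \<Longrightarrow> dist (Q y) (Q x) < ?e"
    using e unfolding continuous_at_eps_delta by (metis dist_norm)
  obtain d3 where d3: "d3 > 0" "ball x d3 \<subseteq> U" using U x open_contains_ball by blast
  define d where "d = min d1 (min d2 d3)"
  \<comment> \<open>This size keeps the whole parallelogram within \<open>d\<close> of
    \<open>x\<close>; the summand 1 keeps the denominator positive when \<open>v\<close> and
    \<open>w\<close> vanish.\<close>
  define s where "s = d / (2 * (norm v + norm w + 1))"
  have nn: "norm v + norm w + 1 > 0" by (smt (verit) norm_ge_zero)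
  have d: "d > 0" unfolding d_def using d1 d2 d3 by simp
  then have s: "s > 0" unfolding s_def using nn by simp
  have near: "dist (x + a *\<^sub>R v + b *\<^sub>R w) x < d" if "0 \<le> a" "a \<le> s" "0 \<le> b" "b \<le> s" for a b
  proof -
    have "dist (x + a *\<^sub>R v + b *\<^sub>R w) x = norm (a *\<^sub>R v + b *\<^sub>R w)"
      by (simp add: dist_norm)
    also have "\<dots> \<le> a * norm v + b * norm w"
      using norm_triangle_ineq [of "a *\<^sub>R v" "b *\<^sub>R w"] that by simp
    also have "\<dots> \<le> s * norm v + s * norm w"
      using that by (intro add_mono mult_right_mono) auto
    also have "\<dots> < s * (2 * (norm v + norm w + 1))"
    proof -
      have "s * norm v \<ge> 0" "s * norm w \<ge> 0" using s by auto
      then have "s * norm v + (s * norm w + s * 2) > 0" using s by linarith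
      then show ?thesis by (simp add: algebra_simps)
    qed
    also have "\<dots> = d" unfolding s_def using nn by simp
    finally show ?thesis .
  qed
  then have inU: "x + a *\<^sub>R v + b *\<^sub>R w \<in> U" if "0 \<le> a" "a \<le> s" "0 \<le> b" "b \<le> s" for a b
    using that d3 unfolding d_def by (force simp: dist_commute)
  have inU': "x + a *\<^sub>R w + b *\<^sub>R v \<in> U" if "0 \<le> a" "a \<le> s" "0 \<le> b" "b \<le> s" for a b
    using inU [of b a] that by (simp add: algebra_simps)
  obtain a b where ab: "0 \<le> a" "a \<le> s" "0 \<le> b" "b \<le> s" and
    1: "f (x + s *\<^sub>R v + s *\<^sub>R w) - f (x + s *\<^sub>R v) - f (x + s *\<^sub>R w) + f x
       = s * s * P (x + a *\<^sub>R v + b *\<^sub>R w)"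
    using mixed_difference_mvt [OF f s inU] unfolding P_def by blast
  obtain a' b' where ab': "0 \<le> a'" "a' \<le> s" "0 \<le> b'" "b' \<le> s" and
    2: "f (x + s *\<^sub>R w + s *\<^sub>R v) - f (x + s *\<^sub>R w) - f (x + s *\<^sub>R v) + f x
       = s * s * Q (x + a' *\<^sub>R w + b' *\<^sub>R v)"
    using mixed_difference_mvt [OF f s inU'] unfolding Q_def by blast
  have "s * s * P (x + a *\<^sub>R v + b *\<^sub>R w) = s * s * Q (x + b' *\<^sub>R v + a' *\<^sub>R w)"
    using 1 2 by (simp add: algebra_simps)
  then have "P (x + a *\<^sub>R v + b *\<^sub>R w) = Q (x + b' *\<^sub>R v + a' *\<^sub>R w)" using s by simp
  moreover have "dist (P (x + a *\<^sub>R v + b *\<^sub>R w)) (P x) < ?e"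
    using near [OF ab] d1 unfolding d_def by simp
  moreover have "dist (Q (x + b' *\<^sub>R v + a' *\<^sub>R w)) (Q x) < ?e"
    using near [of b' a'] ab' d2 unfolding d_def by simp
  ultimately show False unfolding dist_real_def by (auto simp: abs_if split: if_splits)
qed

lemma dd_nth:
  fixes f :: "'a::real_normed_vector \<Rightarrow> real^'n"
  assumes "f differentiable (at x)"
  shows "dd (\<lambda>y. f y $ i) x v = dd f x v $ i"
  using dd_eqI [OF bounded_linear.has_derivative [OF bounded_linear_vec_nth has_derivative_dd [OF assms]]]
  by metis

lemma dd_commute:
  fixes f :: "'a::real_normed_vector \<Rightarrow> real^'n"
  assumes U: "open U" and f: "smooth_on U f" and x: "x \<in> U"
  shows "dd (\<lambda>y. dd f y v) x w = dd (\<lambda>y. dd f y w) x v"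
proof -
  have fi: "smooth_on U (\<lambda>y. f y $ i)" for i
    by (rule smooth_on_bounded_linear [OF U bounded_linear_vec_nth f])
  have "dd (\<lambda>y. dd f y a) x b $ i = dd (\<lambda>y. dd (\<lambda>y. f y $ i) y a) x b" for a b i
  proof -
    have "dd (\<lambda>y. dd (\<lambda>y. f y $ i) y a) x b = dd (\<lambda>y. dd f y a $ i) x b"
      by (subst dd_cong_open [OF U x, of _ "\<lambda>y. dd f y a $ i"])
        (auto intro!: dd_nth smooth_on_differentiable [OF f])
    also have "\<dots> = dd (\<lambda>y. dd f y a) x b $ i"
      by (intro dd_nth smooth_on_differentiable [OF smooth_on_dd [OF f] x])
    finally show ?thesis ..
  qed
  then show ?thesis using dd_commute_real [OF U fi x] by (simp add: vec_eq_iff)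
qed

section \<open>Linear algebra of the form of signature (2,2)\<close>

lemma bilinear_form22: "bilinear form22"
  unfolding bilinear_def form22_def by (auto intro!: linearI simp: algebra_simps)

lemma bounded_bilinear_form22: "bounded_bilinear form22"
  using bilinear_form22 by (simp add: bilinear_conv_bounded_bilinear)

lemma form22_commute: "form22 x y = form22 y x"
  by (simp add: form22_def mult.commute)

lemma form22_simps [simp]:
  "form22 (x + y) z = form22 x z + form22 y z"
  "form22 z (x + y) = form22 z x + form22 z y"
  "form22 (x - y) z = form22 x z - form22 y z"
  "form22 z (x - y) = form22 z x - form22 z y"
  "form22 (c *\<^sub>R x) z = c * form22 x z"
  "form22 z (c *\<^sub>R x) = c * form22 z x"
  "form22 (- x) z = - form22 x z"
  "form22 z (- x) = - form22 z x"
  "form22 0 z = 0"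
  "form22 z 0 = 0"
  by (auto simp: form22_def algebra_simps)

lemma vector_4 [simp]:
  "(vector [x, y, z, w] :: 'a::zero^4) $ 1 = x" "(vector [x, y, z, w] :: 'a^4) $ 2 = y"
  "(vector [x, y, z, w] :: 'a^4) $ 3 = z" "(vector [x, y, z, w] :: 'a^4) $ 4 = w"
  unfolding vector_def by simp_all

text \<open>With the vectors as rows of \<open>A\<close> and the signature \<open>s\<close>,
  orthonormality says that \<open>B\<close> is a right inverse of \<open>A\<close>. For square
  matrices it is then a left inverse too, and \<open>B ** A = mat 1\<close> read entrywise is the
  expansion.\<close>

lemma orthonormal_expansion:
  assumes "form22 e1 e1 = 1" "form22 e2 e2 = 1" "form22 x x = -1" "form22 n n = -1"
    "form22 e1 e2 = 0" "form22 e1 x = 0" "form22 e1 n = 0" "form22 e2 x = 0" "form22 e2 n = 0"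
    "form22 x n = 0"
  shows "z = form22 z e1 *\<^sub>R e1 + form22 z e2 *\<^sub>R e2 - form22 z x *\<^sub>R x - form22 z n *\<^sub>R n"
proof -
  define s :: "real^4" where "s = vector [1, 1, -1, -1]"
  define A :: "real^4^4" where "A = vector [e1, e2, x, n]"
  define B :: "real^4^4" where "B = (\<chi> j i. s$j * s$i * A$i$j)"
  have "A ** B = mat 1"
    using assms unfolding A_def B_def s_def form22_def
    by (simp add: vec_eq_iff forall_4 matrix_matrix_mult_def sum_4 mat_def algebra_simps)
  then have BA: "B ** A = mat 1" by (simp add: matrix_left_right_inverse)
  have *: "(\<Sum>i\<in>UNIV. B$j$i * A$i$k) = (if j = k then 1 else 0)" for j k
    using arg_cong [OF BA, of "\<lambda>M. M$j$k"] by (simp add: matrix_matrix_mult_def mat_def)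
  have "z $ k = (form22 z e1 *\<^sub>R e1 + form22 z e2 *\<^sub>R e2 - form22 z x *\<^sub>R x - form22 z n *\<^sub>R n) $ k" for k
  proof -
    have "z $ k = (\<Sum>j\<in>UNIV. z$j * (\<Sum>i\<in>UNIV. B$j$i * A$i$k))"
      unfolding * by (simp add: if_distrib cong: if_cong)
    then show ?thesis
      unfolding A_def B_def s_def form22_def by (simp add: sum_4 algebra_simps)
  qed
  then show ?thesis by (simp add: vec_eq_iff)
qed

text \<open>Gram-Schmidt applied to \<open>p\<close> and \<open>q\<close> reduces this to an
  orthonormal frame; the coefficients of \<open>p\<close> and \<open>q\<close> come from the inverse
  Gram matrix.\<close>

lemma adapted_expansion:
  assumes x: "form22 x x = -1" "form22 n n = -1" "form22 x n = 0"
    and pq: "form22 p x = 0" "form22 p n = 0" "form22 q x = 0" "form22 q n = 0"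
    and g: "form22 p p = g11" "form22 p q = g12" "form22 q q = g22"
    and pos: "g11 > 0" "g11 * g22 - g12^2 > 0"
  shows "z = ((g22 * form22 z p - g12 * form22 z q) / (g11 * g22 - g12^2)) *\<^sub>R p
     + ((g11 * form22 z q - g12 * form22 z p) / (g11 * g22 - g12^2)) *\<^sub>R q
     - form22 z x *\<^sub>R x - form22 z n *\<^sub>R n"
proof -
  define W where "W = g11 * g22 - g12^2"
  define r where "r = 1 / sqrt g11"
  define s where "s = 1 / sqrt (g11 * W)"
  have W: "W > 0" using pos unfolding W_def by simp
  have r: "r * r = 1 / g11" unfolding r_def using pos by simp
  have s: "s * s = 1 / (g11 * W)" unfolding s_def using pos W by simp
  have qp: "form22 q p = g12" using g form22_commute by metis
  define e1 where "e1 = r *\<^sub>R p"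
  define e2 where "e2 = s *\<^sub>R (g11 *\<^sub>R q - g12 *\<^sub>R p)"
  have e11: "form22 e1 e1 = 1"
    unfolding e1_def using r pos by (simp add: g mult.assoc [symmetric])
  have "form22 e2 e2 = (s * s) * (g11 * W)"
    unfolding e2_def W_def using g qp by (simp add: algebra_simps power2_eq_square)
  then have e22: "form22 e2 e2 = 1" using s pos W by simp
  have "z = form22 z e1 *\<^sub>R e1 + form22 z e2 *\<^sub>R e2 - form22 z x *\<^sub>R x - form22 z n *\<^sub>R n"
    by (rule orthonormal_expansion) (use x pq e11 e22 g qp in \<open>auto simp: e1_def e2_def\<close>)
  moreover have "form22 z e1 *\<^sub>R e1 + form22 z e2 *\<^sub>R e2 =
    (r * r * form22 z p - s * s * (g11 * form22 z q - g12 * form22 z p) * g12) *\<^sub>R p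
    + (s * s * (g11 * form22 z q - g12 * form22 z p) * g11) *\<^sub>R q"
    unfolding e1_def e2_def by (simp add: algebra_simps)
  moreover have "r * r * form22 z p - s * s * (g11 * form22 z q - g12 * form22 z p) * g12
     = (g22 * form22 z p - g12 * form22 z q) / W"
    unfolding r s using pos W by (simp add: field_simps) (simp add: W_def algebra_simps power2_eq_square)
  moreover have "s * s * (g11 * form22 z q - g12 * form22 z p) * g11 = (g11 * form22 z q - g12 * form22 z p) / W"
    unfolding s using pos W by (simp add: field_simps)
  ultimately show ?thesis unfolding W_def by metis
qed

definition cross22 :: "real^4 \<Rightarrow> real^4 \<Rightarrow> real^4 \<Rightarrow> real^4" where
  "cross22 x p q = vector
    [x$2 * (p$3 * q$4 - p$4 * q$3) - x$3 * (p$2 * q$4 - p$4 * q$2) + x$4 * (p$2 * q$3 - p$3 * q$2),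
     - (x$1 * (p$3 * q$4 - p$4 * q$3) - x$3 * (p$1 * q$4 - p$4 * q$1) + x$4 * (p$1 * q$3 - p$3 * q$1)),
     - (x$1 * (p$2 * q$4 - p$4 * q$2) - x$2 * (p$1 * q$4 - p$4 * q$1) + x$4 * (p$1 * q$2 - p$2 * q$1)),
     x$1 * (p$2 * q$3 - p$3 * q$2) - x$2 * (p$1 * q$3 - p$3 * q$1) + x$3 * (p$1 * q$2 - p$2 * q$1)]"

text \<open>The vector \<open>n = cross22 x p q\<close> is characterized by \<open>form22 n y = det (y, x, p, q)\<close>. Its norm is
  computed from the Pluecker coordinates \<open>P\<close> of \<open>p \<and> q\<close>: for \<open>y\<close> the contraction of \<open>x\<close> with
  \<open>p \<and> q\<close>, it is \<open>|x|\<^sup>2 |p \<and> q|\<^sup>2 - |y|\<^sup>2\<close>.\<close>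

lemma cross22_orthogonal:
  "form22 (cross22 x p q) x = 0" "form22 (cross22 x p q) p = 0" "form22 (cross22 x p q) q = 0"
  unfolding form22_def cross22_def by (simp_all add: algebra_simps)

lemma form22_cross22:
  "form22 (cross22 x p q) (cross22 x p q) =
     form22 x x * (form22 p p * form22 q q - form22 p q * form22 p q)
     - form22 x p * (form22 x p * form22 q q - form22 p q * form22 x q)
     + form22 x q * (form22 x p * form22 p q - form22 p p * form22 x q)"
proof -
  define P where "P i j = p$i * q$j - p$j * q$i" for i j
  define y where "y = form22 x p *\<^sub>R q - form22 x q *\<^sub>R p"
  have y: "y $ j = x$1 * P 1 j + x$2 * P 2 j - x$3 * P 3 j - x$4 * P 4 j" for j
    unfolding y_def P_def form22_def by (simp add: algebra_simps)
  have P: "P 1 1 = 0" "P 2 2 = 0" "P 3 3 = 0" "P 4 4 = 0" "P 2 1 = - P 1 2" "P 3 1 = - P 1 3"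
    "P 4 1 = - P 1 4" "P 3 2 = - P 2 3" "P 4 2 = - P 2 4" "P 4 3 = - P 3 4"
    unfolding P_def by simp_all
  have n: "cross22 x p q = vector
    [x$2 * P 3 4 - x$3 * P 2 4 + x$4 * P 2 3, - (x$1 * P 3 4 - x$3 * P 1 4 + x$4 * P 1 3),
     - (x$1 * P 2 4 - x$2 * P 1 4 + x$4 * P 1 2), x$1 * P 2 3 - x$2 * P 1 3 + x$3 * P 1 2]"
    unfolding cross22_def P_def ..
  define a b c d e f where
    "a = P 1 2" "b = P 1 3" "c = P 1 4" "d = P 2 3" "e = P 2 4" "f = P 3 4"
  note abbr = this
  have lagrange: "form22 p p * form22 q q - form22 p q * form22 p q
      = a^2 - b^2 - c^2 - d^2 - e^2 + f^2"
    unfolding abbr P_def form22_def by (simp add: power2_eq_square algebra_simps)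
  have "form22 (cross22 x p q) (cross22 x p q) =
      form22 x x * (a^2 - b^2 - c^2 - d^2 - e^2 + f^2) - form22 y y"
    unfolding form22_def y n P vector_4 abbr [symmetric] by (simp add: power2_eq_square algebra_simps)
  also have "form22 y y = form22 x p * (form22 x p * form22 q q - form22 p q * form22 x q)
     - form22 x q * (form22 x p * form22 p q - form22 p p * form22 x q)"
    unfolding y_def by (simp add: algebra_simps form22_commute [of q p])
  finally show ?thesis unfolding lagrange by simp
qed

lemma vec2_expansion: "v = v$1 *\<^sub>R axis 1 1 + v$2 *\<^sub>R axis 2 (1::real)" for v :: "real^2"
  by (simp add: vec_eq_iff forall_2 axis_def)

lemma linear_vec2_expansion:
  fixes v :: "real^2"
  assumes "linear L"
  shows "L v = v$1 *\<^sub>R L (axis 1 1) + v$2 *\<^sub>R L (axis 2 1)"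
  by (subst vec2_expansion [of v]) (simp only: linear_add [OF assms] linear_scale [OF assms])

section \<open>Calculus of vector fields on the parameter plane\<close>

lemma linear_dd: "f differentiable (at x) \<Longrightarrow> linear (dd f x)"
  using has_derivative_dd has_derivative_linear by blast

definition along :: "(real^2 \<Rightarrow> real^2) \<Rightarrow> (real^2 \<Rightarrow> 'b::real_normed_vector) \<Rightarrow> real^2 \<Rightarrow> 'b" where
  "along \<xi> f u = dd f u (\<xi> u)"

definition bracket :: "(real^2 \<Rightarrow> real^2) \<Rightarrow> (real^2 \<Rightarrow> real^2) \<Rightarrow> real^2 \<Rightarrow> real^2" where
  "bracket \<xi> \<eta> u = dd \<eta> u (\<xi> u) - dd \<xi> u (\<eta> u)"

lemma along_cong: "open U \<Longrightarrow> u \<in> U \<Longrightarrow> (\<And>y. y \<in> U \<Longrightarrow> f y = g y) \<Longrightarrow> along \<xi> f u = along \<xi> g u"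
  unfolding along_def using dd_cong_open by metis

lemma along_const [simp]: "along \<xi> (\<lambda>_. c) u = 0"
  unfolding along_def by (simp add: dd_eqI [OF has_derivative_const])

lemma along_expansion:
  assumes "smooth_on U f" "u \<in> U"
  shows "along \<xi> f u = \<xi> u $ 1 *\<^sub>R dd f u (axis 1 1) + \<xi> u $ 2 *\<^sub>R dd f u (axis 2 1)"
  unfolding along_def
  using linear_vec2_expansion [OF linear_dd [OF smooth_on_differentiable [OF assms]]] .

lemma smooth_on_along:
  assumes U: "open U" and f: "smooth_on U f" and \<xi>: "smooth_on U \<xi>"
  shows "smooth_on U (along \<xi> f)"
proof -
  have "smooth_on U (\<lambda>u. \<xi> u $ i)" for i
    by (rule smooth_on_bounded_linear [OF U bounded_linear_vec_nth \<xi>])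
  then have "smooth_on U (\<lambda>u. \<xi> u $ 1 *\<^sub>R dd f u (axis 1 1) + \<xi> u $ 2 *\<^sub>R dd f u (axis 2 1))"
    by (intro smooth_on_add smooth_on_scaleR smooth_on_dd f U)
  then show ?thesis
    by (rule smooth_on_cong [OF U, rotated]) (simp add: along_expansion [OF f])
qed

context
  fixes U :: "(real^2) set" and u :: "real^2"
  assumes u: "u \<in> U"
begin

lemma along_bilinear:
  assumes "bounded_bilinear B" "smooth_on U f" "smooth_on U g"
  shows "along \<xi> (\<lambda>u. B (f u) (g u)) u = B (f u) (along \<xi> g u) + B (along \<xi> f u) (g u)"
  unfolding along_def
  using dd_eqI [OF bounded_bilinear.FDERIV [OF assms(1) smooth_on_has_derivative [OF assms(2) u] smooth_on_has_derivative [OF assms(3) u]]]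
  by simp

lemma along_linear:
  assumes "bounded_linear L" "smooth_on U f"
  shows "along \<xi> (\<lambda>u. L (f u)) u = L (along \<xi> f u)"
  unfolding along_def
  using dd_eqI [OF bounded_linear.has_derivative [OF assms(1) smooth_on_has_derivative [OF assms(2) u]]] by simp

lemma along_add:
  assumes "smooth_on U f" "smooth_on U g"
  shows "along \<xi> (\<lambda>u. f u + g u) u = along \<xi> f u + along \<xi> g u"
  unfolding along_def
  using dd_eqI [OF has_derivative_add [OF smooth_on_has_derivative [OF assms(1) u] smooth_on_has_derivative [OF assms(2) u]]] by simp

lemma along_minus: "smooth_on U f \<Longrightarrow> along \<xi> (\<lambda>u. - f u) u = - along \<xi> f u"
  by (rule along_linear [OF bounded_linear_minus [OF bounded_linear_ident]])

lemma along_diff: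
  assumes "smooth_on U f" "smooth_on U g"
  shows "along \<xi> (\<lambda>u. f u - g u) u = along \<xi> f u - along \<xi> g u"
  unfolding along_def
  using dd_eqI [OF has_derivative_diff [OF smooth_on_has_derivative [OF assms(1) u] smooth_on_has_derivative [OF assms(2) u]]] by simp

lemmas along_form22 = along_bilinear [OF bounded_bilinear_form22]
lemmas along_scaleR = along_bilinear [OF bounded_bilinear_scaleR]
lemmas along_mult = along_bilinear [OF bounded_bilinear_mult]

lemma along_chain:
  fixes f :: "real^2 \<Rightarrow> real"
  assumes "smooth_on U f" "(g has_real_derivative g') (at (f u))"
  shows "along \<xi> (\<lambda>u. g (f u)) u = g' * along \<xi> f u"
proof -
  have "(g has_derivative (*) g') (at (f u))" using assms(2) by (simp add: has_field_derivative_def)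
  from dd_eqI [OF has_derivative_compose [OF smooth_on_has_derivative [OF assms(1) u] this]]
  show ?thesis unfolding along_def by simp
qed

lemma along_ln:
  fixes f :: "real^2 \<Rightarrow> real"
  assumes "smooth_on U f" "f u > 0"
  shows "along \<xi> (\<lambda>u. ln (f u)) u = along \<xi> f u / f u"
  using along_chain [OF assms(1) DERIV_ln [OF assms(2)]] by (simp add: divide_inverse mult.commute)

lemma along_divide:
  fixes f g :: "real^2 \<Rightarrow> real"
  assumes f: "smooth_on U f" and g: "smooth_on U g" and nz: "g u \<noteq> 0"
  shows "along \<xi> (\<lambda>u. f u / g u) u = (along \<xi> f u * g u - f u * along \<xi> g u) / (g u * g u)"
proof -
  have "((\<lambda>u. f u / g u) has_derivative (\<lambda>h. (dd f u h * g u - f u * dd g u h) / (g u * g u))) (at u)"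
    by (rule has_derivative_divide' [OF smooth_on_has_derivative [OF f u] smooth_on_has_derivative [OF g u] nz])
  from dd_eqI [OF this] show ?thesis unfolding along_def by simp
qed

end

text \<open>The second-order part depends only on the values of the two fields at \<open>u\<close>;
  the last summand is of first order. It becomes the bracket in the commutator and disappears at a
  critical point.\<close>

lemma along_along:
  assumes U: "open U" and f: "smooth_on U f" and \<xi>: "smooth_on U \<xi>" and \<eta>: "smooth_on U \<eta>" and u: "u \<in> U"
  shows "along \<xi> (along \<eta> f) u =
    (\<eta> u $ 1 * \<xi> u $ 1) *\<^sub>R dd (\<lambda>y. dd f y (axis 1 1)) u (axis 1 1)
    + (\<eta> u $ 1 * \<xi> u $ 2) *\<^sub>R dd (\<lambda>y. dd f y (axis 1 1)) u (axis 2 1)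
    + (\<eta> u $ 2 * \<xi> u $ 1) *\<^sub>R dd (\<lambda>y. dd f y (axis 2 1)) u (axis 1 1)
    + (\<eta> u $ 2 * \<xi> u $ 2) *\<^sub>R dd (\<lambda>y. dd f y (axis 2 1)) u (axis 2 1)
    + dd f u (dd \<eta> u (\<xi> u))"
proof -
  have \<eta>i: "smooth_on U (\<lambda>u. \<eta> u $ i)" for i
    by (rule smooth_on_bounded_linear [OF U bounded_linear_vec_nth \<eta>])
  have s: "smooth_on U (\<lambda>u. \<eta> u $ i *\<^sub>R dd f u (axis j 1))" for i j
    by (intro smooth_on_scaleR U \<eta>i smooth_on_dd f)
  have "along \<xi> (along \<eta> f) u = along \<xi> (\<lambda>u. \<eta> u $ 1 *\<^sub>R dd f u (axis 1 1) + \<eta> u $ 2 *\<^sub>R dd f u (axis 2 1)) u"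
    by (rule along_cong [OF U u]) (simp add: along_expansion [OF f])
  also have "\<dots> = \<eta> u $ 1 *\<^sub>R along \<xi> (\<lambda>u. dd f u (axis 1 1)) u + along \<xi> (\<lambda>u. \<eta> u $ 1) u *\<^sub>R dd f u (axis 1 1)
     + (\<eta> u $ 2 *\<^sub>R along \<xi> (\<lambda>u. dd f u (axis 2 1)) u + along \<xi> (\<lambda>u. \<eta> u $ 2) u *\<^sub>R dd f u (axis 2 1))"
    by (simp only: along_add [OF u s s] along_scaleR [OF u \<eta>i smooth_on_dd [OF f]])
  finally have "along \<xi> (along \<eta> f) u = \<eta> u $ 1 *\<^sub>R along \<xi> (\<lambda>u. dd f u (axis 1 1)) u
     + \<eta> u $ 2 *\<^sub>R along \<xi> (\<lambda>u. dd f u (axis 2 1)) u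
     + (along \<xi> (\<lambda>u. \<eta> u $ 1) u *\<^sub>R dd f u (axis 1 1) + along \<xi> (\<lambda>u. \<eta> u $ 2) u *\<^sub>R dd f u (axis 2 1))"
    by simp
  moreover have "along \<xi> (\<lambda>u. \<eta> u $ i) u = dd \<eta> u (\<xi> u) $ i" for i
    using along_linear [OF u bounded_linear_vec_nth \<eta>, of \<xi> i] by (simp add: along_def)
  moreover have "dd f u (dd \<eta> u (\<xi> u)) = dd \<eta> u (\<xi> u) $ 1 *\<^sub>R dd f u (axis 1 1) + dd \<eta> u (\<xi> u) $ 2 *\<^sub>R dd f u (axis 2 1)"
    by (rule linear_vec2_expansion [OF linear_dd [OF smooth_on_differentiable [OF f u]]])
  ultimately show ?thesis
    by (simp add: along_expansion [OF smooth_on_dd [OF f] u] scaleR_add_right)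
qed

lemma along_commutator_aux:
  assumes U: "open U" and f: "smooth_on U f" and \<xi>: "smooth_on U \<xi>" and \<eta>: "smooth_on U \<eta>" and u: "u \<in> U"
    and sym: "dd (\<lambda>y. dd f y (axis 1 1)) u (axis 2 1) = dd (\<lambda>y. dd f y (axis 2 1)) u (axis 1 1)"
  shows "along \<xi> (along \<eta> f) u - along \<eta> (along \<xi> f) u = dd f u (bracket \<xi> \<eta> u)"
  unfolding along_along [OF U f \<xi> \<eta> u] along_along [OF U f \<eta> \<xi> u] sym bracket_def
    linear_diff [OF linear_dd [OF smooth_on_differentiable [OF f u]]]
  by (simp add: algebra_simps)

lemma along_commutator_real:
  fixes f :: "real^2 \<Rightarrow> real"
  assumes U: "open U" and f: "smooth_on U f" and \<xi>: "smooth_on U \<xi>" and \<eta>: "smooth_on U \<eta>" and u: "u \<in> U"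
  shows "along \<xi> (along \<eta> f) u - along \<eta> (along \<xi> f) u = dd f u (bracket \<xi> \<eta> u)"
  by (rule along_commutator_aux [OF assms dd_commute_real [OF U f u]])

lemma along_commutator:
  fixes f :: "real^2 \<Rightarrow> real^'n"
  assumes U: "open U" and f: "smooth_on U f" and \<xi>: "smooth_on U \<xi>" and \<eta>: "smooth_on U \<eta>" and u: "u \<in> U"
  shows "along \<xi> (along \<eta> f) u - along \<eta> (along \<xi> f) u = dd f u (bracket \<xi> \<eta> u)"
  by (rule along_commutator_aux [OF assms dd_commute [OF U f u]])

text \<open>At a critical point the field may be replaced by the constant vector
  \<open>v = \<xi> u\<close>, which leaves a question in one variable: if the second derivative
  along \<open>v\<close> were positive, the first would be positive shortly after \<open>u\<close>,
  and the mean value theorem would give a larger value of \<open>f\<close>.\<close>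

lemma max_second_derivative:
  fixes f :: "real^2 \<Rightarrow> real"
  assumes U: "open U" and f: "smooth_on U f" and \<xi>: "smooth_on U \<xi>" and u: "u \<in> U"
    and max: "\<And>y. y \<in> U \<Longrightarrow> f y \<le> f u"
  shows "dd f u = (\<lambda>v. 0)" "along \<xi> f u = 0" "along \<xi> (along \<xi> f) u \<le> 0"
proof -
  show df: "dd f u = (\<lambda>v. 0)"
    using differential_zero_maxmin [OF u U smooth_on_has_derivative [OF f u]] max by blast
  then show "along \<xi> f u = 0" by (simp add: along_def)
  define v where "v = \<xi> u"
  define g where "g = (\<lambda>y. dd f y v)"
  have g: "smooth_on U g" unfolding g_def by (rule smooth_on_dd [OF f])
  have "along \<xi> (along \<xi> f) u = along (\<lambda>_. v) (along (\<lambda>_. v) f) u"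
    unfolding along_along [OF U f \<xi> \<xi> u] along_along [OF U f smooth_on_const smooth_on_const u] df v_def by simp
  then have eq: "along \<xi> (along \<xi> f) u = dd g u v" unfolding along_def g_def .
  show "along \<xi> (along \<xi> f) u \<le> 0"
  proof (rule ccontr)
    assume "\<not> ?thesis"
    then have pos: "dd g u v > 0" using eq by simp
    have "((\<lambda>a. g (u + a *\<^sub>R v)) has_real_derivative dd g u v) (at 0)"
      using line_has_real_derivative [of g u 0 v] smooth_on_differentiable [OF g u] by simp
    from DERIV_pos_inc_right [OF this pos]
    obtain d where d: "d > 0" "\<And>h. 0 < h \<Longrightarrow> h < d \<Longrightarrow> g (u + h *\<^sub>R v) > 0"
      using df by (auto simp: g_def)
    obtain r where r: "r > 0" "ball u r \<subseteq> U" using U u open_contains_ball by blast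
    define s where "s = min (d/2) (r / (2 * (norm v + 1)))"
    have nv: "norm v + 1 > 0" by (smt (verit) norm_ge_zero)
    have s: "s > 0" "s < d" unfolding s_def using d r nv by auto
    have inU: "u + a *\<^sub>R v \<in> U" if "0 \<le> a" "a \<le> s" for a
    proof -
      have "norm (a *\<^sub>R v) \<le> s * norm v" using that by (simp add: mult_right_mono)
      also have "\<dots> < s * (2 * (norm v + 1))" using s(1) nv by (intro mult_strict_left_mono) (simp_all add: algebra_simps)
      also have "\<dots> \<le> r"
      proof -
        have "s \<le> r / (2 * (norm v + 1))" unfolding s_def by simp
        then show ?thesis using nv by (simp add: pos_le_divide_eq)
      qed
      finally have "u + a *\<^sub>R v \<in> ball u r" by (simp add: dist_norm)
      then show ?thesis using r by blast
    qed
    have "\<exists>z>0. z < s \<and> f (u + s *\<^sub>R v) - f (u + 0 *\<^sub>R v) = (s - 0) * g (u + z *\<^sub>R v)"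
      unfolding g_def
      by (rule MVT2 [OF s(1)]) (intro line_has_real_derivative smooth_on_differentiable [OF f] inU)
    then obtain z where z: "0 < z" "z < s" "f (u + s *\<^sub>R v) - f u = s * g (u + z *\<^sub>R v)" by auto
    have "g (u + z *\<^sub>R v) > 0" using d z s by auto
    then have "f (u + s *\<^sub>R v) > f u" using z s by (smt (verit) mult_pos_pos)
    then show False using max [OF inU [of s]] s by simp
  qed
qed

lemma smooth_on_vec_nth: "open U \<Longrightarrow> smooth_on U f \<Longrightarrow> smooth_on U (\<lambda>u. f u $ i)"
  by (rule smooth_on_bounded_linear [OF _ bounded_linear_vec_nth])

lemma smooth_on_form22: "open U \<Longrightarrow> smooth_on U f \<Longrightarrow> smooth_on U g \<Longrightarrow> smooth_on U (\<lambda>u. form22 (f u) (g u))"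
  by (rule smooth_on_bilinear [OF _ bounded_bilinear_form22])

lemma smooth_on_vector_4:
  assumes "open U" "smooth_on U a" "smooth_on U b" "smooth_on U c" "smooth_on U d"
  shows "smooth_on U (\<lambda>u. vector [a u, b u, c u, d u] :: real^4)"
proof -
  have "vector [a u, b u, c u, d u] = a u *\<^sub>R axis 1 1 + b u *\<^sub>R axis 2 1 + c u *\<^sub>R axis 3 1
      + d u *\<^sub>R (axis 4 1 :: real^4)" for u
    by (simp add: vec_eq_iff forall_4 axis_def)
  then show ?thesis
    using assms by (simp only:) (intro smooth_on_add smooth_on_scaleR smooth_on_const assms)
qed

lemma smooth_on_cross22:
  assumes "open U" "smooth_on U x" "smooth_on U p" "smooth_on U q"
  shows "smooth_on U (\<lambda>u. cross22 (x u) (p u) (q u))"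
  unfolding cross22_def
  by (intro smooth_on_vector_4 smooth_on_add smooth_on_diff smooth_on_minus smooth_on_mult smooth_on_vec_nth assms)

lemmas smooth_intros = smooth_on_const smooth_on_add smooth_on_diff smooth_on_minus smooth_on_mult
  smooth_on_scaleR smooth_on_power smooth_on_form22 smooth_on_vec_nth smooth_on_dd smooth_on_cross22

section \<open>Spacelike immersions\<close>

text \<open>First and second fundamental form of a parametrized surface in the quadric
  \<open>{x. form22 x x = -1}\<close>; the sign convention of the second one is that of \<open>B = \<nabla>N\<close>.\<close>

definition \<phi>\<^sub>1 :: "(real^2 \<Rightarrow> real^4) \<Rightarrow> real^2 \<Rightarrow> real^4" where "\<phi>\<^sub>1 \<phi> u = dd \<phi> u (axis 1 1)"
definition \<phi>\<^sub>2 :: "(real^2 \<Rightarrow> real^4) \<Rightarrow> real^2 \<Rightarrow> real^4" where "\<phi>\<^sub>2 \<phi> u = dd \<phi> u (axis 2 1)"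

definition "g11 \<phi> u = form22 (\<phi>\<^sub>1 \<phi> u) (\<phi>\<^sub>1 \<phi> u)"
definition "g12 \<phi> u = form22 (\<phi>\<^sub>1 \<phi> u) (\<phi>\<^sub>2 \<phi> u)"
definition "g22 \<phi> u = form22 (\<phi>\<^sub>2 \<phi> u) (\<phi>\<^sub>2 \<phi> u)"
definition "gdet \<phi> u = g11 \<phi> u * g22 \<phi> u - g12 \<phi> u ^ 2"

text \<open>No orientation of the surface enters: each chart has a smooth normal of its own, and the
  normals of overlapping charts may differ by a sign.\<close>

definition normal :: "(real^2 \<Rightarrow> real^4) \<Rightarrow> real^2 \<Rightarrow> real^4" where
  "normal \<phi> u = (1 / sqrt (gdet \<phi> u)) *\<^sub>R cross22 (\<phi> u) (\<phi>\<^sub>1 \<phi> u) (\<phi>\<^sub>2 \<phi> u)"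

definition "b11 \<phi> u = form22 (\<phi>\<^sub>1 (normal \<phi>) u) (\<phi>\<^sub>1 \<phi> u)"
definition "b12 \<phi> u = form22 (\<phi>\<^sub>1 (normal \<phi>) u) (\<phi>\<^sub>2 \<phi> u)"
definition "b22 \<phi> u = form22 (\<phi>\<^sub>2 (normal \<phi>) u) (\<phi>\<^sub>2 \<phi> u)"

text \<open>This is \<open>- det B\<close>, which equals \<open>\<lambda>\<^sup>2\<close> for a maximal immersion.\<close>

definition curv :: "(real^2 \<Rightarrow> real^4) \<Rightarrow> real^2 \<Rightarrow> real" where
  "curv \<phi> u = (b12 \<phi> u ^ 2 - b11 \<phi> u * b22 \<phi> u) / gdet \<phi> u"

locale spacelike_immersion =
  fixes U :: "(real^2) set" and \<phi> :: "real^2 \<Rightarrow> real^4"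
  assumes open_U: "open U" and smooth_\<phi>: "smooth_on U \<phi>"
    and norm_\<phi>: "\<And>u. u \<in> U \<Longrightarrow> form22 (\<phi> u) (\<phi> u) = -1"
    and spacelike: "\<And>u v. u \<in> U \<Longrightarrow> v \<noteq> 0 \<Longrightarrow> form22 (dd \<phi> u v) (dd \<phi> u v) > 0"
begin

lemma linear_d\<phi>: "u \<in> U \<Longrightarrow> linear (dd \<phi> u)"
  by (rule linear_dd [OF smooth_on_differentiable [OF smooth_\<phi>]])

lemma d\<phi>_expansion: "u \<in> U \<Longrightarrow> dd \<phi> u v = v$1 *\<^sub>R \<phi>\<^sub>1 \<phi> u + v$2 *\<^sub>R \<phi>\<^sub>2 \<phi> u"
  unfolding \<phi>\<^sub>1_def \<phi>\<^sub>2_def by (rule linear_vec2_expansion [OF linear_d\<phi>])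

lemma metric_expansion:
  "u \<in> U \<Longrightarrow> form22 (dd \<phi> u v) (dd \<phi> u w) =
     v$1 * w$1 * g11 \<phi> u + (v$1 * w$2 + v$2 * w$1) * g12 \<phi> u + v$2 * w$2 * g22 \<phi> u"
  unfolding d\<phi>_expansion g11_def g12_def g22_def
  by (simp add: algebra_simps form22_commute [of "\<phi>\<^sub>2 \<phi> u" "\<phi>\<^sub>1 \<phi> u"])

lemma inj_d\<phi>: "u \<in> U \<Longrightarrow> dd \<phi> u v = dd \<phi> u w \<Longrightarrow> v = w"
  using spacelike [of u "v - w"] linear_diff [OF linear_d\<phi>, of u v w] by fastforce

lemma g11_pos: "u \<in> U \<Longrightarrow> g11 \<phi> u > 0"
  using spacelike [of u "axis 1 1"] by (simp add: g11_def \<phi>\<^sub>1_def axis_eq_0_iff)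

lemma gdet_pos:
  assumes u: "u \<in> U" shows "gdet \<phi> u > 0"
proof -
  \<comment> \<open>Orthogonal to the first coordinate vector; its squared length is
    \<open>g11 \<phi> u * gdet \<phi> u\<close>.\<close>
  define v :: "real^2" where "v = vector [- g12 \<phi> u, g11 \<phi> u]"
  have "v \<noteq> 0" using g11_pos [OF u] unfolding v_def by (auto simp: vec_eq_iff forall_2)
  from spacelike [OF u this] have "g11 \<phi> u * gdet \<phi> u > 0"
    unfolding metric_expansion [OF u] v_def gdet_def by (simp add: algebra_simps power2_eq_square)
  then show ?thesis using g11_pos [OF u] by (simp add: zero_less_mult_iff)
qed

lemma g22_pos: assumes u: "u \<in> U" shows "g22 \<phi> u > 0"
  using spacelike [of u "axis 2 1"] u by (simp add: g22_def \<phi>\<^sub>2_def axis_eq_0_iff)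

lemma \<phi>_d\<phi>:
  assumes u: "u \<in> U" shows "form22 (\<phi> u) (dd \<phi> u v) = 0"
proof -
  have "along (\<lambda>_. v) (\<lambda>u. form22 (\<phi> u) (\<phi> u)) u = along (\<lambda>_. v) (\<lambda>_. -1) u"
    by (rule along_cong [OF open_U u]) (rule norm_\<phi>)
  then show ?thesis
    unfolding along_form22 [OF u smooth_\<phi> smooth_\<phi>]
    by (simp add: along_def form22_commute)
qed

lemma smooth_basic:
  "smooth_on U (\<phi>\<^sub>1 \<phi>)" "smooth_on U (\<phi>\<^sub>2 \<phi>)" "smooth_on U (g11 \<phi>)" "smooth_on U (g12 \<phi>)"
  "smooth_on U (g22 \<phi>)" "smooth_on U (gdet \<phi>)" "smooth_on U (normal \<phi>)"
proof -
  show 1: "smooth_on U (\<phi>\<^sub>1 \<phi>)" "smooth_on U (\<phi>\<^sub>2 \<phi>)"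
    unfolding \<phi>\<^sub>1_def [abs_def] \<phi>\<^sub>2_def [abs_def] by (intro smooth_on_dd smooth_\<phi>)+
  show 2: "smooth_on U (g11 \<phi>)" "smooth_on U (g12 \<phi>)" "smooth_on U (g22 \<phi>)"
    unfolding g11_def [abs_def] g12_def [abs_def] g22_def [abs_def]
    by (intro smooth_on_form22 open_U 1)+
  show 3: "smooth_on U (gdet \<phi>)"
    unfolding gdet_def [abs_def] by (intro smooth_intros open_U 2)
  have "sqrt (gdet \<phi> u) \<noteq> 0" if "u \<in> U" for u using gdet_pos [OF that] by simp
  then show "smooth_on U (normal \<phi>)"
    unfolding normal_def [abs_def]
    by (intro smooth_on_scaleR smooth_on_divide smooth_on_sqrt smooth_on_cross22 smooth_on_const
      gdet_pos open_U 1 3 smooth_\<phi>)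
qed

lemma normal_orthogonal:
  assumes u: "u \<in> U"
  shows "form22 (normal \<phi> u) (normal \<phi> u) = -1" "form22 (normal \<phi> u) (\<phi> u) = 0"
    "form22 (normal \<phi> u) (dd \<phi> u v) = 0"
proof -
  have x: "form22 (\<phi> u) (\<phi>\<^sub>1 \<phi> u) = 0" "form22 (\<phi> u) (\<phi>\<^sub>2 \<phi> u) = 0"
    unfolding \<phi>\<^sub>1_def \<phi>\<^sub>2_def by (rule \<phi>_d\<phi> [OF u])+
  have "form22 (cross22 (\<phi> u) (\<phi>\<^sub>1 \<phi> u) (\<phi>\<^sub>2 \<phi> u)) (cross22 (\<phi> u) (\<phi>\<^sub>1 \<phi> u) (\<phi>\<^sub>2 \<phi> u)) = - gdet \<phi> u"
    unfolding form22_cross22 x norm_\<phi> [OF u] gdet_def g11_def g12_def g22_def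
    by (simp add: power2_eq_square)
  then have "form22 (normal \<phi> u) (normal \<phi> u) = - (gdet \<phi> u / (sqrt (gdet \<phi> u) * sqrt (gdet \<phi> u)))"
    unfolding normal_def by simp
  then show "form22 (normal \<phi> u) (normal \<phi> u) = -1" using gdet_pos [OF u] by simp
  show "form22 (normal \<phi> u) (\<phi> u) = 0" "form22 (normal \<phi> u) (dd \<phi> u v) = 0"
    unfolding d\<phi>_expansion [OF u] normal_def by (simp_all add: cross22_orthogonal)
qed

lemma unit_normal_field_normal: "unit_normal_field U \<phi> (normal \<phi>)"
  unfolding unit_normal_field_def using smooth_basic(7) normal_orthogonal by blast

text \<open>Allows any unit normal \<open>n\<close>, because principal curvatures are defined with
  arbitrary unit normal fields.\<close>

lemma tangent_expansion:
  assumes u: "u \<in> U" and n: "form22 n n = -1" "form22 n (\<phi> u) = 0" "\<And>v. form22 n (dd \<phi> u v) = 0"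
  shows "z = ((g22 \<phi> u * form22 z (\<phi>\<^sub>1 \<phi> u) - g12 \<phi> u * form22 z (\<phi>\<^sub>2 \<phi> u)) / gdet \<phi> u) *\<^sub>R \<phi>\<^sub>1 \<phi> u
     + ((g11 \<phi> u * form22 z (\<phi>\<^sub>2 \<phi> u) - g12 \<phi> u * form22 z (\<phi>\<^sub>1 \<phi> u)) / gdet \<phi> u) *\<^sub>R \<phi>\<^sub>2 \<phi> u
     - form22 z (\<phi> u) *\<^sub>R \<phi> u - form22 z n *\<^sub>R n"
  unfolding gdet_def
proof (rule adapted_expansion)
  show "form22 (\<phi> u) (\<phi> u) = -1" by (rule norm_\<phi> [OF u])
  show "0 < g11 \<phi> u" by (rule g11_pos [OF u])
  show "0 < g11 \<phi> u * g22 \<phi> u - (g12 \<phi> u)\<^sup>2" using gdet_pos [OF u] unfolding gdet_def .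
  show "form22 (\<phi>\<^sub>1 \<phi> u) (\<phi> u) = 0" "form22 (\<phi>\<^sub>2 \<phi> u) (\<phi> u) = 0" 
    using \<phi>_d\<phi> [OF u] unfolding \<phi>\<^sub>1_def \<phi>\<^sub>2_def by (simp_all add: form22_commute)
qed (use n in \<open>auto simp: g11_def g12_def g22_def \<phi>\<^sub>1_def \<phi>\<^sub>2_def form22_commute\<close>)

lemma unit_normal_unique:
  assumes u: "u \<in> U" and n: "form22 n n = -1" "form22 n (\<phi> u) = 0" "\<And>v. form22 n (dd \<phi> u v) = 0"
    and m: "form22 m m = -1" "form22 m (\<phi> u) = 0" "\<And>v. form22 m (dd \<phi> u v) = 0"
  shows "n = m \<or> n = - m"
proof -
  have "n = - form22 n m *\<^sub>R m"
    using tangent_expansion [OF u m, of n] n by (simp add: \<phi>\<^sub>1_def \<phi>\<^sub>2_def)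
  moreover from this have "-1 = form22 n m * form22 n m * form22 m m"
    using n(1) form22_simps(5) form22_simps(6) by (metis (no_types, lifting) minus_mult_minus mult.assoc)
  then have "form22 n m * form22 n m = 1" using m by simp
  then have "form22 n m = 1 \<or> form22 n m = -1" by (simp add: square_eq_1_iff)
  ultimately show ?thesis by (metis add.inverse_inverse scaleR_minus1_left scaleR_one)
qed

text \<open>Differentiation of three orthogonality relations. By the first two,
  \<open>dd \<nu> u v\<close> is tangent to the surface, so the projection in
  \<open>cov_deriv\<close> changes nothing. The third makes the second fundamental form symmetric,
  because second derivatives commute.\<close>

lemma normal_field_derivative:
  assumes \<nu>: "unit_normal_field U \<phi> \<nu>" and u: "u \<in> U"
  shows "form22 (dd \<nu> u v) (\<nu> u) = 0" "form22 (dd \<nu> u v) (\<phi> u) = 0"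
    "form22 (dd \<nu> u v) (dd \<phi> u w) = - form22 (\<nu> u) (dd (\<lambda>y. dd \<phi> y w) u v)"
proof -
  have s: "smooth_on U \<nu>" and n: "\<And>u. u \<in> U \<Longrightarrow> form22 (\<nu> u) (\<nu> u) = -1"
    "\<And>u. u \<in> U \<Longrightarrow> form22 (\<nu> u) (\<phi> u) = 0" "\<And>u v. u \<in> U \<Longrightarrow> form22 (\<nu> u) (dd \<phi> u v) = 0"
    using \<nu> unfolding unit_normal_field_def by auto
  have "along (\<lambda>_. v) (\<lambda>u. form22 (\<nu> u) (\<nu> u)) u = along (\<lambda>_. v) (\<lambda>_. -1) u"
    by (rule along_cong [OF open_U u]) (rule n)
  then show "form22 (dd \<nu> u v) (\<nu> u) = 0"
    unfolding along_form22 [OF u s s] by (simp add: along_def form22_commute)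
  have "along (\<lambda>_. v) (\<lambda>u. form22 (\<nu> u) (\<phi> u)) u = along (\<lambda>_. v) (\<lambda>_. 0) u"
    by (rule along_cong [OF open_U u]) (rule n)
  then show "form22 (dd \<nu> u v) (\<phi> u) = 0"
    unfolding along_form22 [OF u s smooth_\<phi>] using n(3) [OF u] by (simp add: along_def)
  have "along (\<lambda>_. v) (\<lambda>u. form22 (\<nu> u) (dd \<phi> u w)) u = along (\<lambda>_. v) (\<lambda>_. 0) u"
    by (rule along_cong [OF open_U u]) (rule n)
  then show "form22 (dd \<nu> u v) (dd \<phi> u w) = - form22 (\<nu> u) (dd (\<lambda>y. dd \<phi> y w) u v)"
    unfolding along_form22 [OF u s smooth_on_dd [OF smooth_\<phi>]] by (simp add: along_def)
qed

lemma shape_operator_exists: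
  assumes \<nu>: "unit_normal_field U \<phi> \<nu>" and u: "u \<in> U"
  shows "\<exists>w. dd \<phi> u w = dd \<nu> u v"
proof -
  have n: "form22 (\<nu> u) (\<nu> u) = -1" "form22 (\<nu> u) (\<phi> u) = 0" "\<And>v. form22 (\<nu> u) (dd \<phi> u v) = 0"
    using \<nu> u unfolding unit_normal_field_def by auto
  define z where "z = dd \<nu> u v"
  define w :: "real^2" where "w = vector
    [(g22 \<phi> u * form22 z (\<phi>\<^sub>1 \<phi> u) - g12 \<phi> u * form22 z (\<phi>\<^sub>2 \<phi> u)) / gdet \<phi> u,
     (g11 \<phi> u * form22 z (\<phi>\<^sub>2 \<phi> u) - g12 \<phi> u * form22 z (\<phi>\<^sub>1 \<phi> u)) / gdet \<phi> u]"
  have "dd \<phi> u w = z"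
    using tangent_expansion [OF u n, of z] normal_field_derivative [OF \<nu> u, of v]
    unfolding d\<phi>_expansion [OF u] w_def z_def by simp
  then show ?thesis unfolding z_def by blast
qed

lemma shape_operator_eq_iff:
  assumes \<nu>: "unit_normal_field U \<phi> \<nu>" and u: "u \<in> U"
  shows "shape_operator \<phi> \<nu> u v = w \<longleftrightarrow> dd \<phi> u w = dd \<nu> u v"
proof -
  have c: "cov_deriv \<phi> \<nu> u v = dd \<nu> u v"
    unfolding cov_deriv_def Let_def using normal_field_derivative(2) [OF \<nu> u] by simp
  obtain w' where w': "dd \<phi> u w' = dd \<nu> u v" using shape_operator_exists [OF \<nu> u] by blast
  have "shape_operator \<phi> \<nu> u v = w'"
    unfolding shape_operator_def c using w' inj_d\<phi> [OF u] by (intro the_equality) auto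
  then show ?thesis using w' inj_d\<phi> [OF u] by metis
qed

end

section \<open>The second fundamental form and the Gauss equation\<close>

context spacelike_immersion
begin

lemma linear_d\<nu>: "u \<in> U \<Longrightarrow> linear (dd (normal \<phi>) u)"
  by (rule linear_dd [OF smooth_on_differentiable [OF smooth_basic(7)]])

lemma d\<nu>_expansion: "u \<in> U \<Longrightarrow> dd (normal \<phi>) u v = v$1 *\<^sub>R \<phi>\<^sub>1 (normal \<phi>) u + v$2 *\<^sub>R \<phi>\<^sub>2 (normal \<phi>) u"
  unfolding \<phi>\<^sub>1_def \<phi>\<^sub>2_def by (rule linear_vec2_expansion [OF linear_d\<nu>])

lemma second_form_symmetric:
  assumes u: "u \<in> U"
  shows "form22 (dd (normal \<phi>) u v) (dd \<phi> u w) = form22 (dd (normal \<phi>) u w) (dd \<phi> u v)"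
  unfolding normal_field_derivative(3) [OF unit_normal_field_normal u]
  using dd_commute [OF open_U smooth_\<phi> u] by metis

lemma b21: "u \<in> U \<Longrightarrow> form22 (\<phi>\<^sub>2 (normal \<phi>) u) (\<phi>\<^sub>1 \<phi> u) = b12 \<phi> u"
  unfolding b12_def \<phi>\<^sub>1_def \<phi>\<^sub>2_def by (rule second_form_symmetric)

lemma smooth_second:
  "smooth_on U (b11 \<phi>)" "smooth_on U (b12 \<phi>)" "smooth_on U (b22 \<phi>)" "smooth_on U (curv \<phi>)"
proof -
  have 1: "smooth_on U (\<phi>\<^sub>1 (normal \<phi>))" "smooth_on U (\<phi>\<^sub>2 (normal \<phi>))"
    unfolding \<phi>\<^sub>1_def [abs_def] \<phi>\<^sub>2_def [abs_def] by (intro smooth_on_dd smooth_basic)+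
  show 2: "smooth_on U (b11 \<phi>)" "smooth_on U (b12 \<phi>)" "smooth_on U (b22 \<phi>)"
    unfolding b11_def [abs_def] b12_def [abs_def] b22_def [abs_def]
    by (intro smooth_on_form22 open_U 1 smooth_basic)+
  have "gdet \<phi> u \<noteq> 0" if "u \<in> U" for u using gdet_pos [OF that] by simp
  then show "smooth_on U (curv \<phi>)"
    unfolding curv_def [abs_def] by (intro smooth_on_divide smooth_intros open_U 2 smooth_basic)
qed

lemma d\<nu>_tangent:
  assumes u: "u \<in> U"
  shows "dd (normal \<phi>) u v =
     ((g22 \<phi> u * form22 (dd (normal \<phi>) u v) (\<phi>\<^sub>1 \<phi> u) - g12 \<phi> u * form22 (dd (normal \<phi>) u v) (\<phi>\<^sub>2 \<phi> u)) / gdet \<phi> u) *\<^sub>R \<phi>\<^sub>1 \<phi> u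
     + ((g11 \<phi> u * form22 (dd (normal \<phi>) u v) (\<phi>\<^sub>2 \<phi> u) - g12 \<phi> u * form22 (dd (normal \<phi>) u v) (\<phi>\<^sub>1 \<phi> u)) / gdet \<phi> u) *\<^sub>R \<phi>\<^sub>2 \<phi> u"
  using tangent_expansion [OF u normal_orthogonal [OF u], of "dd (normal \<phi>) u v"]
    normal_field_derivative(1,2) [OF unit_normal_field_normal u] by simp

lemma shape_operator_entries:
  assumes u: "u \<in> U"
  shows "\<phi>\<^sub>1 (normal \<phi>) u = ((g22 \<phi> u * b11 \<phi> u - g12 \<phi> u * b12 \<phi> u) / gdet \<phi> u) *\<^sub>R \<phi>\<^sub>1 \<phi> u
     + ((g11 \<phi> u * b12 \<phi> u - g12 \<phi> u * b11 \<phi> u) / gdet \<phi> u) *\<^sub>R \<phi>\<^sub>2 \<phi> u"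
    "\<phi>\<^sub>2 (normal \<phi>) u = ((g22 \<phi> u * b12 \<phi> u - g12 \<phi> u * b22 \<phi> u) / gdet \<phi> u) *\<^sub>R \<phi>\<^sub>1 \<phi> u
     + ((g11 \<phi> u * b22 \<phi> u - g12 \<phi> u * b12 \<phi> u) / gdet \<phi> u) *\<^sub>R \<phi>\<^sub>2 \<phi> u"
  using d\<nu>_tangent [OF u, of "axis 1 1"] d\<nu>_tangent [OF u, of "axis 2 1"] b21 [OF u]
  unfolding b11_def b12_def b22_def by (simp_all add: \<phi>\<^sub>1_def [symmetric] \<phi>\<^sub>2_def [symmetric])

lemma trace_shape_operator:
  assumes u: "u \<in> U"
  shows "trace (matrix (shape_operator \<phi> (normal \<phi>) u)) * gdet \<phi> u =
    g22 \<phi> u * b11 \<phi> u - 2 * g12 \<phi> u * b12 \<phi> u + g11 \<phi> u * b22 \<phi> u"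
proof -
  define w1 :: "real^2" where "w1 = vector [(g22 \<phi> u * b11 \<phi> u - g12 \<phi> u * b12 \<phi> u) / gdet \<phi> u,
     (g11 \<phi> u * b12 \<phi> u - g12 \<phi> u * b11 \<phi> u) / gdet \<phi> u]"
  define w2 :: "real^2" where "w2 = vector [(g22 \<phi> u * b12 \<phi> u - g12 \<phi> u * b22 \<phi> u) / gdet \<phi> u,
     (g11 \<phi> u * b22 \<phi> u - g12 \<phi> u * b12 \<phi> u) / gdet \<phi> u]"
  have "shape_operator \<phi> (normal \<phi>) u (axis 1 1) = w1"
    unfolding shape_operator_eq_iff [OF unit_normal_field_normal u] d\<phi>_expansion [OF u] w1_def
    using shape_operator_entries(1) [OF u] by (simp add: \<phi>\<^sub>1_def)
  moreover have "shape_operator \<phi> (normal \<phi>) u (axis 2 1) = w2"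
    unfolding shape_operator_eq_iff [OF unit_normal_field_normal u] d\<phi>_expansion [OF u] w2_def
    using shape_operator_entries(2) [OF u] by (simp add: \<phi>\<^sub>2_def)
  ultimately have "trace (matrix (shape_operator \<phi> (normal \<phi>) u)) = w1$1 + w2$2"
    by (simp add: trace_def sum_2 matrix_def)
  also have "w1$1 + w2$2 = (g22 \<phi> u * b11 \<phi> u - 2 * g12 \<phi> u * b12 \<phi> u + g11 \<phi> u * b22 \<phi> u) / gdet \<phi> u"
    unfolding w1_def w2_def by (simp add: add_divide_distrib diff_divide_distrib)
  finally show ?thesis using gdet_pos [OF u] by simp
qed

text \<open>Splitting the second derivatives of \<open>\<phi>\<close> gives the Christoffel symbols
  along the surface, the metric along \<open>\<phi>\<close> and the second fundamental form along
  the normal. The tangential part of the equality of mixed third derivatives is then the curvature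
  identity. The position vector contributes -1, the normal contributes \<open>- det B\<close>, with
  this sign because it is timelike.\<close>

lemma gauss_equation:
  assumes u: "u \<in> U"
  shows "gauss_curvature (induced_metric \<phi>) u = curv \<phi> u - 1"
proof -
  define X where "X = (\<lambda>i::2. partial_deriv i \<phi>)"
  define N where "N = (\<lambda>i::2. partial_deriv i (normal \<phi>))"
  define G where "G = (\<lambda>(i::2) (j::2) u. form22 (X i u) (X j u))"
  define b where "b = (\<lambda>(i::2) (j::2) u. form22 (N i u) (X j u))"
  define XX where "XX = (\<lambda>(i::2) (j::2). partial_deriv i (X j))"
  define C where "C = (\<lambda>(k::2) (i::2) (j::2). christoffel (induced_metric \<phi>) k i j)"
  have X12: "\<phi>\<^sub>1 \<phi> = X 1" "\<phi>\<^sub>2 \<phi> = X 2" "\<phi>\<^sub>1 (normal \<phi>) = N 1" "\<phi>\<^sub>2 (normal \<phi>) = N 2"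
    unfolding X_def N_def partial_deriv_def \<phi>\<^sub>1_def \<phi>\<^sub>2_def by auto
  have sX: "smooth_on U (X i)" for i
    unfolding X_def partial_deriv_def [abs_def] by (intro smooth_on_dd smooth_\<phi>)
  have sG: "smooth_on U (G i j)" for i j
    unfolding G_def by (intro smooth_on_form22 open_U sX)
  have sN: "smooth_on U (N i)" for i
    unfolding N_def partial_deriv_def [abs_def] by (intro smooth_on_dd smooth_basic)
  have sb: "smooth_on U (b i j)" for i j
    unfolding b_def by (intro smooth_on_form22 open_U sX sN)
  have G_sym: "G i j = G j i" for i j unfolding G_def by (auto simp: form22_commute)
  have XX_sym: "XX i j y = XX j i y" if "y \<in> U" for i j y
    unfolding XX_def X_def partial_deriv_def by (rule dd_commute [OF open_U smooth_\<phi> that])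
  have im: "induced_metric \<phi> y $ i $ j = G i j y" for i j y
    unfolding induced_metric_def G_def X_def by simp
  have G12: "g11 \<phi> = G 1 1" "g12 \<phi> = G 1 2" "g22 \<phi> = G 2 2"
    unfolding g11_def [abs_def] g12_def [abs_def] g22_def [abs_def] G_def X12 by auto
  have b12': "b11 \<phi> = b 1 1" "b12 \<phi> = b 1 2" "b22 \<phi> = b 2 2"
    unfolding b11_def [abs_def] b12_def [abs_def] b22_def [abs_def] b_def X12 by auto
  have bsym: "b i j y = b j i y" if "y \<in> U" for i j y
    unfolding b_def N_def X_def partial_deriv_def by (rule second_form_symmetric [OF that])
  have det: "det (induced_metric \<phi> y) = gdet \<phi> y" for y
    unfolding det_2 im gdet_def G12 G_sym [of 2 1] by (simp add: power2_eq_square)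
  have pG: "partial_deriv i (G j l) y = form22 (XX i j y) (X l y) + form22 (XX i l y) (X j y)"
    if y: "y \<in> U" for i j l y
  proof -
    have "partial_deriv i (G j l) y = along (\<lambda>_. axis i 1) (\<lambda>y. form22 (X j y) (X l y)) y"
      unfolding partial_deriv_def along_def G_def ..
    then show ?thesis unfolding along_form22 [OF y sX sX]
      by (simp add: along_def XX_def partial_deriv_def form22_commute)
  qed
  \<comment> \<open>The Christoffel symbols are the tangential components of the second derivatives:
    the Koszul combination of metric derivatives collapses to \<open>2 * t l\<close>, and the
    inverse metric is written out.\<close>
  have C_eq: "C k i j y = (if k = 1 then
      (G 2 2 y * form22 (XX i j y) (X 1 y) - G 1 2 y * form22 (XX i j y) (X 2 y)) / gdet \<phi> y
      else (G 1 1 y * form22 (XX i j y) (X 2 y) - G 1 2 y * form22 (XX i j y) (X 1 y)) / gdet \<phi> y)"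
    if y: "y \<in> U" for i j k y
  proof -
    define K where "K = matrix_inv (induced_metric \<phi> y)"
    define t where "t l = form22 (XX i j y) (X l y)" for l
    have "partial_deriv i (G j l) y + partial_deriv j (G i l) y - partial_deriv l (G i j) y = 2 * t l" for l
      unfolding pG [OF y] t_def using XX_sym [OF y] by (simp add: form22_commute)
    then have Ck: "C k i j y = K$k$1 * t 1 + K$k$2 * t 2" for k
      unfolding C_def christoffel_def im K_def by (simp add: sum_2)
    have "invertible (induced_metric \<phi> y)"
      using det [of y] gdet_pos [OF y] by (simp add: invertible_det_nz)
    then have "induced_metric \<phi> y ** K = mat 1"
      unfolding K_def matrix_inv_def invertible_def by (metis (mono_tags, lifting) someI_ex)
    then have "(\<Sum>k\<in>UNIV. G i k y * K$k$j) = (if i = j then 1 else 0)" for i j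
      by (simp add: vec_eq_iff matrix_matrix_mult_def mat_def im)
    then have q: "G i 1 y * K$1$j + G i 2 y * K$2$j = (if i = j then 1 else 0)" for i j
      by (simp add: sum_2)
    have "G 1 1 y * C 1 i j y + G 1 2 y * C 2 i j y = t 1"
      "G 1 2 y * C 1 i j y + G 2 2 y * C 2 i j y = t 2"
    proof -
      have q11: "G 1 1 y * K$1$1 + G 1 2 y * K$2$1 = 1" and q12: "G 1 1 y * K$1$2 + G 1 2 y * K$2$2 = 0"
        and q21: "G 1 2 y * K$1$1 + G 2 2 y * K$2$1 = 0" and q22: "G 1 2 y * K$1$2 + G 2 2 y * K$2$2 = 1"
        using q [of 1 1] q [of 1 2] q [of 2 1] q [of 2 2] unfolding G_sym [of 2 1] by simp_all
      show "G 1 1 y * C 1 i j y + G 1 2 y * C 2 i j y = t 1" using q11 q12 unfolding Ck by algebra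
      show "G 1 2 y * C 1 i j y + G 2 2 y * C 2 i j y = t 2" using q21 q22 unfolding Ck by algebra
    qed
    note tt = this
    have "gdet \<phi> y * C 1 i j y = G 2 2 y * t 1 - G 1 2 y * t 2"
      unfolding tt [symmetric] gdet_def G12 by (simp add: algebra_simps power2_eq_square)
    moreover have "gdet \<phi> y * C 2 i j y = G 1 1 y * t 2 - G 1 2 y * t 1"
      unfolding tt [symmetric] gdet_def G12 by (simp add: algebra_simps power2_eq_square)
    ultimately have "C 1 i j y = (G 2 2 y * t 1 - G 1 2 y * t 2) / gdet \<phi> y"
      "C 2 i j y = (G 1 1 y * t 2 - G 1 2 y * t 1) / gdet \<phi> y"
      using gdet_pos [OF y] by (simp_all add: field_simps)
    then show ?thesis using exhaust_2 [of k] unfolding t_def by auto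
  qed
  have sXX: "smooth_on U (XX i j)" for i j
    unfolding XX_def partial_deriv_def [abs_def] by (intro smooth_on_dd sX)
  have gnz: "\<And>y. y \<in> U \<Longrightarrow> gdet \<phi> y \<noteq> 0" using gdet_pos by force
  have sC: "smooth_on U (C k i j)" for k i j
  proof (rule smooth_on_cong [OF open_U C_eq [symmetric]])
    show "smooth_on U (\<lambda>y. if k = 1 then
      (G 2 2 y * form22 (XX i j y) (X 1 y) - G 1 2 y * form22 (XX i j y) (X 2 y)) / gdet \<phi> y
      else (G 1 1 y * form22 (XX i j y) (X 2 y) - G 1 2 y * form22 (XX i j y) (X 1 y)) / gdet \<phi> y)"
      by (cases "k = 1") (auto intro!: smooth_on_divide smooth_intros open_U sG sXX sX smooth_basic gnz)
  qed
  have C_sym: "C k i j y = C k j i y" if "y \<in> U" for k i j y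
    unfolding C_eq [OF that] XX_sym [OF that, of i j] ..
  have XXn: "form22 (XX i j y) (\<phi> y) = - G i j y" "form22 (XX i j y) (normal \<phi> y) = - b i j y" if y: "y \<in> U" for i j y
  proof -
    have "along (\<lambda>_. axis i 1) (\<lambda>y. form22 (\<phi> y) (X j y)) y = along (\<lambda>_. axis i 1) (\<lambda>_. 0) y"
      by (rule along_cong [OF open_U y]) (simp add: X_def partial_deriv_def \<phi>_d\<phi>)
    then show "form22 (XX i j y) (\<phi> y) = - G i j y"
      unfolding along_form22 [OF y smooth_\<phi> sX]
      by (simp add: along_def XX_def partial_deriv_def [symmetric] X_def [symmetric] G_def)
        (simp add: X_def form22_commute)
    show "form22 (XX i j y) (normal \<phi> y) = - b i j y"
      unfolding b_def N_def X_def XX_def partial_deriv_def normal_field_derivative(3) [OF unit_normal_field_normal y]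
      by (simp add: form22_commute)
  qed
  have XX_exp: "XX i j y = C 1 i j y *\<^sub>R X 1 y + C 2 i j y *\<^sub>R X 2 y + G i j y *\<^sub>R \<phi> y + b i j y *\<^sub>R normal \<phi> y"
    if y: "y \<in> U" for i j y
    using tangent_expansion [OF y normal_orthogonal [OF y], of "XX i j y"]
    unfolding X12 G12 XXn [OF y] C_eq [OF y] by simp
  \<comment> \<open>Only the product with \<open>X 1\<close> matters, since
    \<open>gauss_curvature\<close> lowers the upper index with the entries
    \<open>g u $ l $ 1\<close>.\<close>
  have ddXX: "form22 (partial_deriv k (XX i j) u) (X 1 u) =
     partial_deriv k (C 1 i j) u * G 1 1 u + partial_deriv k (C 2 i j) u * G 1 2 u
     + C 1 i j u * (C 1 k 1 u * G 1 1 u + C 2 k 1 u * G 1 2 u)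
     + C 2 i j u * (C 1 k 2 u * G 1 1 u + C 2 k 2 u * G 1 2 u)
     + G i j u * G k 1 u + b i j u * b k 1 u" for k i j
  proof -
    have a: "partial_deriv k f u = along (\<lambda>_. axis k 1) f u" for f :: "real^2 \<Rightarrow> 'z::real_normed_vector"
      unfolding partial_deriv_def along_def ..
    have nX: "form22 (\<phi> u) (X j u) = 0" "form22 (normal \<phi> u) (X j u) = 0" for j
      unfolding X_def partial_deriv_def using \<phi>_d\<phi> [OF u] normal_orthogonal [OF u] by auto
    have XXX: "form22 (XX k j u) (X 1 u) = C 1 k j u * G 1 1 u + C 2 k j u * G 1 2 u" for j
      unfolding XX_exp [OF u] by (simp add: nX G_def form22_commute)
    have "partial_deriv k (XX i j) u = along (\<lambda>_. axis k 1) (\<lambda>y. C 1 i j y *\<^sub>R X 1 y + C 2 i j y *\<^sub>R X 2 y + G i j y *\<^sub>R \<phi> y + b i j y *\<^sub>R normal \<phi> y) u"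
      unfolding a by (rule along_cong [OF open_U u]) (rule XX_exp)
    also have "\<dots> = C 1 i j u *\<^sub>R XX k 1 u + partial_deriv k (C 1 i j) u *\<^sub>R X 1 u
      + (C 2 i j u *\<^sub>R XX k 2 u + partial_deriv k (C 2 i j) u *\<^sub>R X 2 u)
      + (G i j u *\<^sub>R X k u + partial_deriv k (G i j) u *\<^sub>R \<phi> u)
      + (b i j u *\<^sub>R N k u + partial_deriv k (b i j) u *\<^sub>R normal \<phi> u)"
      unfolding a XX_def N_def X_def 
      by (simp add: along_add [OF u] along_scaleR [OF u] smooth_intros open_U sC sG sb smooth_\<phi> smooth_basic
         sX [unfolded X_def])
    finally show ?thesis
      using XXX by (simp add: nX) (simp add: G_def b_def algebra_simps form22_commute)
  qed
  have "partial_deriv 1 (XX 2 2) u = partial_deriv 2 (XX 1 2) u"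
    unfolding XX_def using dd_commute [OF open_U sX u] unfolding partial_deriv_def by blast
  from arg_cong [OF this, of "\<lambda>z. form22 z (X 1 u)"]
  have key: "(partial_deriv 1 (C 1 2 2) u - partial_deriv 2 (C 1 1 2) u) * G 1 1 u
     + (partial_deriv 1 (C 2 2 2) u - partial_deriv 2 (C 2 1 2) u) * G 1 2 u
     + C 1 2 2 u * (C 1 1 1 u * G 1 1 u + C 2 1 1 u * G 1 2 u)
     + C 2 2 2 u * (C 1 1 2 u * G 1 1 u + C 2 1 2 u * G 1 2 u)
     - C 1 1 2 u * (C 1 2 1 u * G 1 1 u + C 2 2 1 u * G 1 2 u)
     - C 2 1 2 u * (C 1 2 2 u * G 1 1 u + C 2 2 2 u * G 1 2 u)
     = G 1 2 u * G 1 2 u - G 1 1 u * G 2 2 u + b 1 2 u * b 1 2 u - b 2 2 u * b 1 1 u"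
    unfolding ddXX G_sym [of 2 1] bsym [OF u, of 2 1] by (simp add: algebra_simps)
  have "(\<Sum>l\<in>UNIV. riemann (induced_metric \<phi>) l 1 2 2 u * induced_metric \<phi> u $ l $ 1)
     = - gdet \<phi> u + (b 1 2 u * b 1 2 u - b 2 2 u * b 1 1 u)"
    using key unfolding riemann_def C_def [symmetric] im sum_2 G_sym [of 2 1] gdet_def G12
    by (simp add: algebra_simps power2_eq_square)
  then show ?thesis
    unfolding gauss_curvature_def det curv_def b12' using gdet_pos [OF u]
    by (simp add: field_simps power2_eq_square)
qed

end

section \<open>Principal frames and the Bernstein estimate\<close>

text \<open>\<open>\<xi>\<close> and \<open>\<eta>\<close> are the principal directions for the principal curvatures \<open>l\<close> and \<open>- l\<close>, of
  length \<open>l\<^bsup>-1/2\<^esup>\<close> in the induced metric.\<close>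

locale flat_frame =
  fixes V :: "(real^2) set" and \<phi> \<nu> :: "real^2 \<Rightarrow> real^4" and \<xi> \<eta> :: "real^2 \<Rightarrow> real^2" and l :: "real^2 \<Rightarrow> real"
  assumes open_V: "open V"
    and smooth: "smooth_on V \<phi>" "smooth_on V \<nu>" "smooth_on V \<xi>" "smooth_on V \<eta>" "smooth_on V l"
    and l_pos: "\<And>u. u \<in> V \<Longrightarrow> l u > 0"
    and normalized: "\<And>u. u \<in> V \<Longrightarrow> form22 (\<phi> u) (\<phi> u) = -1" "\<And>u. u \<in> V \<Longrightarrow> form22 (\<nu> u) (\<nu> u) = -1"
      "\<And>u. u \<in> V \<Longrightarrow> form22 (\<phi> u) (\<nu> u) = 0"
    and normal_frame: "\<And>u. u \<in> V \<Longrightarrow> form22 (along \<xi> \<phi> u) (\<nu> u) = 0" "\<And>u. u \<in> V \<Longrightarrow> form22 (along \<eta> \<phi> u) (\<nu> u) = 0"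
    and conformal: "\<And>u. u \<in> V \<Longrightarrow> form22 (along \<xi> \<phi> u) (along \<xi> \<phi> u) = 1 / l u"
      "\<And>u. u \<in> V \<Longrightarrow> form22 (along \<eta> \<phi> u) (along \<eta> \<phi> u) = 1 / l u"
      "\<And>u. u \<in> V \<Longrightarrow> form22 (along \<xi> \<phi> u) (along \<eta> \<phi> u) = 0"
    and principal: "\<And>u. u \<in> V \<Longrightarrow> along \<xi> \<nu> u = l u *\<^sub>R along \<xi> \<phi> u"
      "\<And>u. u \<in> V \<Longrightarrow> along \<eta> \<nu> u = - l u *\<^sub>R along \<eta> \<phi> u"
begin

abbreviation "x1 \<equiv> along \<xi> \<phi>"
abbreviation "x2 \<equiv> along \<eta> \<phi>"

lemma smooth_x: "smooth_on V x1" "smooth_on V x2"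
  by (intro smooth_on_along open_V smooth)+

lemma position_orthogonal:
  assumes u: "u \<in> V"
  shows "form22 (along \<zeta> \<phi> u) (\<phi> u) = 0"
proof -
  have "along \<zeta> (\<lambda>u. form22 (\<phi> u) (\<phi> u)) u = along \<zeta> (\<lambda>_. -1) u"
    by (rule along_cong [OF open_V u]) (rule normalized)
  then show ?thesis unfolding along_form22 [OF u smooth(1) smooth(1)] by (simp add: form22_commute)
qed

lemma frame_expansion:
  assumes u: "u \<in> V"
  shows "z = (l u * form22 z (x1 u)) *\<^sub>R x1 u + (l u * form22 z (x2 u)) *\<^sub>R x2 u
     - form22 z (\<phi> u) *\<^sub>R \<phi> u - form22 z (\<nu> u) *\<^sub>R \<nu> u"
proof -
  have "z = ((1 / l u * form22 z (x1 u) - 0 * form22 z (x2 u)) / (1 / l u * (1 / l u) - 0^2)) *\<^sub>R x1 u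
     + ((1 / l u * form22 z (x2 u) - 0 * form22 z (x1 u)) / (1 / l u * (1 / l u) - 0^2)) *\<^sub>R x2 u
     - form22 z (\<phi> u) *\<^sub>R \<phi> u - form22 z (\<nu> u) *\<^sub>R \<nu> u"
    by (rule adapted_expansion) (use normalized normal_frame conformal position_orthogonal l_pos u in auto)
  then show ?thesis using l_pos [OF u] by (simp add: mult.commute)
qed

lemma along_inverse_l:
  assumes u: "u \<in> V"
  shows "along \<zeta> (\<lambda>u. 1 / l u) u = - along \<zeta> l u / (l u * l u)"
proof -
  have "along \<zeta> (\<lambda>u. 1 / l u) u = (along \<zeta> (\<lambda>_. 1) u * l u - 1 * along \<zeta> l u) / (l u * l u)"
    by (rule along_divide [OF u smooth_on_const smooth(5)]) (use l_pos [OF u] in simp)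
  then show ?thesis by simp
qed

lemma along_conformal:
  assumes u: "u \<in> V"
  shows "form22 (along \<zeta> x1 u) (x1 u) = - along \<zeta> l u / (2 * (l u * l u))"
    "form22 (along \<zeta> x2 u) (x2 u) = - along \<zeta> l u / (2 * (l u * l u))"
    "form22 (along \<zeta> x1 u) (x2 u) = - form22 (along \<zeta> x2 u) (x1 u)"
proof -
  have "along \<zeta> (\<lambda>u. form22 (x1 u) (x1 u)) u = along \<zeta> (\<lambda>u. 1 / l u) u"
    by (rule along_cong [OF open_V u]) (rule conformal)
  then show "form22 (along \<zeta> x1 u) (x1 u) = - along \<zeta> l u / (2 * (l u * l u))"
    unfolding along_form22 [OF u smooth_x(1) smooth_x(1)] along_inverse_l [OF u]
    by (simp add: form22_commute field_simps)
  have "along \<zeta> (\<lambda>u. form22 (x2 u) (x2 u)) u = along \<zeta> (\<lambda>u. 1 / l u) u"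
    by (rule along_cong [OF open_V u]) (rule conformal)
  then show "form22 (along \<zeta> x2 u) (x2 u) = - along \<zeta> l u / (2 * (l u * l u))"
    unfolding along_form22 [OF u smooth_x(2) smooth_x(2)] along_inverse_l [OF u]
    by (simp add: form22_commute field_simps)
  have "along \<zeta> (\<lambda>u. form22 (x1 u) (x2 u)) u = along \<zeta> (\<lambda>u. 0) u"
    by (rule along_cong [OF open_V u]) (rule conformal)
  then show "form22 (along \<zeta> x1 u) (x2 u) = - form22 (along \<zeta> x2 u) (x1 u)"
    unfolding along_form22 [OF u smooth_x] by (simp add: form22_commute)
qed

lemma along_x_position:
  assumes u: "u \<in> V" and that: "smooth_on V \<theta>"
  shows "form22 (along \<zeta> (along \<theta> \<phi>) u) (\<phi> u) = - form22 (along \<theta> \<phi> u) (along \<zeta> \<phi> u)"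
proof -
  have "along \<zeta> (\<lambda>u. form22 (along \<theta> \<phi> u) (\<phi> u)) u = along \<zeta> (\<lambda>u. 0) u"
    by (rule along_cong [OF open_V u]) (rule position_orthogonal)
  then show ?thesis
    unfolding along_form22 [OF u smooth_on_along [OF open_V smooth(1) that] smooth(1)] by simp
qed

lemma along_x_normal:
  assumes u: "u \<in> V"
  shows "form22 (along \<zeta> x1 u) (\<nu> u) = - form22 (x1 u) (along \<zeta> \<nu> u)"
    "form22 (along \<zeta> x2 u) (\<nu> u) = - form22 (x2 u) (along \<zeta> \<nu> u)"
proof -
  have "along \<zeta> (\<lambda>u. form22 (x1 u) (\<nu> u)) u = along \<zeta> (\<lambda>u. 0) u"
    by (rule along_cong [OF open_V u]) (rule normal_frame)
  then show "form22 (along \<zeta> x1 u) (\<nu> u) = - form22 (x1 u) (along \<zeta> \<nu> u)"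
    unfolding along_form22 [OF u smooth_x(1) smooth(2)] by simp
  have "along \<zeta> (\<lambda>u. form22 (x2 u) (\<nu> u)) u = along \<zeta> (\<lambda>u. 0) u"
    by (rule along_cong [OF open_V u]) (rule normal_frame)
  then show "form22 (along \<zeta> x2 u) (\<nu> u) = - form22 (x2 u) (along \<zeta> \<nu> u)"
    unfolding along_form22 [OF u smooth_x(2) smooth(2)] by simp
qed

lemma linear_d: "u \<in> V \<Longrightarrow> linear (dd \<phi> u)" "u \<in> V \<Longrightarrow> linear (dd \<nu> u)"
  by (rule linear_dd, erule smooth_on_differentiable [OF smooth(1)], rule linear_dd, erule smooth_on_differentiable [OF smooth(2)])

text \<open>\<open>dd \<phi> u\<close> maps \<open>\<xi> u\<close> and \<open>\<eta> u\<close> to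
  orthogonal nonzero vectors, so their determinant \<open>D\<close> does not vanish and Cramer's
  rule applies.\<close>

lemma frame_spans:
  assumes u: "u \<in> V"
  shows "\<exists>\<alpha> \<beta>. z = \<alpha> *\<^sub>R \<xi> u + \<beta> *\<^sub>R \<eta> u"
proof -
  define D where "D = \<xi> u $ 1 * \<eta> u $ 2 - \<xi> u $ 2 * \<eta> u $ 1"
  have zero: "\<alpha> = 0" if "\<alpha> *\<^sub>R \<xi> u + \<beta> *\<^sub>R \<eta> u = 0" for \<alpha> \<beta>
  proof -
    have "\<alpha> *\<^sub>R x1 u + \<beta> *\<^sub>R x2 u = 0"
      using arg_cong [OF that, of "dd \<phi> u"] unfolding along_def
      by (simp add: linear_add [OF linear_d(1) [OF u]] linear_scale [OF linear_d(1) [OF u]] linear_0 [OF linear_d(1) [OF u]])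
    from arg_cong [OF this, of "form22 (x1 u)"] have "\<alpha> * (1 / l u) = 0"
      using conformal [OF u] by simp
    then show ?thesis using l_pos [OF u] by simp
  qed
  have "D \<noteq> 0"
  proof
    assume D: "D = 0"
    have "\<eta> u $ 1 *\<^sub>R \<xi> u + (- \<xi> u $ 1) *\<^sub>R \<eta> u = 0" "\<eta> u $ 2 *\<^sub>R \<xi> u + (- \<xi> u $ 2) *\<^sub>R \<eta> u = 0"
      using D unfolding D_def by (simp_all add: vec_eq_iff forall_2 algebra_simps)
    from this [THEN zero] have "\<eta> u = 0" by (simp add: vec_eq_iff forall_2)
    then have "x2 u = 0" unfolding along_def by (simp add: linear_0 [OF linear_d(1) [OF u]])
    then show False using conformal(2) [OF u] l_pos [OF u] by simp
  qed
  then have "z = ((z$1 * \<eta> u $ 2 - z$2 * \<eta> u $ 1) / D) *\<^sub>R \<xi> u + ((\<xi> u $ 1 * z$2 - \<xi> u $ 2 * z$1) / D) *\<^sub>R \<eta> u"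
    by (simp add: vec_eq_iff forall_2 field_simps) (simp add: D_def algebra_simps)
  then show ?thesis by blast
qed

text \<open>The Codazzi equation in disguise: the rescaled principal fields are coordinate fields of
  the flat metric \<open>\<lambda> I\<close>.\<close>

lemma bracket_zero:
  assumes u: "u \<in> V"
  shows "bracket \<xi> \<eta> u = 0"
proof -
  have L: "l u > 0" by (rule l_pos [OF u])
  \<comment> \<open>The commutator of the two fields, applied to \<open>\<phi>\<close> and to
    \<open>\<nu>\<close>, gives two vector equations for \<open>\<alpha>\<close> and
    \<open>\<beta>\<close>; the second one is the Codazzi equation.\<close>
  obtain \<alpha> \<beta> where ab: "bracket \<xi> \<eta> u = \<alpha> *\<^sub>R \<xi> u + \<beta> *\<^sub>R \<eta> u" using frame_spans [OF u] by blast
  have 1: "along \<xi> x2 u - along \<eta> x1 u = \<alpha> *\<^sub>R x1 u + \<beta> *\<^sub>R x2 u"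
    unfolding along_commutator [OF open_V smooth(1) smooth(3) smooth(4) u] ab
    by (simp add: along_def linear_add [OF linear_d(1) [OF u]] linear_scale [OF linear_d(1) [OF u]])
  have "along \<xi> (along \<eta> \<nu>) u - along \<eta> (along \<xi> \<nu>) u = \<alpha> *\<^sub>R along \<xi> \<nu> u + \<beta> *\<^sub>R along \<eta> \<nu> u"
    unfolding along_commutator [OF open_V smooth(2) smooth(3) smooth(4) u] ab
    by (simp add: along_def linear_add [OF linear_d(2) [OF u]] linear_scale [OF linear_d(2) [OF u]])
  moreover have "along \<xi> (along \<eta> \<nu>) u = along \<xi> (\<lambda>u. - l u *\<^sub>R x2 u) u"
    by (rule along_cong [OF open_V u]) (rule principal)
  moreover have "along \<eta> (along \<xi> \<nu>) u = along \<eta> (\<lambda>u. l u *\<^sub>R x1 u) u"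
    by (rule along_cong [OF open_V u]) (rule principal)
  moreover have "along \<xi> (\<lambda>u. - l u *\<^sub>R x2 u) u = - (l u *\<^sub>R along \<xi> x2 u + along \<xi> l u *\<^sub>R x2 u)"
    using along_scaleR [OF u smooth_on_minus [OF open_V smooth(5)] smooth_x(2), of \<xi>] along_minus [OF u smooth(5), of \<xi>]
    by simp
  moreover have "along \<eta> (\<lambda>u. l u *\<^sub>R x1 u) u = l u *\<^sub>R along \<eta> x1 u + along \<eta> l u *\<^sub>R x1 u"
    by (rule along_scaleR [OF u smooth(5) smooth_x(1)])
  ultimately have 2: "- (l u *\<^sub>R along \<xi> x2 u + along \<xi> l u *\<^sub>R x2 u) - (l u *\<^sub>R along \<eta> x1 u + along \<eta> l u *\<^sub>R x1 u)
     = (\<alpha> * l u) *\<^sub>R x1 u - (\<beta> * l u) *\<^sub>R x2 u"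
    unfolding principal [OF u] by simp
  define p where "p = form22 (along \<xi> x2 u) (x1 u)"
  define q where "q = form22 (along \<eta> x1 u) (x2 u)"
  have c: "form22 (x2 u) (x1 u) = 0" using conformal(3) [OF u] form22_commute by metis
  note cc = conformal [OF u] c along_conformal [OF u]
  have a1: "p + along \<eta> l u / (2 * (l u * l u)) = \<alpha> / l u"
    using arg_cong [OF 1, of "\<lambda>z. form22 z (x1 u)"] by (simp add: cc p_def)
  have a2: "- (l u * p) + l u * (along \<eta> l u / (2 * (l u * l u))) - along \<eta> l u / l u = \<alpha>"
    using arg_cong [OF 2, of "\<lambda>z. form22 z (x1 u)"] L by (simp add: cc p_def)
  \<comment> \<open>One and the same expression equals \<open>2 l^2 \<alpha>\<close> by the first
    equation and \<open>- 2 l^2 \<alpha>\<close> by the second, which forces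
    \<open>\<alpha> = 0\<close>. Pairing with \<open>x2\<close> does the same for
    \<open>\<beta>\<close>.\<close>
  have "l u * along \<eta> l u + p * (l u * (l u * (l u * 2))) = \<alpha> * (l u * (l u * 2))"
    using a1 L by (simp add: field_simps)
  moreover have "- (l u * along \<eta> l u) = \<alpha> * (l u * (l u * 2)) + p * (l u * (l u * (l u * 2)))"
    using a2 L by (simp add: field_simps)
  ultimately have "\<alpha> * (l u * (l u * 2)) = 0" by linarith
  then have "\<alpha> = 0" using L by simp
  have b1: "- along \<xi> l u / (2 * (l u * l u)) - q = \<beta> / l u"
    using arg_cong [OF 1, of "\<lambda>z. form22 z (x2 u)"] by (simp add: cc(1-6) q_def)
  have b2: "l u * (along \<xi> l u / (2 * (l u * l u))) - along \<xi> l u / l u - l u * q = - \<beta>"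
    using arg_cong [OF 2, of "\<lambda>z. form22 z (x2 u)"] L by (simp add: cc(1-6) q_def)
  have "- (l u * along \<xi> l u) = \<beta> * (l u * (l u * 2)) + q * (l u * (l u * (l u * 2)))"
    using b1 L by (simp add: field_simps)
  moreover have "\<beta> * (l u * 2) = along \<xi> l u + q * (l u * (l u * 2))"
    using b2 L by (simp add: field_simps)
  then have "l u * (\<beta> * (l u * 2)) = l u * (along \<xi> l u + q * (l u * (l u * 2)))" by simp
  then have "\<beta> * (l u * (l u * 2)) = l u * along \<xi> l u + q * (l u * (l u * (l u * 2)))"
    by (simp add: algebra_simps)
  ultimately have "\<beta> * (l u * (l u * 2)) = 0" by linarith
  then have "\<beta> = 0" using L by simp
  then show ?thesis unfolding ab using \<open>\<alpha> = 0\<close> by simp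
qed

lemma commute:
  fixes f :: "real^2 \<Rightarrow> real"
  assumes "u \<in> V" "smooth_on V f"
  shows "along \<xi> (along \<eta> f) u = along \<eta> (along \<xi> f) u"
  using along_commutator_real [OF open_V assms(2) smooth(3,4) assms(1)] bracket_zero [OF assms(1)]
    linear_0 [OF linear_dd [OF smooth_on_differentiable [OF assms(2,1)]]] by simp

lemma commute4:
  fixes f :: "real^2 \<Rightarrow> real^4"
  assumes "u \<in> V" "smooth_on V f"
  shows "along \<xi> (along \<eta> f) u = along \<eta> (along \<xi> f) u"
  using along_commutator [OF open_V assms(2) smooth(3,4) assms(1)] bracket_zero [OF assms(1)]
    linear_0 [OF linear_dd [OF smooth_on_differentiable [OF assms(2,1)]]] by simp

definition "w u = ln (l u)"
abbreviation "w1 \<equiv> along \<xi> w"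
abbreviation "w2 \<equiv> along \<eta> w"

lemma smooth_w: "smooth_on V w" "smooth_on V w1" "smooth_on V w2"
proof -
  show "smooth_on V w" unfolding w_def [abs_def] by (intro smooth_on_ln open_V smooth l_pos)
  then show "smooth_on V w1" "smooth_on V w2" by (intro smooth_on_along open_V smooth; assumption)+
qed

lemma along_l: "u \<in> V \<Longrightarrow> along \<zeta> l u = l u * along \<zeta> w u"
  using along_ln [OF _ smooth(5) l_pos, of u \<zeta>] l_pos [of u] unfolding w_def by simp

text \<open>The Gauss formulas for \<open>1 / l\<close> times the flat metric: the tangential
  coefficients are its Christoffel symbols, halves of derivatives of \<open>w = ln l\<close>. The
  coefficients of \<open>\<nu>\<close> are 1, 0 and -1, since the eigenvalue \<open>l\<close>
  cancels the squared length \<open>1 / l\<close> of the principal fields.\<close>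

lemma x11: "u \<in> V \<Longrightarrow> along \<xi> x1 u = (- w1 u / 2) *\<^sub>R x1 u + (w2 u / 2) *\<^sub>R x2 u + (1 / l u) *\<^sub>R \<phi> u + \<nu> u"
  and x12: "u \<in> V \<Longrightarrow> along \<xi> x2 u = (- w2 u / 2) *\<^sub>R x1 u + (- w1 u / 2) *\<^sub>R x2 u"
  and x22: "u \<in> V \<Longrightarrow> along \<eta> x2 u = (w1 u / 2) *\<^sub>R x1 u + (- w2 u / 2) *\<^sub>R x2 u + (1 / l u) *\<^sub>R \<phi> u - \<nu> u"
proof -
  assume u: "u \<in> V"
  have L: "l u > 0" by (rule l_pos [OF u])
  have sym: "along \<xi> x2 u = along \<eta> x1 u" by (rule commute4 [OF u smooth(1)])
  have c: "form22 (x2 u) (x1 u) = 0" using conformal(3) [OF u] form22_commute by metis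
  have a: "form22 (along \<xi> x2 u) (x1 u) = - w2 u / (2 * l u)"
    unfolding sym along_conformal(1) [OF u] along_l [OF u] using L by (simp add: field_simps)
  have b: "form22 (along \<eta> x1 u) (x2 u) = - w1 u / (2 * l u)"
    unfolding sym [symmetric] along_conformal(2) [OF u] along_l [OF u] using L by (simp add: field_simps)
  have d: "form22 (along \<xi> x1 u) (x1 u) = - w1 u / (2 * l u)" "form22 (along \<eta> x2 u) (x2 u) = - w2 u / (2 * l u)"
    unfolding along_conformal(1,2) [OF u] along_l [OF u] using L by (simp_all add: field_simps)
  have e: "form22 (along \<xi> x1 u) (x2 u) = w2 u / (2 * l u)" "form22 (along \<eta> x2 u) (x1 u) = w1 u / (2 * l u)"
    using along_conformal(3) [OF u, of \<xi>] along_conformal(3) [OF u, of \<eta>] a b by simp_all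
  note n = along_x_normal [OF u] principal [OF u] conformal [OF u] c along_x_position [OF u smooth(3)] along_x_position [OF u smooth(4)]
  show "along \<xi> x1 u = (- w1 u / 2) *\<^sub>R x1 u + (w2 u / 2) *\<^sub>R x2 u + (1 / l u) *\<^sub>R \<phi> u + \<nu> u"
    using frame_expansion [OF u, of "along \<xi> x1 u"] L by (simp add: n d e)
  show "along \<xi> x2 u = (- w2 u / 2) *\<^sub>R x1 u + (- w1 u / 2) *\<^sub>R x2 u"
    using frame_expansion [OF u, of "along \<xi> x2 u"] a b L by (simp add: n sym)
  show "along \<eta> x2 u = (w1 u / 2) *\<^sub>R x1 u + (- w2 u / 2) *\<^sub>R x2 u + (1 / l u) *\<^sub>R \<phi> u - \<nu> u"
    using frame_expansion [OF u, of "along \<eta> x2 u"] L by (simp add: n d e)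
qed

text \<open>Maximality cancels the two normal terms. The Laplacian is that of the flat metric,
  \<open>1 / l\<close> times the Laplacian of the induced metric; hence \<open>2 / l\<close> in
  place of 2.\<close>

lemma laplacian_\<phi>:
  "u \<in> V \<Longrightarrow> along \<xi> x1 u + along \<eta> x2 u = (2 / l u) *\<^sub>R \<phi> u"
  unfolding x11 x22 by (simp add: vec_eq_iff)

lemma laplacian_\<nu>:
  assumes u: "u \<in> V"
  shows "along \<xi> (along \<xi> \<nu>) u + along \<eta> (along \<eta> \<nu>) u = (2 * l u) *\<^sub>R \<nu> u"
proof -
  have "along \<xi> (along \<xi> \<nu>) u = along \<xi> (\<lambda>u. l u *\<^sub>R x1 u) u"
    by (rule along_cong [OF open_V u]) (rule principal)
  moreover have "along \<eta> (along \<eta> \<nu>) u = along \<eta> (\<lambda>u. - l u *\<^sub>R x2 u) u"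
    by (rule along_cong [OF open_V u]) (rule principal)
  moreover have "along \<eta> (\<lambda>u. - l u *\<^sub>R x2 u) u = - (l u *\<^sub>R along \<eta> x2 u + along \<eta> l u *\<^sub>R x2 u)"
    using along_scaleR [OF u smooth_on_minus [OF open_V smooth(5)] smooth_x(2), of \<eta>] along_minus [OF u smooth(5), of \<eta>]
    by simp
  moreover have "along \<xi> (\<lambda>u. l u *\<^sub>R x1 u) u = l u *\<^sub>R along \<xi> x1 u + along \<xi> l u *\<^sub>R x1 u"
    by (rule along_scaleR [OF u smooth(5) smooth_x(1)])
  ultimately show ?thesis
    unfolding x11 [OF u] x22 [OF u] along_l [OF u]
    by (simp add: vec_eq_iff algebra_simps)
qed

text \<open>The Gauss equation once more, from the equality of two third derivatives of
  \<open>\<phi>\<close>, twice along \<open>\<xi>\<close> and once along \<open>\<eta>\<close>,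
  paired with \<open>x2\<close>. In terms of \<open>w\<close> it reads
  \<open>\<Delta> w = 4 sinh w\<close>.\<close>

lemma sinh_gordon:
  assumes u: "u \<in> V"
  shows "along \<xi> w1 u + along \<eta> w2 u = 2 * (l u - 1 / l u)"
proof -
  have L: "l u > 0" by (rule l_pos [OF u])
  have s: "smooth_on V (\<lambda>u. - w1 u / 2)" "smooth_on V (\<lambda>u. - w2 u / 2)" "smooth_on V (\<lambda>u. w2 u / 2)"
    "smooth_on V (\<lambda>u. 1 / l u)"
    by (intro smooth_on_divide smooth_on_minus smooth_on_const open_V smooth_w smooth; use l_pos in force)+
  have h: "along \<zeta> (\<lambda>u. - f u / 2) u = - along \<zeta> f u / 2" "along \<zeta> (\<lambda>u. f u / 2) u = along \<zeta> f u / 2"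
    if "smooth_on V f" for f :: "real^2 \<Rightarrow> real" and \<zeta>
  proof -
    have "along \<zeta> (\<lambda>u. - f u / 2) u = (along \<zeta> (\<lambda>u. - f u) u * 2 - (- f u) * along \<zeta> (\<lambda>_. 2) u) / (2 * 2)"
      by (rule along_divide [OF u smooth_on_minus [OF open_V that] smooth_on_const]) simp
    then show "along \<zeta> (\<lambda>u. - f u / 2) u = - along \<zeta> f u / 2" by (simp add: along_minus [OF u that])
    have "along \<zeta> (\<lambda>u. f u / 2) u = (along \<zeta> f u * 2 - f u * along \<zeta> (\<lambda>_. 2) u) / (2 * 2)"
      by (rule along_divide [OF u that smooth_on_const]) simp
    then show "along \<zeta> (\<lambda>u. f u / 2) u = along \<zeta> f u / 2" by simp
  qed
  have c: "form22 (x1 u) (x2 u) = 0" "form22 (x2 u) (x2 u) = 1 / l u" 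
     "form22 (\<phi> u) (x2 u) = 0" "form22 (\<nu> u) (x2 u) = 0"
    using conformal [OF u] position_orthogonal [OF u, of \<eta>] normal_frame(2) [OF u] by (simp_all add: form22_commute)
  have t: "smooth_on V (\<lambda>u. (- w2 u / 2) *\<^sub>R x1 u)" "smooth_on V (\<lambda>u. (- w1 u / 2) *\<^sub>R x2 u)"
    "smooth_on V (\<lambda>u. (- w1 u / 2) *\<^sub>R x1 u)" "smooth_on V (\<lambda>u. (w2 u / 2) *\<^sub>R x2 u)"
    "smooth_on V (\<lambda>u. (1 / l u) *\<^sub>R \<phi> u)"
    by (intro smooth_on_scaleR open_V s smooth_x smooth)+
  have "along \<xi> (along \<xi> x2) u = along \<xi> (\<lambda>u. (- w2 u / 2) *\<^sub>R x1 u + (- w1 u / 2) *\<^sub>R x2 u) u"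
    by (rule along_cong [OF open_V u]) (rule x12)
  also have "\<dots> = (- w2 u / 2) *\<^sub>R along \<xi> x1 u + (- along \<xi> w2 u / 2) *\<^sub>R x1 u
     + ((- w1 u / 2) *\<^sub>R along \<xi> x2 u + (- along \<xi> w1 u / 2) *\<^sub>R x2 u)"
    by (simp only: along_add [OF u t(1,2)] along_scaleR [OF u s(2) smooth_x(1)]
      along_scaleR [OF u s(1) smooth_x(2)] h(1) [OF smooth_w(2)] h(1) [OF smooth_w(3)])
  finally have E: "along \<xi> (along \<xi> x2) u = (- w2 u / 2) *\<^sub>R along \<xi> x1 u + (- along \<xi> w2 u / 2) *\<^sub>R x1 u
     + ((- w1 u / 2) *\<^sub>R along \<xi> x2 u + (- along \<xi> w1 u / 2) *\<^sub>R x2 u)" .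
  have "form22 (along \<xi> (along \<xi> x2) u) (x2 u) = (- (w2 u)\<^sup>2 / 4 + (w1 u)\<^sup>2 / 4 - along \<xi> w1 u / 2) / l u"
    unfolding E x11 [OF u] x12 [OF u] form22_simps c using L by (simp add: field_simps power2_eq_square)
  have "along \<eta> (along \<xi> x1) u = along \<eta> (\<lambda>u. (- w1 u / 2) *\<^sub>R x1 u + (w2 u / 2) *\<^sub>R x2 u + (1 / l u) *\<^sub>R \<phi> u + \<nu> u) u"
    by (rule along_cong [OF open_V u]) (rule x11)
  also have "\<dots> = (- w1 u / 2) *\<^sub>R along \<eta> x1 u + (- along \<eta> w1 u / 2) *\<^sub>R x1 u
     + ((w2 u / 2) *\<^sub>R along \<eta> x2 u + (along \<eta> w2 u / 2) *\<^sub>R x2 u)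
     + ((1 / l u) *\<^sub>R x2 u + along \<eta> (\<lambda>u. 1 / l u) u *\<^sub>R \<phi> u) + along \<eta> \<nu> u"
    by (simp only: along_add [OF u smooth_on_add [OF open_V smooth_on_add [OF open_V t(3,4)] t(5)] smooth(2)]
      along_add [OF u smooth_on_add [OF open_V t(3,4)] t(5)] along_add [OF u t(3,4)]
      along_scaleR [OF u s(1) smooth_x(1)] along_scaleR [OF u s(3) smooth_x(2)] along_scaleR [OF u s(4) smooth(1)]
      h(1) [OF smooth_w(2)] h(2) [OF smooth_w(3)])
  finally have E2: "along \<eta> (along \<xi> x1) u = (- w1 u / 2) *\<^sub>R along \<eta> x1 u + (- along \<eta> w1 u / 2) *\<^sub>R x1 u
     + ((w2 u / 2) *\<^sub>R along \<eta> x2 u + (along \<eta> w2 u / 2) *\<^sub>R x2 u)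
     + ((1 / l u) *\<^sub>R x2 u + along \<eta> (\<lambda>u. 1 / l u) u *\<^sub>R \<phi> u) + along \<eta> \<nu> u" .
  have 2: "form22 (along \<eta> (along \<xi> x1) u) (x2 u) = (w1 u * w1 u / 4 + along \<eta> w2 u / 2 - w2 u * w2 u / 4 + 1 / l u - l u) / l u"
    unfolding E2 x22 [OF u] principal [OF u] commute4 [OF u smooth(1), symmetric] x12 [OF u] form22_simps c
    using L by (simp add: field_simps)
  have "along \<eta> (along \<xi> x1) u = along \<xi> (along \<eta> x1) u"
    by (rule commute4 [OF u smooth_x(1), symmetric])
  also have "\<dots> = along \<xi> (along \<xi> x2) u"
    by (rule along_cong [OF open_V u]) (rule commute4 [OF _ smooth(1), symmetric])
  finally show ?thesis
    using 2 \<open>form22 (along \<xi> (along \<xi> x2) u) (x2 u) = _\<close> L by (simp add: power2_eq_square)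
qed

end

text \<open>The maximum principle at a point, multiplied by \<open>l\<close> to pass to the Laplacian of the induced
  metric. \<open>w1\<close>, \<open>w2\<close> and \<open>A\<close>, \<open>B\<close>, \<open>D\<close> are the first and second derivatives of \<open>w = ln l\<close>, and the
  quantity maximized is \<open>r w + ln W - 2 ln f + 2 ln y\<close>. The term coming from \<open>\<nabla>y\<close> is absorbed by
  \<open>8 \<sigma>\<^sup>2 / W\<close>, so that no lower bound on \<open>W\<close> is needed.\<close>

lemma bernstein_algebra:
  fixes l :: real
  assumes l: "0 < l" "l \<le> 1" and W: "W = w1^2 + w2^2" "W > 0" and \<sigma>: "\<sigma> = l - 1 / l" and tr: "A + D = 2 * \<sigma>"
    and f: "f = 1 + e - l^2" "e > 0" and r: "3 \<le> r" "r \<le> 4" and y: "0 < y" "y \<le> 3"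
    and W12: "W1 = 2 * (w1 * A + w2 * B)" "W2 = 2 * (w1 * B + w2 * D)"
    and crit: "r * w1 + W1 / W + 4 * l^2 * w1 / f + 2 * y1 / y = 0"
      "r * w2 + W2 / W + 4 * l^2 * w2 / f + 2 * y2 / y = 0"
    and LW: "LW = 2 * (A^2 + 2 * B^2 + D^2) + 4 * (l + 1 / l) * W"
    and second: "r * (2 * \<sigma>) + (LW * W - (W1^2 + W2^2)) / W^2
      + (8 * l^2 * \<sigma> + 8 * l^2 * W) / f + 8 * l^4 * W / f^2 + 2 * S / y - 2 * (y1^2 + y2^2) / y^2 \<le> 0"
    and yb: "l * (y1^2 + y2^2) \<le> 24" "- (l * S) \<le> 16"
  shows "l^3 * W * y^2 \<le> 74 * f^2"
proof -
  define \<kappa> where "\<kappa> = l + 1 / l"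
  define k where "k = 1 - l^2"
  define v where "v = w1 * y1 + w2 * y2"
  define Y where "Y = y1^2 + y2^2"
  have l2: "l^2 \<le> 1" using l by (simp add: power_le_one)
  then have k: "0 \<le> k" "k \<le> 1" "k \<le> f" "f > 0" unfolding k_def f(1) using f(2) by auto
  have ls: "l * \<sigma> = - k" unfolding \<sigma> k_def using l by (simp add: field_simps power2_eq_square)
  have lk: "l * \<kappa> = 1 + l^2" unfolding \<kappa>_def using l by (simp add: field_simps power2_eq_square)
  \<comment> \<open>Contracting the critical equations with \<open>(w1, w2)\<close> determines the
    only combination of \<open>W1\<close> and \<open>W2\<close> that survives in the second-order
    inequality.\<close>
  have vW: "(w1 * W1 + w2 * W2) / W^2 = - (r + 4 * l^2 / f + 2 * v / (y * W))"
  proof -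
    have "w1 * (r * w1 + W1 / W + 4 * l^2 * w1 / f + 2 * y1 / y) +
        w2 * (r * w2 + W2 / W + 4 * l^2 * w2 / f + 2 * y2 / y) = 0" using crit by simp
    moreover have "w1 * (r * w1 + W1 / W + 4 * l^2 * w1 / f + 2 * y1 / y) +
        w2 * (r * w2 + W2 / W + 4 * l^2 * w2 / f + 2 * y2 / y)
       = r * W + (w1 * W1 + w2 * W2) / W + 4 * l^2 * W / f + 2 * v / y"
      unfolding v_def W(1) using k(4) y(1) by (simp add: add_divide_distrib algebra_simps power2_eq_square)
    ultimately have "(w1 * W1 + w2 * W2) / W = - (r * W + 4 * l^2 * W / f + 2 * v / y)" by simp
    also have "\<dots> = - (r + 4 * l^2 / f + 2 * v / (y * W)) * W"
      using W(2) by (simp add: algebra_simps)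
    finally have e: "(w1 * W1 + w2 * W2) / W = - (r + 4 * l^2 / f + 2 * v / (y * W)) * W" .
    have "(w1 * W1 + w2 * W2) / W^2 = (w1 * W1 + w2 * W2) / W / W" by (simp add: power2_eq_square)
    then show ?thesis unfolding e using W(2) by simp
  qed
  \<comment> \<open>Cayley-Hamilton for the Hessian of \<open>w\<close>, a symmetric 2 by 2 matrix
    of trace \<open>2 * \<sigma>\<close>: in the combination of its squared norm with its action on
    the gradient, the determinant cancels. This is where dimension two enters.\<close>
  have "(2 * (A^2 + 2 * B^2 + D^2) + 4 * \<kappa> * W) * W - (W1^2 + W2^2)
      = 4 * \<kappa> * W^2 - 4 * \<sigma> * (w1 * W1 + w2 * W2) + 8 * \<sigma>^2 * W"
  proof -
    have A: "A = 2 * \<sigma> - D" using tr by simp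
    show ?thesis unfolding W12 A W(1) by algebra
  qed
  then have "(LW * W - (W1^2 + W2^2)) / W^2
      = (4 * \<kappa> * W^2 - 4 * \<sigma> * (w1 * W1 + w2 * W2) + 8 * \<sigma>^2 * W) / W^2"
    unfolding LW \<kappa>_def by simp
  also have "\<dots> = 4 * \<kappa> - 4 * \<sigma> * ((w1 * W1 + w2 * W2) / W^2) + 8 * \<sigma>^2 / W"
    using W(2) by (simp add: add_divide_distrib diff_divide_distrib power2_eq_square distrib_left)
  finally have T1: "(LW * W - (W1^2 + W2^2)) / W^2
     = 4 * \<kappa> + 4 * \<sigma> * (r + 4 * l^2 / f + 2 * v / (y * W)) + 8 * \<sigma>^2 / W"
    unfolding vW by (simp add: algebra_simps)
  \<comment> \<open>A complete square plus the Lagrange defect \<open>W * Y - v^2\<close>. It uses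
    up \<open>2 * Y / y^2\<close>, so that the term \<open>- 2 * Y / y^2\<close> of the hypothesis
    becomes \<open>- 4 * Y / y^2\<close>.\<close>
  have amgm: "0 \<le> 8 * \<sigma>^2 / W + 8 * \<sigma> * v / (y * W) + 2 * Y / y^2"
  proof -
    have "8 * \<sigma>^2 / W + 8 * \<sigma> * v / (y * W) + 2 * Y / y^2
       = 2 / (W * y^2) * ((2 * \<sigma> * y + v)^2 + (W * Y - v^2))"
      using W(2) y(1) by (simp add: field_simps power2_eq_square)
    moreover have "W * Y - v^2 = (w1 * y2 - w2 * y1)^2"
      unfolding W(1) Y_def v_def by algebra
    ultimately show ?thesis using W(2) y(1) by simp
  qed
  have "6 * r * \<sigma> + 4 * \<kappa> + 16 * \<sigma> * l^2 / f + (8 * l^2 * \<sigma> + 8 * l^2 * W) / f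
      + 8 * l^4 * W / f^2 + 2 * S / y - 4 * Y / y^2 \<le> 0"
  proof -
    have "4 * \<sigma> * (r + 4 * l^2 / f + 2 * v / (y * W)) = 4 * (r * \<sigma>) + 16 * \<sigma> * l^2 / f + 8 * \<sigma> * v / (y * W)"
      by (simp add: algebra_simps)
    moreover have "4 * Y / y^2 = 2 * Y / y^2 + 2 * Y / y^2" by simp
    moreover have "r * (2 * \<sigma>) = 2 * (r * \<sigma>)" "6 * r * \<sigma> = 6 * (r * \<sigma>)" by simp_all
    ultimately show ?thesis
      using second amgm unfolding T1 Y_def [symmetric] by linarith
  qed
  from mult_left_mono [OF this, of l] l(1)
  have "l * (6 * r * \<sigma> + 4 * \<kappa> + 16 * \<sigma> * l^2 / f + (8 * l^2 * \<sigma> + 8 * l^2 * W) / f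
      + 8 * l^4 * W / f^2 + 2 * S / y - 4 * Y / y^2) \<le> 0" by simp
  moreover have "l * (6 * r * \<sigma> + 4 * \<kappa> + 16 * \<sigma> * l^2 / f + (8 * l^2 * \<sigma> + 8 * l^2 * W) / f
      + 8 * l^4 * W / f^2 + 2 * S / y - 4 * Y / y^2)
     = 6 * r * (l * \<sigma>) + 4 * (l * \<kappa>) + 24 * (l * \<sigma>) * l^2 / f + (8 * l^3 * W / f + 8 * l^5 * W / f^2)
       + 2 * (l * S) / y - 4 * (l * Y) / y^2"
    by (simp add: algebra_simps add_divide_distrib power2_eq_square power3_eq_cube eval_nat_numeral)
  moreover have "8 * l^3 * W / f + 8 * l^5 * W / f^2 = 8 * l^3 * W * (f + l^2) / f^2"
    using k(4) by (simp add: field_simps eval_nat_numeral)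
  moreover have "8 * l^3 * W * (f + l^2) / f^2 \<ge> 8 * l^3 * W / f^2"
  proof -
    \<comment> \<open>The sum is \<open>1 + e\<close>, so the two good terms together dominate
      \<open>8 l^3 W / f^2\<close>, uniformly in \<open>l\<close>.\<close>
    have "f + l^2 \<ge> 1" unfolding f(1) using f(2) by simp
    then have "8 * l^3 * W * 1 \<le> 8 * l^3 * W * (f + l^2)" using l W(2) by (intro mult_left_mono) auto
    then show ?thesis by (simp add: divide_right_mono)
  qed
  moreover have "r * k \<le> 4"
    using mult_mono [of r 4 k 1] r k by simp
  moreover have "k * l^2 / f \<le> 1"
  proof -
    have "k * l^2 \<le> f" using mult_mono [of k f "l^2" 1] k l2 by simp
    then show ?thesis using k(4) by simp
  qed
  moreover have "1 + l^2 \<ge> 1" "24 * (- k) * l^2 / f = - 24 * (k * l^2 / f)" "6 * r * (- k) = - 6 * (r * k)"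
    by simp_all
  moreover define Z where "Z = 8 * l^3 * W * (f + l^2) / f^2"
  moreover define q where "q = k * l^2 / f"
  moreover define Z0 where "Z0 = 8 * l^3 * W / f^2"
  moreover define t where "t = 2 * (l * S) / y"
  moreover define t' where "t' = 4 * (l * Y) / y^2"
  moreover define X where "X = l * (6 * r * \<sigma> + 4 * \<kappa> + 16 * \<sigma> * l^2 / f + (8 * l^2 * \<sigma> + 8 * l^2 * W) / f
      + 8 * l^4 * W / f^2 + 2 * S / y - 4 * Y / y^2)"
  ultimately have "X \<le> 0" "X = - 6 * (r * k) + 4 * (1 + l^2) + - 24 * q + Z + t - t'"
    "Z0 \<le> Z" "r * k \<le> 4" "q \<le> 1" "1 \<le> 1 + l^2"
    unfolding ls lk by (simp_all only:)
  \<comment> \<open>44 = 6 * 4 + 24 - 4, from \<open>r * k \<le> 4\<close>, \<open>q \<le> 1\<close>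
    and \<open>1 \<le> 1 + l^2\<close>.\<close>
  then have "Z0 + t - t' \<le> 44" by argo
  then have main: "8 * l^3 * W / f^2 + 2 * (l * S) / y - 4 * (l * Y) / y^2 \<le> 44"
    unfolding Z0_def t_def t'_def .
  have "(8 * l^3 * W / f^2 + 2 * (l * S) / y - 4 * (l * Y) / y^2) * y^2 \<le> 44 * y^2"
    using main by (intro mult_right_mono) auto
  also have "(8 * l^3 * W / f^2 + 2 * (l * S) / y - 4 * (l * Y) / y^2) * y^2
     = 8 * l^3 * W * y^2 / f^2 + 2 * (l * S) * y - 4 * (l * Y)"
    using y(1) by (simp add: field_simps power2_eq_square)
  finally have m2: "8 * l^3 * W * y^2 / f^2 + 2 * (l * S) * y - 4 * (l * Y) \<le> 44 * y^2" .
  have "y^2 \<le> 9" using y power_mono [of y 3 2] by simp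
  moreover have "(- (l * S)) * y \<le> 16 * 3"
  proof -
    have "(- (l * S)) * y \<le> 16 * y" using yb(2) y(1) by (intro mult_right_mono) auto
    then show ?thesis using y(2) by simp
  qed
  \<comment> \<open>With \<open>y \<le> 3\<close> the bound is 44 * 9 + 2 * 48 + 4 * 24 = 588, at
    most 8 * 74.\<close>
  ultimately have "8 * l^3 * W * y^2 / f^2 \<le> 8 * 74" using m2 yb(1) unfolding Y_def by simp
  then have "l^3 * W * y^2 / f^2 \<le> 74" by simp
  then show ?thesis using k(4) by (simp add: pos_divide_le_eq)
qed

text \<open>The weights 1, -2 and 2 are the exponents of \<open>W\<close>, \<open>f\<close> and
  \<open>3 - G\<close> in the function to be maximized; \<open>r\<close> is the exponent of
  \<open>l\<close>, whose logarithm is \<open>w\<close>.\<close>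

lemma along_log_combination:
  fixes w A B C :: "real^2 \<Rightarrow> real" and r :: real
  assumes V: "open V" and s: "smooth_on V w" "smooth_on V A" "smooth_on V B" "smooth_on V C"
    and pos: "\<And>u. u \<in> V \<Longrightarrow> A u > 0" "\<And>u. u \<in> V \<Longrightarrow> B u > 0" "\<And>u. u \<in> V \<Longrightarrow> C u > 0"
    and \<zeta>: "smooth_on V \<zeta>"
  defines "\<Psi> \<equiv> \<lambda>u. r * w u + ln (A u) - 2 * ln (B u) + 2 * ln (C u)"
  shows "smooth_on V \<Psi>"
    "u \<in> V \<Longrightarrow> along \<zeta> \<Psi> u = r * along \<zeta> w u + along \<zeta> A u / A u - 2 * (along \<zeta> B u / B u) + 2 * (along \<zeta> C u / C u)"
    "u \<in> V \<Longrightarrow> along \<zeta> (along \<zeta> \<Psi>) u = r * along \<zeta> (along \<zeta> w) u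
       + (along \<zeta> (along \<zeta> A) u * A u - along \<zeta> A u * along \<zeta> A u) / (A u * A u)
       - 2 * ((along \<zeta> (along \<zeta> B) u * B u - along \<zeta> B u * along \<zeta> B u) / (B u * B u))
       + 2 * ((along \<zeta> (along \<zeta> C) u * C u - along \<zeta> C u * along \<zeta> C u) / (C u * C u))"
proof -
  have nz: "\<And>u. u \<in> V \<Longrightarrow> A u \<noteq> 0" "\<And>u. u \<in> V \<Longrightarrow> B u \<noteq> 0" "\<And>u. u \<in> V \<Longrightarrow> C u \<noteq> 0"
    using pos by force+
  have ln: "smooth_on V (\<lambda>u. ln (A u))" "smooth_on V (\<lambda>u. ln (B u))" "smooth_on V (\<lambda>u. ln (C u))"
    by (intro smooth_on_ln V s pos; assumption)+
  have c: "smooth_on V (\<lambda>u. c * h u)" "u \<in> V \<Longrightarrow> along \<zeta> (\<lambda>u. c * h u) u = c * along \<zeta> h u"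
    if "smooth_on V h" for c :: real and h u
    using along_mult [OF _ smooth_on_const that, of u \<zeta> c] that by (auto intro: smooth_on_mult V smooth_on_const)
  have comb: "u \<in> V \<Longrightarrow> along \<zeta> (\<lambda>u. r * w u + a u - 2 * b u + 2 * c u) u
      = r * along \<zeta> w u + along \<zeta> a u - 2 * along \<zeta> b u + 2 * along \<zeta> c u"
    if sm: "smooth_on V w" "smooth_on V a" "smooth_on V b" "smooth_on V c" for u w a b c
  proof -
    assume u: "u \<in> V"
    have 1: "smooth_on V (\<lambda>u. r * w u + a u)" by (intro smooth_on_add V c sm)
    have 2: "smooth_on V (\<lambda>u. r * w u + a u - 2 * b u)" by (intro smooth_on_diff V c sm 1)
    show ?thesis
      unfolding along_add [OF u 2 c(1) [OF sm(4)]] along_diff [OF u 1 c(1) [OF sm(3)]]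
        along_add [OF u c(1) [OF sm(1)] sm(2)] c(2) [OF sm(1) u] c(2) [OF sm(3) u] c(2) [OF sm(4) u] ..
  qed
  show "smooth_on V \<Psi>"
    unfolding \<Psi>_def by (intro smooth_on_add smooth_on_diff V c s ln)
  show first: "along \<zeta> \<Psi> u = r * along \<zeta> w u + along \<zeta> A u / A u - 2 * (along \<zeta> B u / B u) + 2 * (along \<zeta> C u / C u)"
    if u: "u \<in> V" for u
    unfolding \<Psi>_def comb [OF s(1) ln u] along_ln [OF u s(2) pos(1) [OF u]]
      along_ln [OF u s(3) pos(2) [OF u]] along_ln [OF u s(4) pos(3) [OF u]] ..
  have q: "smooth_on V (\<lambda>u. along \<zeta> A u / A u)" "smooth_on V (\<lambda>u. along \<zeta> B u / B u)" "smooth_on V (\<lambda>u. along \<zeta> C u / C u)"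
    by (intro smooth_on_divide smooth_on_along V s \<zeta> nz; assumption)+
  assume u: "u \<in> V"
  have "along \<zeta> (along \<zeta> \<Psi>) u = along \<zeta> (\<lambda>u. r * along \<zeta> w u + along \<zeta> A u / A u - 2 * (along \<zeta> B u / B u) + 2 * (along \<zeta> C u / C u)) u"
    by (rule along_cong [OF V u first])
  also have "\<dots> = r * along \<zeta> (along \<zeta> w) u
       + (along \<zeta> (along \<zeta> A) u * A u - along \<zeta> A u * along \<zeta> A u) / (A u * A u)
       - 2 * ((along \<zeta> (along \<zeta> B) u * B u - along \<zeta> B u * along \<zeta> B u) / (B u * B u))
       + 2 * ((along \<zeta> (along \<zeta> C) u * C u - along \<zeta> C u * along \<zeta> C u) / (C u * C u))"
    unfolding comb [OF smooth_on_along [OF V s(1) \<zeta>] q u]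
      along_divide [OF u smooth_on_along [OF V s(2) \<zeta>] s(2) nz(1) [OF u]]
      along_divide [OF u smooth_on_along [OF V s(3) \<zeta>] s(3) nz(2) [OF u]]
      along_divide [OF u smooth_on_along [OF V s(4) \<zeta>] s(4) nz(3) [OF u]] ..
  finally show "along \<zeta> (along \<zeta> \<Psi>) u = r * along \<zeta> (along \<zeta> w) u
       + (along \<zeta> (along \<zeta> A) u * A u - along \<zeta> A u * along \<zeta> A u) / (A u * A u)
       - 2 * ((along \<zeta> (along \<zeta> B) u * B u - along \<zeta> B u * along \<zeta> B u) / (B u * B u))
       + 2 * ((along \<zeta> (along \<zeta> C) u * C u - along \<zeta> C u * along \<zeta> C u) / (C u * C u))" .
qed

text \<open>The squared Hilbert-Schmidt norm of the negative definite part of the moving frame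
  \<open>(\<phi>, \<nu>)\<close>, seen from the frame \<open>(a, b)\<close> at the base point: an exhaustion function
  whose gradient and Laplacian are controlled by itself.\<close>

definition exhaustion :: "real^4 \<Rightarrow> real^4 \<Rightarrow> real^4 \<Rightarrow> real^4 \<Rightarrow> real" where
  "exhaustion a b x n = form22 x a ^ 2 + form22 x b ^ 2 + form22 n a ^ 2 + form22 n b ^ 2"

lemma cauchy_schwarz_4:
  fixes c1 :: real
  shows "(c1 * d1 + c2 * d2 + c3 * d3 + c4 * d4)^2 \<le>
    (c1^2 + c2^2 + c3^2 + c4^2) * (d1^2 + d2^2 + d3^2 + d4^2)"
proof -
  have "(c1^2 + c2^2 + c3^2 + c4^2) * (d1^2 + d2^2 + d3^2 + d4^2) - (c1 * d1 + c2 * d2 + c3 * d3 + c4 * d4)^2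
    = (c1 * d2 - c2 * d1)^2 + (c1 * d3 - c3 * d1)^2 + (c1 * d4 - c4 * d1)^2
      + (c2 * d3 - c3 * d2)^2 + (c2 * d4 - c4 * d2)^2 + (c3 * d4 - c4 * d3)^2"
    by algebra
  then show ?thesis by (smt (verit) zero_le_power2)
qed

context flat_frame
begin

text \<open>The expansion of \<open>a\<close> in the moving frame, paired with \<open>a\<close>
  itself. The left-hand side is the squared gradient of \<open>form22 (\<phi> u) a\<close> in the
  induced metric, which is thus controlled by the timelike coordinates of \<open>a\<close>.\<close>

lemma gradient_position:
  assumes u: "u \<in> V"
  shows "l u * (form22 (x1 u) a ^ 2 + form22 (x2 u) a ^ 2)
    = form22 a a + form22 (\<phi> u) a ^ 2 + form22 (\<nu> u) a ^ 2"
  using arg_cong [OF frame_expansion [OF u, of a], of "form22 a"]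
  by (simp add: form22_commute power2_eq_square algebra_simps)

definition "W u = w1 u ^ 2 + w2 u ^ 2"

lemma smooth_W: "smooth_on V W"
  unfolding W_def [abs_def] by (intro smooth_intros open_V smooth_w)

lemma along_square: "u \<in> V \<Longrightarrow> smooth_on V f \<Longrightarrow> along \<zeta> (\<lambda>u. (f u)^2) u = 2 * f u * along \<zeta> f u" for f :: "real^2 \<Rightarrow> real"
  unfolding power2_eq_square by (subst along_mult) auto

lemma along_along_square:
  fixes f :: "real^2 \<Rightarrow> real"
  assumes u: "u \<in> V" and f: "smooth_on V f" and \<zeta>: "smooth_on V \<zeta>"
  shows "along \<zeta> (along \<zeta> (\<lambda>u. (f u)^2)) u = 2 * (along \<zeta> f u)^2 + 2 * f u * along \<zeta> (along \<zeta> f) u"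
proof -
  have "along \<zeta> (along \<zeta> (\<lambda>u. (f u)^2)) u = along \<zeta> (\<lambda>u. (2 * f u) * along \<zeta> f u) u"
    by (rule along_cong [OF open_V u]) (simp add: along_square f)
  also have "\<dots> = (2 * f u) * along \<zeta> (along \<zeta> f) u + along \<zeta> (\<lambda>u. 2 * f u) u * along \<zeta> f u"
    by (rule along_mult [OF u]) (intro smooth_on_mult smooth_on_const smooth_on_along open_V f \<zeta>)+
  also have "along \<zeta> (\<lambda>u. 2 * f u) u = 2 * along \<zeta> f u"
    using along_mult [OF u smooth_on_const f, of \<zeta> 2] by simp
  finally show ?thesis by (simp add: power2_eq_square)
qed

lemma along_W:
  assumes u: "u \<in> V"
  shows "along \<zeta> W u = 2 * (w1 u * along \<zeta> w1 u + w2 u * along \<zeta> w2 u)"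
proof -
  have s: "smooth_on V (\<lambda>u. (w1 u)^2)" "smooth_on V (\<lambda>u. (w2 u)^2)"
    by (intro smooth_intros open_V smooth_w)+
  show ?thesis unfolding W_def [abs_def] along_add [OF u s]
    using along_square [OF u smooth_w(2)] along_square [OF u smooth_w(3)] by (simp add: algebra_simps)
qed

text \<open>The flat Bochner formula: the Laplacian of a squared gradient is twice the squared
  Hessian plus twice the pairing of the gradient with the gradient of the Laplacian. The latter
  comes from \<open>sinh_gordon\<close>, whose right-hand side has derivative
  \<open>2 * (l + 1 / l)\<close> with respect to \<open>w\<close>.\<close>

lemma laplacian_W:
  assumes u: "u \<in> V"
  shows "along \<xi> (along \<xi> W) u + along \<eta> (along \<eta> W) u
    = 2 * ((along \<xi> w1 u)^2 + 2 * (along \<xi> w2 u)^2 + (along \<eta> w2 u)^2) + 4 * (l u + 1 / l u) * W u"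
proof -
  have L: "l u > 0" by (rule l_pos [OF u])
  have s: "smooth_on V (\<lambda>u. (w1 u)^2)" "smooth_on V (\<lambda>u. (w2 u)^2)"
    by (intro smooth_intros open_V smooth_w)+
  have 1: "along \<zeta> (along \<zeta> W) u = 2 * (along \<zeta> w1 u)^2 + 2 * w1 u * along \<zeta> (along \<zeta> w1) u
     + (2 * (along \<zeta> w2 u)^2 + 2 * w2 u * along \<zeta> (along \<zeta> w2) u)" if \<zeta>: "smooth_on V \<zeta>" for \<zeta>
  proof -
    have "along \<zeta> (along \<zeta> W) u = along \<zeta> (\<lambda>u. along \<zeta> (\<lambda>u. (w1 u)^2) u + along \<zeta> (\<lambda>u. (w2 u)^2) u) u"
      unfolding W_def [abs_def] by (rule along_cong [OF open_V u]) (rule along_add [OF _ s])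
    also have "\<dots> = along \<zeta> (along \<zeta> (\<lambda>u. (w1 u)^2)) u + along \<zeta> (along \<zeta> (\<lambda>u. (w2 u)^2)) u"
      by (rule along_add [OF u]) (intro smooth_on_along open_V s \<zeta>)+
    finally show ?thesis
      unfolding along_along_square [OF u smooth_w(2) \<zeta>] along_along_square [OF u smooth_w(3) \<zeta>] .
  qed
  have c: "along \<eta> w1 u = along \<xi> w2 u" by (rule commute [OF u smooth_w(1), symmetric])
  have sl: "smooth_on V (\<lambda>u. 1 / l u)"
    by (intro smooth_on_divide smooth_on_const open_V smooth) (use l_pos in force)
  have lap: "along \<zeta> (\<lambda>u. along \<xi> w1 u + along \<eta> w2 u) u = 2 * (l u + 1 / l u) * along \<zeta> w u" for \<zeta>
  proof -
    have "along \<zeta> (\<lambda>u. along \<xi> w1 u + along \<eta> w2 u) u = along \<zeta> (\<lambda>u. 2 * (l u - 1 / l u)) u"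
      by (rule along_cong [OF open_V u]) (rule sinh_gordon)
    also have "\<dots> = 2 * along \<zeta> (\<lambda>u. l u - 1 / l u) u"
      using along_mult [OF u smooth_on_const smooth_on_diff [OF open_V smooth(5) sl], of \<zeta> 2] by simp
    also have "\<dots> = 2 * (along \<zeta> l u - along \<zeta> (\<lambda>u. 1 / l u) u)"
      unfolding along_diff [OF u smooth(5) sl] ..
    finally show ?thesis unfolding along_inverse_l [OF u] along_l [OF u] using L by (simp add: field_simps)
  qed
  have sm: "smooth_on V (along \<xi> w1)" "smooth_on V (along \<eta> w2)"
    by (intro smooth_on_along open_V smooth smooth_w)+
  have L1: "along \<xi> (along \<xi> w1) u + along \<eta> (along \<eta> w1) u = 2 * (l u + 1 / l u) * w1 u"
  proof -
    have "along \<eta> (along \<eta> w1) u = along \<eta> (along \<xi> w2) u"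
      by (rule along_cong [OF open_V u]) (rule commute [OF _ smooth_w(1), symmetric])
    also have "\<dots> = along \<xi> (along \<eta> w2) u" by (rule commute [OF u smooth_w(3), symmetric])
    finally show ?thesis using lap [of \<xi>] along_add [OF u sm, of \<xi>] by simp
  qed
  have L2: "along \<xi> (along \<xi> w2) u + along \<eta> (along \<eta> w2) u = 2 * (l u + 1 / l u) * w2 u"
  proof -
    have "along \<xi> (along \<xi> w2) u = along \<xi> (along \<eta> w1) u"
      by (rule along_cong [OF open_V u]) (rule commute [OF _ smooth_w(1)])
    also have "\<dots> = along \<eta> (along \<xi> w1) u" by (rule commute [OF u smooth_w(2)])
    finally show ?thesis using lap [of \<eta>] along_add [OF u sm, of \<eta>] by simp
  qed
  have "along \<xi> (along \<xi> W) u + along \<eta> (along \<eta> W) u =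
     2 * ((along \<xi> w1 u)^2 + 2 * (along \<xi> w2 u)^2 + (along \<eta> w2 u)^2)
     + 2 * w1 u * (along \<xi> (along \<xi> w1) u + along \<eta> (along \<eta> w1) u)
     + 2 * w2 u * (along \<xi> (along \<xi> w2) u + along \<eta> (along \<eta> w2) u)"
    unfolding 1 [OF smooth(3)] 1 [OF smooth(4)] c by (simp add: algebra_simps)
  then show ?thesis unfolding L1 L2 W_def by (simp add: algebra_simps power2_eq_square)
qed

end

context flat_frame
begin

lemma along_along_l:
  assumes u: "u \<in> V" and \<zeta>: "smooth_on V \<zeta>"
  shows "along \<zeta> (along \<zeta> l) u = l u * along \<zeta> (along \<zeta> w) u + l u * (along \<zeta> w u)^2"
proof -
  have "along \<zeta> (along \<zeta> l) u = along \<zeta> (\<lambda>u. l u * along \<zeta> w u) u"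
    by (rule along_cong [OF open_V u]) (rule along_l)
  also have "\<dots> = l u * along \<zeta> (along \<zeta> w) u + along \<zeta> l u * along \<zeta> w u"
    by (rule along_mult [OF u smooth(5) smooth_on_along [OF open_V smooth_w(1) \<zeta>]])
  finally show ?thesis unfolding along_l [OF u] by (simp add: power2_eq_square)
qed

text \<open>The left-hand side is the squared gradient of the principal curvature in the induced
  metric times the cutoff. The maximized function is differentiated along \<open>\<xi>\<close> and
  \<open>\<eta>\<close>, and the outcome is handed to \<open>bernstein_algebra\<close>. The exponent
  \<open>r\<close> will be \<open>3 + \<alpha>\<close>, hence its range.\<close>

lemma bernstein_max:
  fixes a b :: "real^4" and e r :: real
  defines "G \<equiv> \<lambda>u. exhaustion a b (\<phi> u) (\<nu> u)"
  defines "f \<equiv> \<lambda>u. 1 + e - (l u)^2"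
  assumes u: "u \<in> V" and ab: "form22 a a = -1" "form22 b b = -1"
    and l1: "\<And>u. u \<in> V \<Longrightarrow> l u \<le> 1" and e: "e > 0" and r: "3 \<le> r" "r \<le> 4"
    and G3: "\<And>u. u \<in> V \<Longrightarrow> G u < 3" and Wpos: "\<And>u. u \<in> V \<Longrightarrow> W u > 0"
    and max: "\<And>v. v \<in> V \<Longrightarrow> r * w v + ln (W v) - 2 * ln (f v) + 2 * ln (3 - G v)
       \<le> r * w u + ln (W u) - 2 * ln (f u) + 2 * ln (3 - G u)"
  shows "l u ^ 3 * W u * (3 - G u)^2 \<le> 74 * (f u)^2"
proof -
  define \<Psi> where "\<Psi> = (\<lambda>u. r * w u + ln (W u) - 2 * ln (f u) + 2 * ln (3 - G u))"
  have L: "0 < l u" "l u \<le> 1" using l_pos l1 u by auto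
  have fpos: "f u > 0" if "u \<in> V" for u
  proof -
    have "(l u)^2 \<le> 1" using l_pos [OF that] l1 [OF that] by (simp add: power_le_one)
    then show ?thesis unfolding f_def using e by simp
  qed
  have ypos: "3 - G u > 0" if "u \<in> V" for u using G3 [OF that] by simp
  have sl2: "smooth_on V (\<lambda>u. (l u)^2)" by (intro smooth_intros open_V smooth)
  have sf: "smooth_on V f" unfolding f_def by (intro smooth_on_diff smooth_on_const open_V sl2)
  have sF: "smooth_on V (\<lambda>u. form22 (\<phi> u) c)" "smooth_on V (\<lambda>u. form22 (\<nu> u) c)" for c
    by (intro smooth_intros open_V smooth)+
  have sS: "smooth_on V (\<lambda>u. (form22 (\<phi> u) c)^2)" "smooth_on V (\<lambda>u. (form22 (\<nu> u) c)^2)" for c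
    by (intro smooth_on_power sF open_V)+
  have sG: "smooth_on V G"
    unfolding G_def exhaustion_def by (intro smooth_on_add sS open_V)
  have sy: "smooth_on V (\<lambda>u. 3 - G u)" by (intro smooth_on_diff smooth_on_const open_V sG)
  note comb = along_log_combination [OF open_V smooth_w(1) smooth_W sf sy Wpos fpos ypos, where r = r, folded \<Psi>_def]
  have comb3: "along \<zeta> (along \<zeta> \<Psi>) u = r * along \<zeta> (along \<zeta> w) u
       + (along \<zeta> (along \<zeta> W) u * W u - along \<zeta> W u * along \<zeta> W u) / (W u * W u)
       - 2 * ((along \<zeta> (along \<zeta> f) u * f u - along \<zeta> f u * along \<zeta> f u) / (f u * f u))
       + 2 * ((along \<zeta> (along \<zeta> (\<lambda>u. 3 - G u)) u * (3 - G u)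
          - along \<zeta> (\<lambda>u. 3 - G u) u * along \<zeta> (\<lambda>u. 3 - G u) u) / ((3 - G u) * (3 - G u)))"
    if "smooth_on V \<zeta>" for \<zeta>
    by (rule comb(3)) (use u that in auto)
  have first: "along \<zeta> \<Psi> u = 0" and second: "along \<zeta> (along \<zeta> \<Psi>) u \<le> 0" if "smooth_on V \<zeta>" for \<zeta>
    using max_second_derivative(2,3) [OF open_V comb(1) [OF _ _ _ that] that u] max unfolding \<Psi>_def by blast+
  have aF: "along \<zeta> (\<lambda>u. form22 (F u) c) v = form22 (along \<zeta> F v) c" if "v \<in> V" "smooth_on V F" for F \<zeta> c v
    using along_form22 [OF that smooth_on_const, of \<zeta> c] by simp
  have aaF: "along \<zeta> (along \<zeta> (\<lambda>u. form22 (F u) c)) u = form22 (along \<zeta> (along \<zeta> F) u) c"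
    if "smooth_on V F" "smooth_on V \<zeta>" for F \<zeta> c
  proof -
    have "along \<zeta> (along \<zeta> (\<lambda>u. form22 (F u) c)) u = along \<zeta> (\<lambda>u. form22 (along \<zeta> F u) c) u"
      by (rule along_cong [OF open_V u]) (rule aF [OF _ that(1)])
    also have "\<dots> = form22 (along \<zeta> (along \<zeta> F) u) c"
      by (rule aF [OF u smooth_on_along [OF open_V that]])
    finally show ?thesis .
  qed
  have alG: "along \<zeta> G v = 2 * (form22 (\<phi> v) a * form22 (along \<zeta> \<phi> v) a + form22 (\<phi> v) b * form22 (along \<zeta> \<phi> v) b
     + form22 (\<nu> v) a * form22 (along \<zeta> \<nu> v) a + form22 (\<nu> v) b * form22 (along \<zeta> \<nu> v) b)"
    if v: "v \<in> V" for \<zeta> v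
    unfolding G_def exhaustion_def
    by (simp add: along_add [OF v] sS smooth_on_add open_V along_square [OF v sF(1)] along_square [OF v sF(2)]
       aF [OF v smooth(1)] aF [OF v smooth(2)])
  have alalG: "along \<zeta> (along \<zeta> G) u = 2 * (form22 (along \<zeta> \<phi> u) a ^ 2 + form22 (along \<zeta> \<phi> u) b ^ 2
       + form22 (along \<zeta> \<nu> u) a ^ 2 + form22 (along \<zeta> \<nu> u) b ^ 2)
     + 2 * (form22 (\<phi> u) a * form22 (along \<zeta> (along \<zeta> \<phi>) u) a + form22 (\<phi> u) b * form22 (along \<zeta> (along \<zeta> \<phi>) u) b
     + form22 (\<nu> u) a * form22 (along \<zeta> (along \<zeta> \<nu>) u) a + form22 (\<nu> u) b * form22 (along \<zeta> (along \<zeta> \<nu>) u) b)"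
    if \<zeta>: "smooth_on V \<zeta>" for \<zeta>
  proof -
    have "along \<zeta> (along \<zeta> G) u = along \<zeta> (\<lambda>u. along \<zeta> (\<lambda>u. (form22 (\<phi> u) a)^2) u + along \<zeta> (\<lambda>u. (form22 (\<phi> u) b)^2) u
       + along \<zeta> (\<lambda>u. (form22 (\<nu> u) a)^2) u + along \<zeta> (\<lambda>u. (form22 (\<nu> u) b)^2) u) u"
      unfolding G_def exhaustion_def
      by (rule along_cong [OF open_V u]) (simp add: along_add sS smooth_on_add open_V)
    also have "\<dots> = along \<zeta> (along \<zeta> (\<lambda>u. (form22 (\<phi> u) a)^2)) u + along \<zeta> (along \<zeta> (\<lambda>u. (form22 (\<phi> u) b)^2)) u
       + along \<zeta> (along \<zeta> (\<lambda>u. (form22 (\<nu> u) a)^2)) u + along \<zeta> (along \<zeta> (\<lambda>u. (form22 (\<nu> u) b)^2)) u"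
      using smooth_on_along [OF open_V sS(1) \<zeta>] smooth_on_along [OF open_V sS(2) \<zeta>]
      by (simp add: along_add [OF u] smooth_on_add open_V)
    finally show ?thesis
      unfolding along_along_square [OF u sF(1) \<zeta>] along_along_square [OF u sF(2) \<zeta>]
        aaF [OF smooth(1) \<zeta>] aaF [OF smooth(2) \<zeta>] aF [OF u smooth(1)] aF [OF u smooth(2)]
      by (simp add: algebra_simps)
  qed
  define q where "q c = form22 (x1 u) c ^ 2 + form22 (x2 u) c ^ 2" for c
  have q0: "q c \<ge> 0" for c unfolding q_def by simp
  \<comment> \<open>Each of the unit timelike vectors \<open>a\<close> and \<open>b\<close>
    contributes -1, so the squared gradients of the two position coordinates add up to
    \<open>G u - 2\<close>. In particular \<open>G\<close> is never below 2.\<close>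
  have q: "l u * (q a + q b) = G u - 2"
    using gradient_position [OF u, of a] gradient_position [OF u, of b] ab
    unfolding q_def G_def exhaustion_def by (simp add: algebra_simps)
  have G2: "0 \<le> G u - 2" unfolding q [symmetric] using L q0 by simp
  have l2: "(l u)^2 \<le> 1" using L by (simp add: power_le_one)
  \<comment> \<open>Cauchy-Schwarz bounds the left-hand side by
    \<open>4 * G u * (1 + (l u)^2) * (G u - 2)\<close>, and 24 = 4 * 3 * 2 * 1.\<close>
  have lG: "l u * ((along \<xi> G u)^2 + (along \<eta> G u)^2) \<le> 24"
  proof -
    have nn: "form22 (along \<xi> \<nu> u) c = l u * form22 (x1 u) c" "form22 (along \<eta> \<nu> u) c = - l u * form22 (x2 u) c" for c
      unfolding principal [OF u] by simp_all
    have "(along \<xi> G u)^2 \<le> 4 * (G u * ((1 + (l u)^2) * (form22 (x1 u) a ^ 2 + form22 (x1 u) b ^ 2)))"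
      using cauchy_schwarz_4 [of "form22 (\<phi> u) a" "form22 (x1 u) a" "form22 (\<phi> u) b" "form22 (x1 u) b"
         "form22 (\<nu> u) a" "l u * form22 (x1 u) a" "form22 (\<nu> u) b" "l u * form22 (x1 u) b"]
      unfolding alG [OF u] nn power_mult_distrib unfolding G_def exhaustion_def by (simp add: algebra_simps)
    moreover have "(along \<eta> G u)^2 \<le> 4 * (G u * ((1 + (l u)^2) * (form22 (x2 u) a ^ 2 + form22 (x2 u) b ^ 2)))"
      using cauchy_schwarz_4 [of "form22 (\<phi> u) a" "form22 (x2 u) a" "form22 (\<phi> u) b" "form22 (x2 u) b"
         "form22 (\<nu> u) a" "- l u * form22 (x2 u) a" "form22 (\<nu> u) b" "- l u * form22 (x2 u) b"]
      unfolding alG [OF u] nn power_mult_distrib unfolding G_def exhaustion_def by (simp add: algebra_simps)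
    ultimately have "(along \<xi> G u)^2 + (along \<eta> G u)^2 \<le> 4 * (G u * ((1 + (l u)^2) * (q a + q b)))"
      unfolding q_def by (simp add: algebra_simps)
    then have "l u * ((along \<xi> G u)^2 + (along \<eta> G u)^2) \<le> l u * (4 * (G u * ((1 + (l u)^2) * (q a + q b))))"
      using L by (intro mult_left_mono) auto
    also have "\<dots> = 4 * G u * (1 + (l u)^2) * (G u - 2)"
      unfolding q [symmetric] by simp
    also have "\<dots> \<le> 4 * 3 * 2 * 1"
    proof -
      have "4 * G u \<le> 4 * 3" "4 * G u \<ge> 0" "1 + (l u)^2 \<le> 2" "G u - 2 \<le> 1" "0 \<le> 1 + (l u)^2"
        using G3 [OF u] l2 G2 by simp_all
      then show ?thesis using G2 by (intro mult_mono) auto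
    qed
    finally show ?thesis by simp
  qed
  \<comment> \<open>At most \<open>4 + 4 * G u\<close>: the squared gradients give at most 4, the
    Laplacians of \<open>\<phi>\<close> and \<open>\<nu>\<close> at most
    \<open>4 * G u\<close>.\<close>
  have DG: "l u * (along \<xi> (along \<xi> G) u + along \<eta> (along \<eta> G) u) \<le> 16"
  proof -
    have lap: "form22 (along \<xi> x1 u) c + form22 (along \<eta> x2 u) c = 2 / l u * form22 (\<phi> u) c"
      "form22 (along \<xi> (along \<xi> \<nu>) u) c + form22 (along \<eta> (along \<eta> \<nu>) u) c = 2 * l u * form22 (\<nu> u) c" for c
      using arg_cong [OF laplacian_\<phi> [OF u], of "\<lambda>z. form22 z c"] arg_cong [OF laplacian_\<nu> [OF u], of "\<lambda>z. form22 z c"]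
      by simp_all
    have "along \<xi> (along \<xi> G) u + along \<eta> (along \<eta> G) u = 2 * (1 + (l u)^2) * (q a + q b)
      + 2 * (form22 (\<phi> u) a * (form22 (along \<xi> x1 u) a + form22 (along \<eta> x2 u) a)
        + form22 (\<phi> u) b * (form22 (along \<xi> x1 u) b + form22 (along \<eta> x2 u) b)
        + form22 (\<nu> u) a * (form22 (along \<xi> (along \<xi> \<nu>) u) a + form22 (along \<eta> (along \<eta> \<nu>) u) a)
        + form22 (\<nu> u) b * (form22 (along \<xi> (along \<xi> \<nu>) u) b + form22 (along \<eta> (along \<eta> \<nu>) u) b))"
      unfolding alalG [OF smooth(3)] alalG [OF smooth(4)] q_def principal [OF u]
      by (simp add: algebra_simps)
    then have "l u * (along \<xi> (along \<xi> G) u + along \<eta> (along \<eta> G) u) =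
       2 * (1 + (l u)^2) * (l u * (q a + q b)) + 4 * (form22 (\<phi> u) a ^ 2 + form22 (\<phi> u) b ^ 2)
       + 4 * ((l u)^2 * (form22 (\<nu> u) a ^ 2 + form22 (\<nu> u) b ^ 2))"
      unfolding lap using L by (simp add: algebra_simps power2_eq_square)
    also have "\<dots> \<le> 2 * 2 * 1 + 4 * (form22 (\<phi> u) a ^ 2 + form22 (\<phi> u) b ^ 2) + 4 * (1 * (form22 (\<nu> u) a ^ 2 + form22 (\<nu> u) b ^ 2))"
      using L l2 q G3 [OF u] q0 G2 by (intro add_mono mult_mono mult_right_mono mult_left_mono) auto
    also have "\<dots> = 4 + 4 * G u" unfolding G_def exhaustion_def by simp
    finally show ?thesis using G3 [OF u] by simp
  qed
  have ay: "along \<zeta> (\<lambda>u. 3 - G u) v = - along \<zeta> G v" if "v \<in> V" for \<zeta> v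
    using along_diff [OF that smooth_on_const sG, of \<zeta> 3] by simp
  have aay: "along \<zeta> (along \<zeta> (\<lambda>u. 3 - G u)) u = - along \<zeta> (along \<zeta> G) u" if "smooth_on V \<zeta>" for \<zeta>
  proof -
    have "along \<zeta> (along \<zeta> (\<lambda>u. 3 - G u)) u = along \<zeta> (\<lambda>u. - along \<zeta> G u) u"
      by (rule along_cong [OF open_V u ay])
    then show ?thesis using along_minus [OF u smooth_on_along [OF open_V sG that]] by simp
  qed
  have af: "along \<zeta> f v = - along \<zeta> (\<lambda>u. (l u)^2) v" if "v \<in> V" for \<zeta> v
    unfolding f_def using along_diff [OF that smooth_on_const sl2, of \<zeta> "1 + e"] by simp
  have aaf: "along \<zeta> (along \<zeta> f) u = - (2 * (l u)^2 * along \<zeta> (along \<zeta> w) u + 4 * (l u)^2 * (along \<zeta> w u)^2)"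
    if \<zeta>: "smooth_on V \<zeta>" for \<zeta>
  proof -
    have "along \<zeta> (along \<zeta> f) u = along \<zeta> (\<lambda>u. - along \<zeta> (\<lambda>u. (l u)^2) u) u"
      by (rule along_cong [OF open_V u af])
    also have "\<dots> = - along \<zeta> (along \<zeta> (\<lambda>u. (l u)^2)) u"
      by (rule along_minus [OF u smooth_on_along [OF open_V sl2 \<zeta>]])
    finally show ?thesis
      unfolding along_along_square [OF u smooth(5) \<zeta>] along_along_l [OF u \<zeta>] along_l [OF u]
      by (simp add: algebra_simps power2_eq_square)
  qed
  have af': "along \<zeta> f u = - 2 * (l u)^2 * along \<zeta> w u" for \<zeta>
    unfolding af [OF u] along_square [OF u smooth(5)] along_l [OF u] by (simp add: power2_eq_square)
  have c: "along \<eta> w1 u = along \<xi> w2 u" by (rule commute [OF u smooth_w(1), symmetric])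
  show ?thesis
  proof (rule bernstein_algebra [where l = "l u" and W = "W u" and ?w1.0 = "w1 u" and ?w2.0 = "w2 u"
      and \<sigma> = "l u - 1 / l u" and A = "along \<xi> w1 u" and B = "along \<xi> w2 u" and D = "along \<eta> w2 u"
      and f = "f u" and e = e and r = r and y = "3 - G u" and ?W1.0 = "along \<xi> W u" and ?W2.0 = "along \<eta> W u"
      and ?y1.0 = "- along \<xi> G u" and ?y2.0 = "- along \<eta> G u" and LW = "along \<xi> (along \<xi> W) u + along \<eta> (along \<eta> W) u"
      and S = "- (along \<xi> (along \<xi> G) u + along \<eta> (along \<eta> G) u)"])
    show "r * w1 u + along \<xi> W u / W u + 4 * (l u)^2 * w1 u / f u + 2 * (- along \<xi> G u) / (3 - G u) = 0"
      "r * w2 u + along \<eta> W u / W u + 4 * (l u)^2 * w2 u / f u + 2 * (- along \<eta> G u) / (3 - G u) = 0"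
      using first [OF smooth(3)] first [OF smooth(4)] comb(2) [OF _ _ _ smooth(3) u] comb(2) [OF _ _ _ smooth(4) u]
      unfolding af' ay [OF u] by simp_all
    \<comment> \<open>The sum of the two logarithmic second derivatives, stated for plain real
      numbers to keep the algebra apart from the derivatives.\<close>
    have gen: "r * (A1 + A2) + ((B1 + B2) * Wu - (C1^2 + C2^2)) / Wu^2 
         + (4 * L2 * (A1 + A2) + 8 * L2 * Wu) / fu + 8 * L2^2 * Wu / fu^2
         + 2 * (- (S1 + S2)) / yu - 2 * ((- Y1)^2 + (- Y2)^2) / yu^2
       = (r * A1 + (B1 * Wu - C1 * C1) / (Wu * Wu) - 2 * ((- (2 * L2 * A1 + 4 * L2 * p1^2) * fu - (- 2 * L2 * p1) * (- 2 * L2 * p1)) / (fu * fu))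
           + 2 * ((- S1 * yu - (- Y1) * (- Y1)) / (yu * yu)))
       + (r * A2 + (B2 * Wu - C2 * C2) / (Wu * Wu) - 2 * ((- (2 * L2 * A2 + 4 * L2 * p2^2) * fu - (- 2 * L2 * p2) * (- 2 * L2 * p2)) / (fu * fu))
           + 2 * ((- S2 * yu - (- Y2) * (- Y2)) / (yu * yu)))"
      if "Wu = p1^2 + p2^2" "Wu > 0" "fu > 0" "yu > 0" for A1 A2 B1 B2 Wu C1 C2 L2 fu S1 S2 yu Y1 Y2 p1 p2 :: real
    proof -
      have 1: "((B1 + B2) * Wu - (C1^2 + C2^2)) / Wu^2 = (B1 * Wu - C1 * C1) / (Wu * Wu) + (B2 * Wu - C2 * C2) / (Wu * Wu)"
        by (simp add: power2_eq_square add_divide_distrib [symmetric] algebra_simps)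
      have 2: "(4 * L2 * (A1 + A2) + 8 * L2 * Wu) / fu + 8 * L2^2 * Wu / fu^2
        = - 2 * ((- (2 * L2 * A1 + 4 * L2 * p1^2) * fu - (- 2 * L2 * p1) * (- 2 * L2 * p1)) / (fu * fu))
          - 2 * ((- (2 * L2 * A2 + 4 * L2 * p2^2) * fu - (- 2 * L2 * p2) * (- 2 * L2 * p2)) / (fu * fu))"
        using that by (simp add: power2_eq_square field_simps)
      have 3: "2 * (- (S1 + S2)) / yu - 2 * ((- Y1)^2 + (- Y2)^2) / yu^2
        = 2 * ((- S1 * yu - (- Y1) * (- Y1)) / (yu * yu)) + 2 * ((- S2 * yu - (- Y2) * (- Y2)) / (yu * yu))"
        using that by (simp add: power2_eq_square field_simps)
      have "r * (A1 + A2) = r * A1 + r * A2" by (rule distrib_left)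
      then show ?thesis using 1 2 3 by argo
    qed
    have sum: "along \<xi> (along \<xi> \<Psi>) u + along \<eta> (along \<eta> \<Psi>) u \<le> 0"
      using second [OF smooth(3)] second [OF smooth(4)] by simp
    have eq: "r * (along \<xi> w1 u + along \<eta> w2 u) + ((along \<xi> (along \<xi> W) u + along \<eta> (along \<eta> W) u) * W u - ((along \<xi> W u)^2 + (along \<eta> W u)^2)) / (W u)^2
       + (4 * (l u)^2 * (along \<xi> w1 u + along \<eta> w2 u) + 8 * (l u)^2 * W u) / f u + 8 * ((l u)^2)^2 * W u / (f u)^2
       + 2 * (- (along \<xi> (along \<xi> G) u + along \<eta> (along \<eta> G) u)) / (3 - G u) - 2 * ((- along \<xi> G u)^2 + (- along \<eta> G u)^2) / (3 - G u)^2
       = along \<xi> (along \<xi> \<Psi>) u + along \<eta> (along \<eta> \<Psi>) u"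
      unfolding comb3 [OF smooth(3)] comb3 [OF smooth(4)] aaf [OF smooth(3)] aaf [OF smooth(4)]
        af' ay [OF u] aay [OF smooth(3)] aay [OF smooth(4)]
      by (rule gen [OF W_def Wpos [OF u] fpos [OF u] ypos [OF u]])
    show "r * (2 * (l u - 1 / l u)) + ((along \<xi> (along \<xi> W) u + along \<eta> (along \<eta> W) u) * W u - ((along \<xi> W u)^2 + (along \<eta> W u)^2)) / (W u)^2
       + (8 * (l u)^2 * (l u - 1 / l u) + 8 * (l u)^2 * W u) / f u + 8 * (l u)^4 * W u / (f u)^2
       + 2 * (- (along \<xi> (along \<xi> G) u + along \<eta> (along \<eta> G) u)) / (3 - G u) - 2 * ((- along \<xi> G u)^2 + (- along \<eta> G u)^2) / (3 - G u)^2 \<le> 0"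
    proof -
      have e1: "4 * (l u)^2 * (2 * (l u - 1 / l u)) = 8 * (l u)^2 * (l u - 1 / l u)" by simp
      have e2: "((l u)^2)^2 = (l u)^4" by simp
      from sum show ?thesis unfolding eq [symmetric] sinh_gordon [OF u] e1 e2 .
    qed
    show "3 - G u \<le> 3" using G2 by simp
    show "l u * ((- along \<xi> G u)^2 + (- along \<eta> G u)^2) \<le> 24" using lG by simp
    show "- (l u * - (along \<xi> (along \<xi> G) u + along \<eta> (along \<eta> G) u)) \<le> 16" using DG by (simp add: algebra_simps)
    show "along \<xi> w1 u + along \<eta> w2 u = 2 * (l u - 1 / l u)" by (rule sinh_gordon [OF u])
    show "along \<xi> W u = 2 * (w1 u * along \<xi> w1 u + w2 u * along \<xi> w2 u)" by (rule along_W [OF u])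
    show "along \<eta> W u = 2 * (w1 u * along \<xi> w2 u + w2 u * along \<eta> w2 u)" unfolding along_W [OF u] c ..
    show "along \<xi> (along \<xi> W) u + along \<eta> (along \<eta> W) u
      = 2 * ((along \<xi> w1 u)^2 + 2 * (along \<xi> w2 u)^2 + (along \<eta> w2 u)^2) + 4 * (l u + 1 / l u) * W u"
      by (rule laplacian_W [OF u])
  qed (use L e r W_def f_def Wpos [OF u] ypos [OF u] in auto)
qed

end

section \<open>Maximal immersions\<close>

text \<open>The squared norm of the gradient of \<open>curv \<phi>\<close> in the induced metric.\<close>

definition gradsq :: "(real^2 \<Rightarrow> real^4) \<Rightarrow> real^2 \<Rightarrow> real" where
  "gradsq \<phi> u = (g22 \<phi> u * (dd (curv \<phi>) u (axis 1 1))^2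
     - 2 * g12 \<phi> u * dd (curv \<phi>) u (axis 1 1) * dd (curv \<phi>) u (axis 2 1)
     + g11 \<phi> u * (dd (curv \<phi>) u (axis 2 1))^2) / gdet \<phi> u"

lemma smooth_on_vector_2:
  assumes "open U" "smooth_on U a" "smooth_on U b"
  shows "smooth_on U (\<lambda>u. vector [a u, b u] :: real^2)"
proof -
  have "vector [a u, b u] = a u *\<^sub>R axis 1 1 + b u *\<^sub>R (axis 2 1 :: real^2)" for u
    by (simp add: vec_eq_iff forall_2 axis_def)
  then show ?thesis
    by (simp only:) (intro smooth_on_add smooth_on_scaleR smooth_on_const assms)
qed

section \<open>The gradient of \<open>curv\<close>\<close>

context spacelike_immersion
begin

lemma linear_dh: "u \<in> U \<Longrightarrow> linear (dd (curv \<phi>) u)"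
  by (rule linear_dd [OF smooth_on_differentiable [OF smooth_second(4)]])

lemma dh_expansion: "u \<in> U \<Longrightarrow> dd (curv \<phi>) u v = v$1 * dd (curv \<phi>) u (axis 1 1) + v$2 * dd (curv \<phi>) u (axis 2 1)"
  using linear_vec2_expansion [OF linear_dh, of u v] by simp

text \<open>\<open>z\<close> is the gradient, obtained by inverting the metric. Its description by
  duality, free of coordinates, is what later allows the passage to principal frames and to other
  charts.\<close>

lemma gradient_exists:
  assumes u: "u \<in> U"
  shows "\<exists>z. (\<forall>v. form22 (dd \<phi> u z) (dd \<phi> u v) = dd (curv \<phi>) u v) \<and> gradsq \<phi> u = dd (curv \<phi>) u z"
proof -
  define h1 where "h1 = dd (curv \<phi>) u (axis 1 1)"
  define h2 where "h2 = dd (curv \<phi>) u (axis 2 1)"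
  define z :: "real^2" where "z = vector [(g22 \<phi> u * h1 - g12 \<phi> u * h2) / gdet \<phi> u, (g11 \<phi> u * h2 - g12 \<phi> u * h1) / gdet \<phi> u]"
  have W: "gdet \<phi> u > 0" by (rule gdet_pos [OF u])
  have a: "(g22 \<phi> u * h1 - g12 \<phi> u * h2) * g11 \<phi> u + (g11 \<phi> u * h2 - g12 \<phi> u * h1) * g12 \<phi> u = gdet \<phi> u * h1"
    "(g22 \<phi> u * h1 - g12 \<phi> u * h2) * g12 \<phi> u + (g11 \<phi> u * h2 - g12 \<phi> u * h1) * g22 \<phi> u = gdet \<phi> u * h2"
    unfolding gdet_def by (simp_all add: algebra_simps power2_eq_square)
  have b: "z$1 * g11 \<phi> u + z$2 * g12 \<phi> u = h1" "z$1 * g12 \<phi> u + z$2 * g22 \<phi> u = h2"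
    unfolding z_def vector_2 times_divide_eq_left add_divide_distrib [symmetric] a using W by simp_all
  have "form22 (dd \<phi> u z) (dd \<phi> u v) = dd (curv \<phi>) u v" for v
    unfolding metric_expansion [OF u] dh_expansion [OF u, of v] h1_def [symmetric] h2_def [symmetric]
    unfolding b [symmetric] by (simp add: algebra_simps)
  moreover have "gradsq \<phi> u = dd (curv \<phi>) u z"
    unfolding gradsq_def dh_expansion [OF u, of z] h1_def [symmetric] h2_def [symmetric]
    unfolding z_def vector_2 times_divide_eq_left add_divide_distrib [symmetric] by (simp add: algebra_simps power2_eq_square)
  ultimately show ?thesis by blast
qed

lemma gradsq_eqI:
  assumes u: "u \<in> U" and z: "\<And>v. form22 (dd \<phi> u z) (dd \<phi> u v) = dd (curv \<phi>) u v"
  shows "gradsq \<phi> u = dd (curv \<phi>) u z"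
proof -
  obtain y where y: "\<And>v. form22 (dd \<phi> u y) (dd \<phi> u v) = dd (curv \<phi>) u v" "gradsq \<phi> u = dd (curv \<phi>) u y"
    using gradient_exists [OF u] by blast
  have "form22 (dd \<phi> u (y - z)) (dd \<phi> u (y - z)) = 0"
    using z y(1) by (simp add: linear_diff [OF linear_d\<phi> [OF u]])
  then have "y - z = 0" using spacelike [OF u, of "y - z"] by force
  then show ?thesis using y by simp
qed

lemma gradsq_nonneg:
  assumes u: "u \<in> U" shows "gradsq \<phi> u \<ge> 0"
proof -
  obtain z where z: "\<And>v. form22 (dd \<phi> u z) (dd \<phi> u v) = dd (curv \<phi>) u v" "gradsq \<phi> u = dd (curv \<phi>) u z"
    using gradient_exists [OF u] by blast
  have "form22 (dd \<phi> u z) (dd \<phi> u z) \<ge> 0"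
    using spacelike [OF u, of z] by (cases "z = 0") (auto simp: linear_0 [OF linear_d\<phi> [OF u]])
  then show ?thesis using z by simp
qed

lemma gradient_cauchy_schwarz:
  assumes u: "u \<in> U"
  shows "(dd (curv \<phi>) u v)^2 \<le> gradsq \<phi> u * form22 (dd \<phi> u v) (dd \<phi> u v)"
proof (cases "v = 0")
  case True then show ?thesis by (simp add: linear_0 [OF linear_d\<phi> [OF u]] linear_0 [OF linear_dh [OF u]])
next
  case False
  obtain z where z: "\<And>v. form22 (dd \<phi> u z) (dd \<phi> u v) = dd (curv \<phi>) u v" "gradsq \<phi> u = dd (curv \<phi>) u z"
    using gradient_exists [OF u] by blast
  define A where "A = form22 (dd \<phi> u v) (dd \<phi> u v)"
  define B where "B = dd (curv \<phi>) u v"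
  have A: "A > 0" unfolding A_def by (rule spacelike [OF u False])
  have vz: "form22 (dd \<phi> u v) (dd \<phi> u z) = B" unfolding B_def z(1) [symmetric] by (rule form22_commute)
  define y where "y = A *\<^sub>R z - B *\<^sub>R v"
  have "form22 (dd \<phi> u y) (dd \<phi> u y) \<ge> 0"
    using spacelike [OF u, of y] by (cases "y = 0") (auto simp: linear_0 [OF linear_d\<phi> [OF u]])
  moreover have "form22 (dd \<phi> u y) (dd \<phi> u y) = A * (A * gradsq \<phi> u - B^2)"
    unfolding y_def linear_diff [OF linear_d\<phi> [OF u]] linear_scale [OF linear_d\<phi> [OF u]]
    by (simp add: z(1) vz A_def [symmetric] z(2) [symmetric] B_def [symmetric] power2_eq_square algebra_simps)
  ultimately have "A * gradsq \<phi> u - B^2 \<ge> 0" using A by (simp add: zero_le_mult_iff)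
  then show ?thesis unfolding A_def B_def by (simp add: mult.commute)
qed

end

locale maximal_immersion = spacelike_immersion +
  assumes trace_zero: "\<And>u. u \<in> U \<Longrightarrow> g22 \<phi> u * b11 \<phi> u - 2 * g12 \<phi> u * b12 \<phi> u + g11 \<phi> u * b22 \<phi> u = 0"
    and curv_le_1: "\<And>u. u \<in> U \<Longrightarrow> curv \<phi> u \<le> 1"
begin

text \<open>The entries of \<open>B\<close> in the Gram-Schmidt frame. They exhibit \<open>curv \<phi>\<close> as a sum of two squares, so
  that its squared gradient is bounded by a multiple of \<open>curv \<phi>\<close>, also at umbilics.\<close>

definition "cp u = (g11 \<phi> u * b12 \<phi> u - g12 \<phi> u * b11 \<phi> u) / (g11 \<phi> u * sqrt (gdet \<phi> u))"
definition "cq u = b11 \<phi> u / g11 \<phi> u"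

lemma smooth_cpq: "smooth_on U cp" "smooth_on U cq"
proof -
  have "g11 \<phi> u * sqrt (gdet \<phi> u) \<noteq> 0" if "u \<in> U" for u using g11_pos [OF that] gdet_pos [OF that] by simp
  moreover have "g11 \<phi> u \<noteq> 0" if "u \<in> U" for u using g11_pos [OF that] by simp
  ultimately show "smooth_on U cp" "smooth_on U cq" unfolding cp_def [abs_def] cq_def [abs_def]
    by - (intro smooth_on_divide smooth_intros smooth_on_sqrt open_U smooth_basic smooth_second gdet_pos; assumption)+
qed

lemma curv_sum_squares:
  assumes u: "u \<in> U" shows "curv \<phi> u = cp u ^ 2 + cq u ^ 2"
proof -
  define E F G W p q r where "E = g11 \<phi> u" "F = g12 \<phi> u" "G = g22 \<phi> u" "W = gdet \<phi> u" "p = b11 \<phi> u" "q = b12 \<phi> u" "r = b22 \<phi> u"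
  note d = this
  have pos: "E > 0" "W > 0" and W: "W = E * G - F^2" and tr: "G * p - 2 * F * q + E * r = 0"
    using g11_pos [OF u] gdet_pos [OF u] trace_zero [OF u] unfolding d gdet_def by auto
  have "(E * q - F * p)^2 + W * p^2 = E^2 * (q^2 - p * r)"
  proof -
    have "E * r = 2 * F * q - G * p" using tr by simp
    then show ?thesis unfolding W by algebra
  qed
  moreover have "((E * q - F * p) / (E * sqrt W))^2 + (p / E)^2 = ((E * q - F * p)^2 + W * p^2) / (E^2 * W)"
    using pos by (simp add: power_divide power_mult_distrib add_divide_distrib)
  ultimately show ?thesis unfolding curv_def cp_def cq_def d [symmetric] using pos by simp
qed

lemma curv_nonneg: "u \<in> U \<Longrightarrow> curv \<phi> u \<ge> 0"
  by (simp add: curv_sum_squares)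

text \<open>\<open>curv\<close> is the sum of the squares of \<open>cp\<close> and
  \<open>cq\<close>, so its differential is twice a pairing of \<open>(cp, cq)\<close> with their
  differentials, and Cauchy-Schwarz splits off the factor \<open>curv\<close>.\<close>

lemma dh_bound:
  assumes u: "u \<in> U"
  shows "(dd (curv \<phi>) u v)^2 \<le> 4 * curv \<phi> u * ((dd cp u v)^2 + (dd cq u v)^2)"
proof -
  have s: "smooth_on U (\<lambda>u. cp u * cp u)" "smooth_on U (\<lambda>u. cq u * cq u)"
    by (intro smooth_on_mult open_U smooth_cpq)+
  have "dd (curv \<phi>) u v = along (\<lambda>_. v) (\<lambda>u. cp u * cp u + cq u * cq u) u"
    unfolding along_def by (subst dd_cong_open [OF open_U u, of _ "\<lambda>u. cp u * cp u + cq u * cq u"])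
      (auto simp: curv_sum_squares power2_eq_square)
  also have "\<dots> = 2 * (cp u * dd cp u v + cq u * dd cq u v)"
    unfolding along_add [OF u s] along_mult [OF u smooth_cpq(1) smooth_cpq(1)] along_mult [OF u smooth_cpq(2) smooth_cpq(2)]
    by (simp add: along_def)
  finally have "(dd (curv \<phi>) u v)^2 = 4 * (cp u * dd cp u v + cq u * dd cq u v)^2"
    by (simp only: power_mult_distrib) simp
  also have "\<dots> \<le> 4 * (((cp u)^2 + (cq u)^2) * ((dd cp u v)^2 + (dd cq u v)^2))"
    using cauchy_schwarz_4 [of "cp u" "dd cp u v" "cq u" "dd cq u v" 0 0 0 0] by simp
  finally show ?thesis unfolding curv_sum_squares [OF u] by (simp only: mult.assoc)
qed

text \<open>A smooth function that dominates the quotient of \<open>gradsq\<close> by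
  \<open>curv\<close> away from umbilics. The factor 8 is the 4 of \<open>dh_bound\<close> times a 2
  that pays for the mixed term.\<close>

definition "gradbound u = 8 * (g22 \<phi> u * ((dd cp u (axis 1 1))^2 + (dd cq u (axis 1 1))^2)
   + g11 \<phi> u * ((dd cp u (axis 2 1))^2 + (dd cq u (axis 2 1))^2)) / gdet \<phi> u"

lemma smooth_gradbound: "smooth_on U gradbound"
proof -
  have "gdet \<phi> u \<noteq> 0" if "u \<in> U" for u using gdet_pos [OF that] by simp
  then show ?thesis unfolding gradbound_def [abs_def]
    by (intro smooth_on_divide smooth_intros open_U smooth_basic smooth_cpq)
qed

lemma gradsq_le:
  assumes u: "u \<in> U"
  shows "gradsq \<phi> u \<le> curv \<phi> u * gradbound u"
proof -
  define h1 where "h1 = dd (curv \<phi>) u (axis 1 1)"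
  define h2 where "h2 = dd (curv \<phi>) u (axis 2 1)"
  have W: "gdet \<phi> u > 0" by (rule gdet_pos [OF u])
  \<comment> \<open>The swapped differential: positivity of the metric on it bounds the mixed term
    by the two others.\<close>
  define v :: "real^2" where "v = vector [h2, h1]"
  have "form22 (dd \<phi> u v) (dd \<phi> u v) \<ge> 0"
    using spacelike [OF u, of v] by (cases "v = 0") (auto simp: linear_0 [OF linear_d\<phi> [OF u]])
  then have "0 \<le> g22 \<phi> u * h1^2 + 2 * g12 \<phi> u * h1 * h2 + g11 \<phi> u * h2^2"
    unfolding metric_expansion [OF u] v_def by (simp add: algebra_simps power2_eq_square)
  then have "g22 \<phi> u * h1^2 - 2 * g12 \<phi> u * h1 * h2 + g11 \<phi> u * h2^2 \<le> 2 * (g22 \<phi> u * h1^2 + g11 \<phi> u * h2^2)"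
    by simp
  also have "\<dots> \<le> 2 * (g22 \<phi> u * (4 * curv \<phi> u * ((dd cp u (axis 1 1))^2 + (dd cq u (axis 1 1))^2))
      + g11 \<phi> u * (4 * curv \<phi> u * ((dd cp u (axis 2 1))^2 + (dd cq u (axis 2 1))^2)))"
    unfolding h1_def h2_def using g11_pos [OF u] g22_pos [OF u] dh_bound [OF u]
    by (intro mult_left_mono add_mono) auto
  also have "\<dots> = curv \<phi> u * gradbound u * gdet \<phi> u"
  proof -
    have "gradbound u * gdet \<phi> u = 8 * (g22 \<phi> u * ((dd cp u (axis 1 1))^2 + (dd cq u (axis 1 1))^2)
      + g11 \<phi> u * ((dd cp u (axis 2 1))^2 + (dd cq u (axis 2 1))^2))"
      unfolding gradbound_def using W by simp
    then show ?thesis unfolding mult.assoc [of "curv \<phi> u"] by (simp add: algebra_simps)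
  qed
  finally show ?thesis unfolding gradsq_def h1_def [symmetric] h2_def [symmetric] using W
    by (simp add: pos_divide_le_eq)
qed

text \<open>The matrix of \<open>B\<close> in coordinates. Unlike \<open>shape_operator\<close>,
  which is given by \<open>THE\<close>, its entries are visibly smooth in \<open>u\<close>.\<close>

definition shape :: "real^2 \<Rightarrow> real^2 \<Rightarrow> real^2" where
  "shape u v = vector
    [(g22 \<phi> u * b11 \<phi> u - g12 \<phi> u * b12 \<phi> u) / gdet \<phi> u * v$1 + (g22 \<phi> u * b12 \<phi> u - g12 \<phi> u * b22 \<phi> u) / gdet \<phi> u * v$2,
     (g11 \<phi> u * b12 \<phi> u - g12 \<phi> u * b11 \<phi> u) / gdet \<phi> u * v$1 + (g11 \<phi> u * b22 \<phi> u - g12 \<phi> u * b12 \<phi> u) / gdet \<phi> u * v$2]"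

lemma d\<phi>_shape: "u \<in> U \<Longrightarrow> dd \<phi> u (shape u v) = dd (normal \<phi>) u v"
  unfolding d\<phi>_expansion d\<nu>_expansion shape_operator_entries(1) shape_operator_entries(2) shape_def
  by (simp add: algebra_simps)

text \<open>Trace zero makes the second diagonal entry \<open>- \<alpha>\<close>, and then
  \<open>\<alpha>^2 + \<beta> * \<gamma>\<close> is minus the determinant.\<close>

lemma shape_form:
  assumes u: "u \<in> U"
  shows "\<exists>\<alpha> \<beta> \<gamma>. (\<forall>v. shape u v = vector [\<alpha> * v$1 + \<gamma> * v$2, \<beta> * v$1 - \<alpha> * v$2]) \<and> \<alpha>^2 + \<beta> * \<gamma> = curv \<phi> u"
proof -
  define E F G W p q r where "E = g11 \<phi> u" "F = g12 \<phi> u" "G = g22 \<phi> u" "W = gdet \<phi> u" "p = b11 \<phi> u" "q = b12 \<phi> u" "r = b22 \<phi> u"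
  note d = this
  have pos: "W > 0" and W: "W = E * G - F^2" and tr: "G * p - 2 * F * q + E * r = 0"
    using gdet_pos [OF u] trace_zero [OF u] unfolding d gdet_def by auto
  define \<alpha> \<beta> \<gamma> where "\<alpha> = (G * p - F * q) / W" "\<beta> = (E * q - F * p) / W" "\<gamma> = (G * q - F * r) / W"
  note abc = this
  have 1: "(E * r - F * q) / W = - \<alpha>"
  proof -
    have "E * r - F * q = - (G * p - F * q)" using tr by simp
    then show ?thesis unfolding abc by (simp only: minus_divide_left)
  qed
  have "(G * p - F * q)^2 + (E * q - F * p) * (G * q - F * r) = W * (q^2 - p * r)"
    using tr unfolding W by algebra
  then have "\<alpha>^2 + \<beta> * \<gamma> = W * (q^2 - p * r) / W^2"
    unfolding abc by (simp add: power2_eq_square add_divide_distrib [symmetric])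
  then have 2: "\<alpha>^2 + \<beta> * \<gamma> = curv \<phi> u" unfolding curv_def d [symmetric] using pos by (simp add: power2_eq_square)
  have "shape u v = vector [\<alpha> * v$1 + \<gamma> * v$2, \<beta> * v$1 - \<alpha> * v$2]" for v
    unfolding shape_def d [symmetric] 1 abc [symmetric] by simp
  with 2 show ?thesis by blast
qed

lemma shape_linear:
  assumes u: "u \<in> U"
  shows "shape u (a *\<^sub>R v + b *\<^sub>R w) = a *\<^sub>R shape u v + b *\<^sub>R shape u w"
proof -
  obtain \<alpha> \<beta> \<gamma> where s: "\<And>v. shape u v = vector [\<alpha> * v$1 + \<gamma> * v$2, \<beta> * v$1 - \<alpha> * v$2]"
    using shape_form [OF u] by blast
  show ?thesis unfolding s by (simp add: vec_eq_iff forall_2 algebra_simps)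
qed

lemma shape_shape:
  assumes u: "u \<in> U"
  shows "shape u (shape u v) = curv \<phi> u *\<^sub>R v"
proof -
  obtain \<alpha> \<beta> \<gamma> where s: "\<And>v. shape u v = vector [\<alpha> * v$1 + \<gamma> * v$2, \<beta> * v$1 - \<alpha> * v$2]" and c: "\<alpha>^2 + \<beta> * \<gamma> = curv \<phi> u"
    using shape_form [OF u] by blast
  show ?thesis unfolding c [symmetric] s by (simp add: vec_eq_iff forall_2 algebra_simps power2_eq_square)
qed

lemma shape_eigenvalue:
  assumes u: "u \<in> U" and v: "v \<noteq> 0" "dd (normal \<phi>) u v = k *\<^sub>R dd \<phi> u v"
  shows "k^2 = curv \<phi> u"
proof -
  have "shape u v = k *\<^sub>R v"
    using v(2) unfolding d\<phi>_shape [OF u, symmetric] linear_scale [OF linear_d\<phi> [OF u], symmetric]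
    by (rule inj_d\<phi> [OF u])
  then have "curv \<phi> u *\<^sub>R v = (k * k) *\<^sub>R v"
    using shape_linear [OF u, of k v 0 v] unfolding shape_shape [OF u, symmetric] by simp
  then show ?thesis using v(1) by (simp add: power2_eq_square)
qed

text \<open>Since the square of \<open>B\<close> is the scalar \<open>k * k\<close>, every nonzero
  vector \<open>B w + k w\<close> is an eigenvector for \<open>k\<close>. If all of them vanish,
  then \<open>B = - k\<close>, and trace zero forces \<open>k = 0\<close>.\<close>

lemma shape_eigenvector_exists:
  assumes u: "u \<in> U"
  shows "\<exists>v. v \<noteq> 0 \<and> dd (normal \<phi>) u v = sqrt (curv \<phi> u) *\<^sub>R dd \<phi> u v"
proof -
  define k where "k = sqrt (curv \<phi> u)"
  have k: "k * k = curv \<phi> u" unfolding k_def using curv_nonneg [OF u] by simp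
  have "\<exists>v. v \<noteq> 0 \<and> shape u v = k *\<^sub>R v"
  proof (cases "\<exists>w. shape u w + k *\<^sub>R w \<noteq> 0")
    case True
    then obtain w where w: "shape u w + k *\<^sub>R w \<noteq> 0" by blast
    have "shape u (shape u w + k *\<^sub>R w) = k *\<^sub>R (shape u w + k *\<^sub>R w)"
      using shape_linear [OF u, of 1 "shape u w" k w] k by (simp add: shape_shape [OF u] scaleR_add_right)
    then show ?thesis using w by blast
  next
    case False
    obtain \<alpha> \<beta> \<gamma> where s: "\<And>v. shape u v = vector [\<alpha> * v$1 + \<gamma> * v$2, \<beta> * v$1 - \<alpha> * v$2]"
      using shape_form [OF u] by blast
    have "shape u (axis 1 1) + k *\<^sub>R axis 1 1 = 0" "shape u (axis 2 1) + k *\<^sub>R axis 2 1 = 0"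
      using False by auto
    then have "\<alpha> + k = 0" "- \<alpha> + k = 0" "\<beta> = 0" "\<gamma> = 0" unfolding s by (auto simp: vec_eq_iff forall_2 axis_def)
    then have "shape u (axis 1 1) = k *\<^sub>R axis 1 1" unfolding s by (simp add: vec_eq_iff forall_2 axis_def)
    moreover have "axis 1 1 \<noteq> (0::real^2)" by (simp add: axis_eq_0_iff)
    ultimately show ?thesis by blast
  qed
  then show ?thesis unfolding k_def [symmetric] d\<phi>_shape [OF u, symmetric]
    by (metis linear_scale [OF linear_d\<phi> [OF u]])
qed

text \<open>Since \<open>B\<^sup>2 = \<lambda>\<^sup>2\<close>, the vectors \<open>B v \<plusminus> \<lambda> v\<close> are eigenvectors of \<open>B\<close>; a constant \<open>v\<close> makes them smooth
  near the given point.\<close>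

lemma principal_frame:
  assumes u0: "u0 \<in> U" and h: "curv \<phi> u0 > 0"
  shows "\<exists>V \<xi> \<eta>. u0 \<in> V \<and> V \<subseteq> U \<and> flat_frame V \<phi> (normal \<phi>) \<xi> \<eta> (\<lambda>u. sqrt (curv \<phi> u))"
proof -
  define l where "l = (\<lambda>u. sqrt (curv \<phi> u))"
  \<comment> \<open>Were \<open>B + s l\<close> zero, trace zero would give \<open>l = 0\<close>,
    against \<open>curv > 0\<close>.\<close>
  have ex: "\<exists>v. shape u0 v + (s * l u0) *\<^sub>R v \<noteq> 0" if "s = 1 \<or> s = -1" for s :: real
  proof (rule ccontr)
    assume n: "\<not> ?thesis"
    obtain \<alpha> \<beta> \<gamma> where s: "\<And>v. shape u0 v = vector [\<alpha> * v$1 + \<gamma> * v$2, \<beta> * v$1 - \<alpha> * v$2]"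
      using shape_form [OF u0] by blast
    have "shape u0 (axis 1 1) + (s * l u0) *\<^sub>R axis 1 1 = 0" "shape u0 (axis 2 1) + (s * l u0) *\<^sub>R axis 2 1 = 0"
      using n by auto
    then have "\<alpha> + s * l u0 = 0" "- \<alpha> + s * l u0 = 0" unfolding s by (auto simp: vec_eq_iff forall_2 axis_def)
    then have "s * l u0 = 0" by simp
    then show False using that h unfolding l_def by auto
  qed
  obtain v1 v2 where v: "shape u0 v1 + l u0 *\<^sub>R v1 \<noteq> 0" "shape u0 v2 - l u0 *\<^sub>R v2 \<noteq> 0"
    using ex [of 1] ex [of "-1"] by auto
  define V1 where "V1 = {u \<in> U. curv \<phi> u > 0}"
  have V1: "open V1"
    using continuous_open_preimage [OF smooth_on_continuous [OF smooth_second(4)] open_U open_greaterThan [of 0]]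
    by (simp add: V1_def vimage_def Int_def)
  have V1U: "V1 \<subseteq> U" unfolding V1_def by blast
  have sl: "smooth_on V1 l" unfolding l_def
    by (rule smooth_on_sqrt [OF V1 smooth_on_subset [OF smooth_second(4) V1U]]) (simp add: V1_def)
  have gn: "gdet \<phi> u \<noteq> 0" if "u \<in> V1" for u using gdet_pos [of u] that V1U by auto
  have sshape: "smooth_on V1 (\<lambda>u. shape u v)" for v
    unfolding shape_def
    by (intro smooth_on_vector_2 smooth_on_divide smooth_intros V1 smooth_on_subset [OF _ V1U] smooth_basic smooth_second gn)
  define e1 where "e1 = (\<lambda>u. shape u v1 + l u *\<^sub>R v1)"
  define e2 where "e2 = (\<lambda>u. shape u v2 - l u *\<^sub>R v2)"
  have se: "smooth_on V1 e1" "smooth_on V1 e2" unfolding e1_def e2_def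
    by (intro smooth_intros V1 sshape sl)+
  define V where "V = {u \<in> V1. e1 u \<noteq> 0} \<inter> {u \<in> V1. e2 u \<noteq> 0}"
  have "open {u \<in> V1. e u \<noteq> 0}" if "smooth_on V1 e" for e :: "real^2 \<Rightarrow> real^2"
    using continuous_open_preimage [OF smooth_on_continuous [OF that] V1, of "- {0}"]
    by (simp add: vimage_def Int_def open_Compl)
  then have V: "open V" unfolding V_def using se by blast
  have VV1: "V \<subseteq> V1" and VU: "V \<subseteq> U" and u0V: "u0 \<in> V"
    unfolding V_def V1_def using u0 h v by (auto simp: e1_def e2_def)
  have l_pos: "l u > 0" and l_sq: "l u * l u = curv \<phi> u" if "u \<in> V" for u
    using that VV1 unfolding V1_def l_def by auto
  define Q where "Q = (\<lambda>e u. form22 (dd \<phi> u (e u)) (dd \<phi> u (e u)))"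
  have Qpos: "Q e1 u > 0" "Q e2 u > 0" if "u \<in> V" for u
    unfolding Q_def using that VU by (auto intro!: spacelike simp: V_def)
  have sQ: "smooth_on V (Q e)" if e: "smooth_on V e" for e
  proof (rule smooth_on_cong [OF V])
    show "smooth_on V (\<lambda>u. e u $ 1 * e u $ 1 * g11 \<phi> u + (e u $ 1 * e u $ 2 + e u $ 2 * e u $ 1) * g12 \<phi> u + e u $ 2 * e u $ 2 * g22 \<phi> u)"
      by (intro smooth_intros V e smooth_on_subset [OF _ VU] smooth_basic)
  qed (use VU in \<open>auto simp: Q_def metric_expansion\<close>)
  \<comment> \<open>This normalization produces the squared length \<open>1 / l u\<close> that
    \<open>flat_frame\<close> requires.\<close>
  define n where "n = (\<lambda>e u. (1 / sqrt (l u * Q e u)) *\<^sub>R (e u :: real^2))"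
  have seV: "smooth_on V e1" "smooth_on V e2" and slV: "smooth_on V l"
    using se sl smooth_on_subset [OF _ VV1] by blast+
  have sn: "smooth_on V (n e)" if "smooth_on V e" "\<And>u. u \<in> V \<Longrightarrow> Q e u > 0" for e
    unfolding n_def using that(2) l_pos
    by (intro smooth_on_scaleR smooth_on_divide smooth_on_sqrt smooth_on_const smooth_on_mult V slV sQ that(1))
      (auto simp: less_imp_neq [symmetric])
  have eig1: "dd (normal \<phi>) u (e1 u) = l u *\<^sub>R dd \<phi> u (e1 u)" if u: "u \<in> V" for u
  proof -
    have uU: "u \<in> U" using u VU by blast
    have "shape u (e1 u) = l u *\<^sub>R e1 u"
      using shape_linear [OF uU, of 1 "shape u v1" "l u" v1] l_sq [OF u]
      by (simp add: e1_def shape_shape [OF uU] scaleR_add_right)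
    then show ?thesis using d\<phi>_shape [OF uU, of "e1 u"] by (simp add: linear_scale [OF linear_d\<phi> [OF uU]])
  qed
  have eig2: "dd (normal \<phi>) u (e2 u) = - l u *\<^sub>R dd \<phi> u (e2 u)" if u: "u \<in> V" for u
  proof -
    have uU: "u \<in> U" using u VU by blast
    have "shape u (e2 u) = (- l u) *\<^sub>R e2 u"
      using shape_linear [OF uU, of 1 "shape u v2" "- l u" v2] l_sq [OF u]
      by (simp add: e2_def shape_shape [OF uU] scaleR_diff_right)
    then have "dd \<phi> u (shape u (e2 u)) = (- l u) *\<^sub>R dd \<phi> u (e2 u)"
      by (simp only: linear_scale [OF linear_d\<phi> [OF uU]])
    then show ?thesis using d\<phi>_shape [OF uU, of "e2 u"] by simp
  qed
  have orth: "form22 (dd \<phi> u (e1 u)) (dd \<phi> u (e2 u)) = 0" if u: "u \<in> V" for u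
  proof -
    have uU: "u \<in> U" using u VU by blast
    have "l u * form22 (dd \<phi> u (e1 u)) (dd \<phi> u (e2 u)) = - l u * form22 (dd \<phi> u (e1 u)) (dd \<phi> u (e2 u))"
      using second_form_symmetric [OF uU, of "e1 u" "e2 u"] unfolding eig1 [OF u] eig2 [OF u]
      by (simp add: form22_commute)
    then show ?thesis using l_pos [OF u] by simp
  qed
  have dn: "dd F u (n e u) = (1 / sqrt (l u * Q e u)) *\<^sub>R dd F u (e u)" if "linear (dd F u)" for e u and F :: "real^2 \<Rightarrow> real^4"
    unfolding n_def by (rule linear_scale [OF that])
  have nn: "form22 (dd \<phi> u (n e u)) (dd \<phi> u (n e u)) = 1 / l u" if "u \<in> V" "Q e u > 0" for e u
  proof -
    have "u \<in> U" using that VU by blast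
    have "form22 (dd \<phi> u (n e u)) (dd \<phi> u (n e u)) = Q e u / (sqrt (l u * Q e u) * sqrt (l u * Q e u))"
      unfolding dn [OF linear_d\<phi> [OF \<open>u \<in> U\<close>]] Q_def by simp
    also have "sqrt (l u * Q e u) * sqrt (l u * Q e u) = l u * Q e u"
      using l_pos [OF that(1)] that(2) by (simp add: less_imp_le)
    finally show ?thesis using that by simp
  qed
  have "flat_frame V \<phi> (normal \<phi>) (n e1) (n e2) l"
  proof
    show "along (n e1) (normal \<phi>) u = l u *\<^sub>R along (n e1) \<phi> u" "along (n e2) (normal \<phi>) u = - l u *\<^sub>R along (n e2) \<phi> u"
      if u: "u \<in> V" for u
    proof -
      have uU: "u \<in> U" using u VU by blast
      show "along (n e1) (normal \<phi>) u = l u *\<^sub>R along (n e1) \<phi> u"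
        unfolding along_def dn [OF linear_d\<phi> [OF uU]] dn [OF linear_d\<nu> [OF uU]] eig1 [OF u] by simp
      show "along (n e2) (normal \<phi>) u = - l u *\<^sub>R along (n e2) \<phi> u"
        unfolding along_def dn [OF linear_d\<phi> [OF uU]] dn [OF linear_d\<nu> [OF uU]] eig2 [OF u] by simp
    qed
    show "form22 (along (n e1) \<phi> u) (along (n e2) \<phi> u) = 0" if u: "u \<in> V" for u
    proof -
      have uU: "u \<in> U" using u VU by blast
      show ?thesis unfolding along_def dn [OF linear_d\<phi> [OF uU]] by (simp add: orth [OF u])
    qed
  qed (use V VU smooth_\<phi> smooth_basic(7) smooth_on_subset sn seV Qpos slV l_pos nn norm_\<phi> normal_orthogonal
     in \<open>auto simp: along_def form22_commute\<close>)
  then show ?thesis using u0V VU unfolding l_def by blast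
qed

end

text \<open>At umbilics \<open>curv \<phi> u = 0\<close>, and the value is 0 by the convention \<open>x / 0 = 0\<close>; for \<open>\<alpha> > 0\<close> this makes
  the function continuous.\<close>

definition barrier :: "real^4 \<Rightarrow> real^4 \<Rightarrow> real \<Rightarrow> real \<Rightarrow> (real^2 \<Rightarrow> real^4) \<Rightarrow> real^2 \<Rightarrow> real" where
  "barrier a b e \<alpha> \<phi> u = curv \<phi> u powr (\<alpha> / 2) * (gradsq \<phi> u / (4 * curv \<phi> u)) *
     (3 - exhaustion a b (\<phi> u) (normal \<phi> u))^2 / (1 + e - curv \<phi> u)^2"

lemma flat_frame_subset:
  assumes "flat_frame V \<phi> \<nu> \<xi> \<eta> l" "V' \<subseteq> V" "open V'"
  shows "flat_frame V' \<phi> \<nu> \<xi> \<eta> l"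
proof -
  interpret flat_frame V \<phi> \<nu> \<xi> \<eta> l by fact
  show ?thesis
    using assms(2,3) l_pos normalized normal_frame conformal principal
    by unfold_locales (blast intro: smooth [THEN smooth_on_subset, OF assms(2)])+
qed

context maximal_immersion
begin

lemma smooth_exhaustion: "smooth_on U (\<lambda>u. exhaustion a b (\<phi> u) (normal \<phi> u))"
  unfolding exhaustion_def by (intro smooth_intros open_U smooth_\<phi> smooth_basic)

text \<open>The fields have squared length \<open>1 / l\<close>, so the gradient has the components
  \<open>l * dh\<close>. With \<open>dh = 2 l^2 dw\<close> the power of \<open>l\<close> is
  \<open>l\<close> times \<open>4 l^4\<close>.\<close>

lemma gradsq_principal_frame:
  assumes V: "V \<subseteq> U" and F: "flat_frame V \<phi> (normal \<phi>) \<xi> \<eta> (\<lambda>u. sqrt (curv \<phi> u))" and u: "u \<in> V"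
  shows "gradsq \<phi> u = 4 * sqrt (curv \<phi> u) ^ 5 * flat_frame.W \<xi> \<eta> (\<lambda>u. sqrt (curv \<phi> u)) u"
proof -
  interpret flat_frame V \<phi> "normal \<phi>" \<xi> \<eta> "\<lambda>u. sqrt (curv \<phi> u)" by fact
  define l where "l = sqrt (curv \<phi> u)"
  have uU: "u \<in> U" using u V by blast
  have l: "l > 0" unfolding l_def by (rule l_pos [OF u])
  obtain z where z: "\<And>v. form22 (dd \<phi> u z) (dd \<phi> u v) = dd (curv \<phi>) u v" "gradsq \<phi> u = dd (curv \<phi>) u z"
    using gradient_exists [OF uU] by blast
  obtain \<alpha> \<beta> where ab: "z = \<alpha> *\<^sub>R \<xi> u + \<beta> *\<^sub>R \<eta> u" using frame_spans [OF u] by blast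
  have dz: "dd \<phi> u z = \<alpha> *\<^sub>R x1 u + \<beta> *\<^sub>R x2 u"
    unfolding ab along_def by (simp add: linear_add [OF linear_d(1) [OF u]] linear_scale [OF linear_d(1) [OF u]])
  have c: "form22 (x2 u) (x1 u) = 0" using conformal(3) [OF u] form22_commute by metis
  have a: "\<alpha> = l * dd (curv \<phi>) u (\<xi> u)" and b: "\<beta> = l * dd (curv \<phi>) u (\<eta> u)"
    using z(1) [of "\<xi> u"] z(1) [of "\<eta> u"] l unfolding dz along_def [of \<xi> \<phi> u, symmetric] along_def [of \<eta> \<phi> u, symmetric]
    by (simp_all add: conformal [OF u] c l_def [symmetric] field_simps)
  have dh: "along \<zeta> (curv \<phi>) u = 2 * l^2 * along \<zeta> w u" for \<zeta>
  proof -
    have "along \<zeta> (curv \<phi>) u = along \<zeta> (\<lambda>u. (sqrt (curv \<phi> u))^2) u"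
      by (rule along_cong [OF open_V u]) (use V curv_nonneg in auto)
    then show ?thesis
      unfolding along_square [OF u smooth(5)] along_l [OF u] by (simp add: l_def power2_eq_square)
  qed
  have "gradsq \<phi> u = \<alpha> * dd (curv \<phi>) u (\<xi> u) + \<beta> * dd (curv \<phi>) u (\<eta> u)"
    unfolding z(2) ab by (simp add: linear_add [OF linear_dh [OF uU]] linear_scale [OF linear_dh [OF uU]])
  also have "\<dots> = l * ((along \<xi> (curv \<phi>) u)^2 + (along \<eta> (curv \<phi>) u)^2)"
    unfolding a b by (simp add: along_def power2_eq_square algebra_simps)
  also have "\<dots> = 4 * l^5 * W u"
    unfolding dh W_def by (simp add: algebra_simps eval_nat_numeral)
  finally show ?thesis unfolding l_def .
qed

text \<open>The logarithm of \<open>barrier\<close> is the function of \<open>bernstein_max\<close>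
  with \<open>r = 3 + \<alpha>\<close>. The neighbourhood is shrunk to where \<open>W > 0\<close>
  and \<open>G < 3\<close>, so that all logarithms exist.\<close>

lemma chart_bernstein:
  fixes a b :: "real^4" and e \<alpha> :: real
  defines "G \<equiv> \<lambda>u. exhaustion a b (\<phi> u) (normal \<phi> u)"
  assumes u0: "u0 \<in> U" and N: "open N" "u0 \<in> N" "N \<subseteq> U" and h0: "curv \<phi> u0 > 0" and g0: "gradsq \<phi> u0 > 0"
    and ab: "form22 a a = -1" "form22 b b = -1" and e: "e > 0" and \<alpha>: "0 \<le> \<alpha>" "\<alpha> \<le> 1" and G0: "G u0 < 3"
    and max: "\<And>u. u \<in> N \<Longrightarrow> G u \<le> 3 \<Longrightarrow> barrier a b e \<alpha> \<phi> u \<le> barrier a b e \<alpha> \<phi> u0"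
  shows "gradsq \<phi> u0 / (4 * curv \<phi> u0) * (3 - G u0)^2 \<le> 74 * (1 + e - curv \<phi> u0)^2"
proof -
  obtain V \<xi> \<eta> where V: "u0 \<in> V" "V \<subseteq> U" and F: "flat_frame V \<phi> (normal \<phi>) \<xi> \<eta> (\<lambda>u. sqrt (curv \<phi> u))"
    using principal_frame [OF u0 h0] by blast
  define l where "l = (\<lambda>u. sqrt (curv \<phi> u))"
  interpret F: flat_frame V \<phi> "normal \<phi>" \<xi> \<eta> l unfolding l_def by (rule F)
  have gW: "gradsq \<phi> u = 4 * l u ^ 5 * F.W u" if "u \<in> V" for u
    unfolding l_def by (rule gradsq_principal_frame [OF V(2) F that])
  have lp: "l u > 0" if "u \<in> V" for u by (rule F.l_pos [OF that])
  have W0: "F.W u0 > 0"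
    using g0 lp [OF V(1)] unfolding gW [OF V(1)] by (simp add: zero_less_mult_iff)
  define V' where "V' = {u \<in> V. F.W u > 0} \<inter> ({u \<in> U. G u < 3} \<inter> N)"
  have "open {u \<in> V. F.W u > 0}"
    using continuous_open_preimage [OF smooth_on_continuous [OF F.smooth_W] F.open_V open_greaterThan [of 0]]
    by (simp add: vimage_def Int_def)
  moreover have "open {u \<in> U. G u < 3}"
    using continuous_open_preimage [OF smooth_on_continuous [OF smooth_exhaustion] open_U open_lessThan [of 3], folded G_def]
    by (simp add: vimage_def Int_def G_def)
  ultimately have V': "open V'" unfolding V'_def using N(1) by blast
  have V'V: "V' \<subseteq> V" and V'N: "V' \<subseteq> N" and u0V': "u0 \<in> V'"
    unfolding V'_def using V W0 u0 G0 N by auto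
  interpret F': flat_frame V' \<phi> "normal \<phi>" \<xi> \<eta> l
    unfolding l_def by (rule flat_frame_subset [OF F V'V V'])
  have hl: "curv \<phi> u = l u ^ 2" if "u \<in> V'" for u
    unfolding l_def using curv_nonneg [of u] that V'V V(2) by auto
  have l1: "l u \<le> 1" if "u \<in> V'" for u
    unfolding l_def using curv_le_1 [of u] that V'V V(2) by auto
  have P: "gradsq \<phi> u / (4 * curv \<phi> u) = l u ^ 3 * F.W u" if u: "u \<in> V'" for u
  proof -
    have "u \<in> V" using u V'V by blast
    then show ?thesis unfolding gW [OF \<open>u \<in> V\<close>] hl [OF u] using lp [of u] by (simp add: field_simps eval_nat_numeral)
  qed
  have pos: "F.W u > 0" "3 - G u > 0" "1 + e - (l u)^2 > 0" if u: "u \<in> V'" for u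
  proof -
    show "F.W u > 0" "3 - G u > 0" using u unfolding V'_def by auto
    have "(l u)^2 \<le> 1" using lp [of u] l1 [OF u] u V'V by (intro power_le_one) (auto intro: less_imp_le)
    then show "1 + e - (l u)^2 > 0" using e by simp
  qed
  have B: "barrier a b e \<alpha> \<phi> u = l u powr \<alpha> * (l u ^ 3 * F.W u) * (3 - G u)^2 / (1 + e - (l u)^2)^2" if u: "u \<in> V'" for u
  proof -
    have "curv \<phi> u powr (\<alpha> / 2) = l u powr \<alpha>"
    proof -
      have "l u > 0" using lp u V'V by blast
      then have "(l u)^2 = l u powr 2" by (simp add: powr_numeral)
      then show ?thesis unfolding hl [OF u] by (simp add: powr_powr)
    qed
    then show ?thesis unfolding barrier_def P [OF u] G_def by (simp add: hl [OF u])
  qed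
  have lnB: "ln (barrier a b e \<alpha> \<phi> u) = (3 + \<alpha>) * F.w u + ln (F.W u) - 2 * ln (1 + e - (l u)^2) + 2 * ln (3 - G u)"
    and Bpos: "barrier a b e \<alpha> \<phi> u > 0"
    if u: "u \<in> V'" for u
  proof -
    have L: "l u > 0" using lp u V'V by blast
    show "barrier a b e \<alpha> \<phi> u > 0" unfolding B [OF u] using L pos [OF u] by simp
    show "ln (barrier a b e \<alpha> \<phi> u) = (3 + \<alpha>) * F.w u + ln (F.W u) - 2 * ln (1 + e - (l u)^2) + 2 * ln (3 - G u)"
      unfolding B [OF u] F.w_def using L pos [OF u]
      by (simp add: ln_mult ln_div ln_powr ln_realpow algebra_simps)
  qed
  have "l u0 ^ 3 * F.W u0 * (3 - G u0)^2 \<le> 74 * (1 + e - (l u0)^2)^2"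
    unfolding G_def
  proof (rule F'.bernstein_max [OF u0V' ab l1 e, where r = "3 + \<alpha>"])
    fix v assume v: "v \<in> V'"
    have "barrier a b e \<alpha> \<phi> v \<le> barrier a b e \<alpha> \<phi> u0"
      by (rule max) (use v V'N pos(2) [OF v] in auto)
    then have "ln (barrier a b e \<alpha> \<phi> v) \<le> ln (barrier a b e \<alpha> \<phi> u0)"
      using Bpos [OF v] Bpos [OF u0V'] by simp
    then show "(3 + \<alpha>) * F.w v + ln (F.W v) - 2 * ln (1 + e - (l v)^2) + 2 * ln (3 - exhaustion a b (\<phi> v) (normal \<phi> v))
       \<le> (3 + \<alpha>) * F.w u0 + ln (F.W u0) - 2 * ln (1 + e - (l u0)^2) + 2 * ln (3 - exhaustion a b (\<phi> u0) (normal \<phi> u0))"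
      unfolding lnB [OF v] lnB [OF u0V'] unfolding G_def .
  qed (use \<alpha> pos in \<open>auto simp: G_def\<close>)
  then show ?thesis unfolding P [OF u0V'] by (simp only: hl [OF u0V'])
qed

end

section \<open>Change of charts\<close>

text \<open>A chart is an embedding in the topological sense, so a lift \<open>\<tau>\<close>
  through it is at first merely continuous. For a linear left inverse \<open>L\<close> of the
  derivative, \<open>L \<circ> \<phi>\<close> has the identity as derivative at
  \<open>\<tau> z0\<close>; with the continuity of \<open>\<tau>\<close> this shows that
  \<open>\<tau>\<close> has the same derivative as \<open>L \<circ> F\<close>.\<close>

lemma lift_has_derivative:
  fixes F :: "'z::real_normed_vector \<Rightarrow> 'c::euclidean_space" and \<phi> :: "'b::euclidean_space \<Rightarrow> 'c"
  assumes \<phi>: "(\<phi> has_derivative \<phi>') (at (\<tau> z0))" and inj: "inj \<phi>'"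
    and \<tau>: "isCont \<tau> z0" and T: "open T" "z0 \<in> T" and F\<phi>: "\<And>z. z \<in> T \<Longrightarrow> F z = \<phi> (\<tau> z)"
    and F: "(F has_derivative F') (at z0)"
  shows "\<exists>\<tau>'. (\<tau> has_derivative \<tau>') (at z0) \<and> (\<forall>v. F' v = \<phi>' (\<tau>' v))"
proof -
  have "linear \<phi>'" using \<phi> has_derivative_linear by blast
  then obtain L where L: "linear L" "L \<circ> \<phi>' = id"
    using linear_injective_left_inverse inj by blast
  have bL: "bounded_linear L" using L linear_conv_bounded_linear by blast
  define y where "y = (\<lambda>z. L (F z))"
  define \<psi> where "\<psi> = (\<lambda>u. L (\<phi> u))"
  have dy: "(y has_derivative (\<lambda>v. L (F' v))) (at z0)"
    unfolding y_def by (rule bounded_linear.has_derivative [OF bL F])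
  have "(\<psi> has_derivative (\<lambda>v. L (\<phi>' v))) (at (\<tau> z0))"
    unfolding \<psi>_def by (rule bounded_linear.has_derivative [OF bL \<phi>])
  moreover have "(\<lambda>v. L (\<phi>' v)) = (\<lambda>v. v)" using L(2) by (simp add: fun_eq_iff)
  ultimately have d\<psi>: "(\<psi> has_derivative (\<lambda>v. v)) (at (\<tau> z0))" by simp
  have y\<psi>: "y z = \<psi> (\<tau> z)" if "z \<in> T" for z unfolding y_def \<psi>_def F\<phi> [OF that] ..
  obtain B where B: "B > 0" "\<And>v. norm (L (F' v)) \<le> norm v * B"
    using bounded_linear.pos_bounded [OF has_derivative_bounded_linear [OF dy]] by blast
  obtain d1 where d1: "d1 > 0" "\<And>z. norm (z - z0) < d1 \<Longrightarrow> norm (y z - y z0 - L (F' (z - z0))) \<le> 1 * norm (z - z0)"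
    using dy unfolding has_derivative_at_alt by (metis zero_less_one)
  have ybound: "norm (y z - y z0) \<le> (B + 1) * norm (z - z0)" if "norm (z - z0) < d1" for z
    using norm_triangle_ineq [of "y z - y z0 - L (F' (z - z0))" "L (F' (z - z0))"] d1(2) [OF that] B(2) [of "z - z0"]
    by (simp add: algebra_simps)
  obtain d2 where d2: "d2 > 0" "ball z0 d2 \<subseteq> T" using T open_contains_ball by blast
  have "((\<lambda>z. \<tau> z - y z) has_derivative (\<lambda>v. 0)) (at z0)"
    unfolding has_derivative_at_alt
  proof (intro conjI allI impI)
    show "bounded_linear (\<lambda>v::'z. 0::'b)" by simp
    fix e :: real assume e: "e > 0"
    \<comment> \<open>The bound 1/2 lets \<open>norm D\<close> be absorbed, giving
      \<open>norm D \<le> 2 * norm Y\<close>; the other bound turns the final constant into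
      \<open>e\<close>.\<close>
    define e' where "e' = min (1/2) (e / (2 * (B + 1)))"
    have e': "e' > 0" "e' \<le> 1/2" unfolding e'_def using e B(1) by - (simp, rule min.cobounded1)
    have e'': "2 * e' * (B + 1) \<le> e"
    proof -
      have "e' \<le> e / (2 * (B + 1))" unfolding e'_def by simp
      then show ?thesis using B(1) by (simp add: pos_le_divide_eq algebra_simps)
    qed
    obtain d3 where d3: "d3 > 0" "\<And>u. norm (u - \<tau> z0) < d3 \<Longrightarrow> norm (\<psi> u - \<psi> (\<tau> z0) - (u - \<tau> z0)) \<le> e' * norm (u - \<tau> z0)"
      using d\<psi> e'(1) unfolding has_derivative_at_alt by blast
    obtain d4 where d4: "d4 > 0" "\<And>z. norm (z - z0) < d4 \<Longrightarrow> norm (\<tau> z - \<tau> z0) < d3"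
      using \<tau> d3(1) unfolding isCont_def LIM_eq by (metis diff_self norm_zero)
    show "\<exists>d>0. \<forall>z. norm (z - z0) < d \<longrightarrow> norm (\<tau> z - y z - (\<tau> z0 - y z0) - 0) \<le> e * norm (z - z0)"
    proof (intro exI [of _ "min d1 (min d2 d4)"] conjI allI impI)
      show "0 < min d1 (min d2 d4)" using d1 d2 d4 by simp
      fix z assume z: "norm (z - z0) < min d1 (min d2 d4)"
      have zT: "z \<in> T" "z0 \<in> T" using z d2 T by (auto simp: dist_norm norm_minus_commute)
      define D where "D = \<tau> z - \<tau> z0"
      define Y where "Y = y z - y z0"
      have r: "norm (Y - D) \<le> e' * norm D"
        using d3(2) [OF d4(2)] z unfolding D_def Y_def y\<psi> [OF zT(1)] y\<psi> [OF zT(2)] by simp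
      have "norm D \<le> norm Y + norm (Y - D)"
        using norm_triangle_ineq4 [of Y "Y - D"] by simp
      also have "\<dots> \<le> norm Y + (1/2) * norm D"
        using r e'(2) mult_right_mono [of e' "1/2" "norm D"] by simp
      finally have "norm D \<le> 2 * norm Y" by simp
      then have "norm (Y - D) \<le> e' * (2 * norm Y)"
        using r e'(1) mult_left_mono [of "norm D" "2 * norm Y" e'] by linarith
      also have "\<dots> \<le> e' * (2 * ((B + 1) * norm (z - z0)))"
        using ybound [of z] z e'(1) unfolding Y_def by (intro mult_left_mono) auto
      also have "\<dots> = (2 * e' * (B + 1)) * norm (z - z0)" by simp
      also have "\<dots> \<le> e * norm (z - z0)" by (rule mult_right_mono [OF e'']) simp
      finally show "norm (\<tau> z - y z - (\<tau> z0 - y z0) - 0) \<le> e * norm (z - z0)"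
        unfolding D_def Y_def by (simp add: norm_minus_commute algebra_simps)
    qed
  qed
  from has_derivative_add [OF this dy]
  have d\<tau>: "(\<tau> has_derivative (\<lambda>v. L (F' v))) (at z0)" by simp
  have "((\<lambda>z. \<phi> (\<tau> z)) has_derivative (\<lambda>v. \<phi>' (L (F' v)))) (at z0)"
    using has_derivative_compose [OF d\<tau> \<phi>] .
  then have "(F has_derivative (\<lambda>v. \<phi>' (L (F' v)))) (at z0)"
    by (rule has_derivative_transform_within_open [OF _ T]) (simp add: F\<phi>)
  then have "F' = (\<lambda>v. \<phi>' (L (F' v)))" using F has_derivative_unique by blast
  then show ?thesis using d\<tau> by metis
qed

lemma proj_eq_imp_scaleR: "proj x = proj y \<Longrightarrow> \<exists>c. x = c *\<^sub>R y"
  unfolding proj_def by (metis span_base insertI1 span_singleton rangeE)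

lemma proj_uminus: "proj (- x) = proj x"
proof -
  have "- x \<in> span {x}" by (simp add: span_base span_neg)
  moreover have "x \<in> span {- x}" using span_neg [OF span_base [of "- x" "{- x}"]] by simp
  ultimately show ?thesis unfolding proj_def span_eq by simp
qed

lemma proj_scale_sign: "\<sigma> = 1 \<or> \<sigma> = - 1 \<Longrightarrow> proj (\<sigma> *\<^sub>R x) = proj x"
  using proj_uminus by auto

lemma proj_eq_normalized:
  assumes "proj x = proj y" "form22 x x = -1" "form22 y y = -1"
  shows "x = y \<or> x = - y"
proof -
  obtain c where c: "x = c *\<^sub>R y" using proj_eq_imp_scaleR [OF assms(1)] by blast
  have "c * c = 1" using assms(2,3) unfolding c by simp
  then have "c = 1 \<or> c = -1" by (simp add: square_eq_1_iff)
  then show ?thesis using c by auto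
qed

text \<open>The preimage of \<open>S\<close> in the double cover. Curves and compact sets are
  handled here, inside \<open>real^4\<close>, and not in the quotient.\<close>

definition lifted :: "(real^4) set set \<Rightarrow> (real^4) set" where
  "lifted S = {x. form22 x x = -1 \<and> proj x \<in> S}"

lemma lifted_nonzero: "x \<in> lifted S \<Longrightarrow> x \<noteq> 0"
  unfolding lifted_def by auto

lemma continuous_map_proj:
  fixes F :: "'z::topological_space \<Rightarrow> real^4"
  assumes "continuous_on Z F" "\<And>z. z \<in> Z \<Longrightarrow> F z \<noteq> 0"
  shows "continuous_map (top_of_set Z) RP3 (proj \<circ> F)"
proof (rule continuous_map_compose)
  show "continuous_map (top_of_set Z) (top_of_set (UNIV - {0})) F"
    using assms by auto
  show "continuous_map (top_of_set (UNIV - {0})) RP3 proj"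
    using quotient_map_proj quotient_imp_continuous_map by blast
qed

text \<open>The inverse of the chart gives a continuous \<open>\<tau>\<close> with
  \<open>F = \<plusminus> \<phi> \<circ> \<tau>\<close>. The sign is continuous with values 1 and
  -1, hence constant near \<open>z0\<close>.\<close>

lemma chart_lift:
  fixes F :: "'z::topological_space \<Rightarrow> real^4"
  assumes ch: "surface_chart S U \<phi>" and F: "continuous_on Z F" "\<And>z. z \<in> Z \<Longrightarrow> F z \<in> lifted S"
    and z0: "z0 \<in> Z" and u0: "u0 \<in> U" "proj (F z0) = proj (\<phi> u0)"
  shows "\<exists>T \<tau> \<sigma>. open T \<and> z0 \<in> T \<and> (\<sigma> = 1 \<or> \<sigma> = -1) \<and> continuous_on (Z \<inter> T) \<tau> \<and> \<tau> z0 = u0 \<and>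
    (\<forall>z\<in>Z \<inter> T. \<tau> z \<in> U \<and> F z = \<sigma> *\<^sub>R \<phi> (\<tau> z))"
proof -
  define f where "f = proj \<circ> \<phi>"
  have U: "open U" and s: "smooth_on U \<phi>" and n: "\<And>u. u \<in> U \<Longrightarrow> form22 (\<phi> u) (\<phi> u) = -1"
    and emb: "embedding_map (top_of_set U) (subtopology RP3 S) f"
    and op: "openin (subtopology RP3 S) (f ` U)"
    using ch unfolding surface_chart_def f_def by auto
  obtain g where g: "homeomorphic_maps (top_of_set U) (subtopology (subtopology RP3 S) (f ` U)) f g"
    using emb unfolding embedding_map_def homeomorphic_map_maps by auto
  then have gc: "continuous_map (subtopology (subtopology RP3 S) (f ` U)) (top_of_set U) g"
    and gf: "\<And>u. u \<in> U \<Longrightarrow> g (f u) = u"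
    unfolding homeomorphic_maps_def by auto
  have pF: "continuous_map (top_of_set Z) (subtopology RP3 S) (proj \<circ> F)"
    unfolding continuous_map_in_subtopology
    using continuous_map_proj [OF F(1)] F(2) lifted_nonzero by (auto simp: lifted_def)
  define Z' where "Z' = {z \<in> Z. proj (F z) \<in> f ` U}"
  have "openin (top_of_set Z) Z'"
    using openin_continuous_map_preimage [OF pF op] unfolding Z'_def by simp
  then obtain T0 where T0: "open T0" "Z' = Z \<inter> T0" by (auto simp: openin_open)
  define \<tau> where "\<tau> = (\<lambda>z. g (proj (F z)))"
  have "continuous_map (top_of_set Z') (subtopology (subtopology RP3 S) (f ` U)) (proj \<circ> F)"
  proof (rule continuous_map_into_subtopology)
    show "continuous_map (top_of_set Z') (subtopology RP3 S) (proj \<circ> F)"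
      using continuous_map_from_subtopology [OF pF, of Z']
      by (simp add: subtopology_subtopology Z'_def Int_absorb1)
  qed (auto simp: Z'_def)
  from continuous_map_compose [OF this gc]
  have "continuous_map (top_of_set Z') (top_of_set U) \<tau>" unfolding \<tau>_def by (simp add: o_def)
  then have \<tau>c: "continuous_on Z' \<tau>" by auto
  have z0': "z0 \<in> Z'" unfolding Z'_def using z0 u0 by (auto simp: f_def)
  have \<tau>U: "\<tau> z \<in> U" "proj (F z) = proj (\<phi> (\<tau> z))" if "z \<in> Z'" for z
    using that gf unfolding Z'_def \<tau>_def by (auto simp: f_def)
  \<comment> \<open>The sign as a continuous function; the minus compensates
    \<open>form22 (\<phi> u) (\<phi> u) = -1\<close>.\<close>
  define s where "s = (\<lambda>z. - form22 (F z) (\<phi> (\<tau> z)))"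
  have pm: "F z = s z *\<^sub>R \<phi> (\<tau> z) \<and> (s z = 1 \<or> s z = -1)" if z: "z \<in> Z'" for z
  proof -
    have "form22 (F z) (F z) = -1" using F(2) z unfolding Z'_def lifted_def by auto
    from proj_eq_normalized [OF \<tau>U(2) [OF z] this n [OF \<tau>U(1) [OF z]]]
    show ?thesis using n [OF \<tau>U(1) [OF z]] unfolding s_def by auto
  qed
  have "continuous_on Z' (\<lambda>z. \<phi> (\<tau> z))"
    by (rule continuous_on_compose2 [OF smooth_on_continuous [OF \<open>smooth_on U \<phi>\<close>] \<tau>c]) (use \<tau>U in auto)
  then have sc: "continuous_on Z' (\<lambda>z. s z * s z0)"
    unfolding s_def
    by (intro continuous_intros bounded_bilinear.continuous_on [OF bounded_bilinear_form22] continuous_on_subset [OF F(1)])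
      (auto simp: Z'_def)
  obtain T1 where T1: "open T1" "T1 \<inter> Z' = (\<lambda>z. s z * s z0) -` {0<..} \<inter> Z'"
    using sc open_greaterThan [of "0::real"] unfolding continuous_on_open_invariant by metis
  have same: "s z = s z0" if "z \<in> Z'" "z \<in> T1" for z
  proof -
    have "s z * s z0 > 0" using that T1 by blast
    then show ?thesis using pm [OF that(1)] pm [OF z0'] by auto
  qed
  show ?thesis
  proof (intro exI [of _ "T0 \<inter> T1"] exI [of _ \<tau>] exI [of _ "s z0"] conjI ballI)
    show "open (T0 \<inter> T1)" using T0 T1 by blast
    have "s z0 * s z0 > 0" using pm [OF z0'] by auto
    then have "z0 \<in> T1" using T1(2) z0' by blast
    then show "z0 \<in> T0 \<inter> T1" using z0' T0 by blast
    show "s z0 = 1 \<or> s z0 = -1" using pm [OF z0'] by blast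
    show "continuous_on (Z \<inter> (T0 \<inter> T1)) \<tau>" by (rule continuous_on_subset [OF \<tau>c]) (use T0 in auto)
    show "\<tau> z0 = u0" unfolding \<tau>_def u0(2) using gf [OF u0(1)] by (simp add: f_def)
    fix z assume "z \<in> Z \<inter> (T0 \<inter> T1)"
    then have z: "z \<in> Z'" "z \<in> T1" using T0 by auto
    show "\<tau> z \<in> U" by (rule \<tau>U [OF z(1)])
    show "F z = s z0 *\<^sub>R \<phi> (\<tau> z)" using pm [OF z(1)] same [OF z] by simp
  qed
qed

text \<open>Differentiability is claimed pointwise, wherever \<open>F\<close> has it, because the
  lemma serves transition maps as well as curves that are only piecewise smooth.\<close>

lemma chart_lift_differentiable:
  fixes F :: "'z::real_normed_vector \<Rightarrow> real^4"
  assumes ch: "surface_chart S U \<phi>" and Z: "open Z" and F: "continuous_on Z F" "\<And>z. z \<in> Z \<Longrightarrow> F z \<in> lifted S"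
    and z0: "z0 \<in> Z" and u0: "u0 \<in> U" "proj (F z0) = proj (\<phi> u0)"
  shows "\<exists>T \<tau> \<sigma>. open T \<and> z0 \<in> T \<and> T \<subseteq> Z \<and> (\<sigma> = 1 \<or> \<sigma> = -1) \<and> continuous_on T \<tau> \<and> \<tau> z0 = u0 \<and>
    (\<forall>z\<in>T. \<tau> z \<in> U \<and> F z = \<sigma> *\<^sub>R \<phi> (\<tau> z)) \<and>
    (\<forall>z\<in>T. F differentiable (at z) \<longrightarrow> \<tau> differentiable (at z) \<and> (\<forall>v. dd F z v = \<sigma> *\<^sub>R dd \<phi> (\<tau> z) (dd \<tau> z v)))"
proof -
  obtain T \<tau> \<sigma> where T: "open T" "z0 \<in> T" "\<sigma> = 1 \<or> \<sigma> = (-1::real)" "continuous_on (Z \<inter> T) \<tau>" "\<tau> z0 = u0"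
    "\<And>z. z\<in>Z \<inter> T \<Longrightarrow> \<tau> z \<in> U" "\<And>z. z\<in>Z \<inter> T \<Longrightarrow> F z = \<sigma> *\<^sub>R \<phi> (\<tau> z)"
    using chart_lift [OF ch F z0 u0] by blast
  have s: "smooth_on U \<phi>" and inj: "\<And>u. u \<in> U \<Longrightarrow> inj (dd \<phi> u)" using ch unfolding surface_chart_def by auto
  have ZT: "open (Z \<inter> T)" using Z T by blast
  have "\<tau> differentiable (at z) \<and> (\<forall>v. dd F z v = \<sigma> *\<^sub>R dd \<phi> (\<tau> z) (dd \<tau> z v))"
    if z: "z \<in> Z \<inter> T" and dF: "F differentiable (at z)" for z
  proof -
    have d: "((\<lambda>u. \<sigma> *\<^sub>R \<phi> u) has_derivative (\<lambda>v. \<sigma> *\<^sub>R dd \<phi> (\<tau> z) v)) (at (\<tau> z))"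
      by (rule has_derivative_scaleR_right [OF smooth_on_has_derivative [OF s T(6) [OF z]]])
    have i: "inj (\<lambda>v. \<sigma> *\<^sub>R dd \<phi> (\<tau> z) v)"
      using inj [OF T(6) [OF z]] T(3) unfolding inj_def by auto
    have c: "isCont \<tau> z" using T(4) ZT z continuous_on_eq_continuous_at by blast
    obtain \<tau>' where "(\<tau> has_derivative \<tau>') (at z)" "\<And>v. dd F z v = \<sigma> *\<^sub>R dd \<phi> (\<tau> z) (\<tau>' v)"
      using lift_has_derivative [OF d i c ZT z T(7) has_derivative_dd [OF dF]] by blast
    then show ?thesis using dd_eqI [of \<tau> \<tau>' z] differentiable_def by blast
  qed
  then show ?thesis using T ZT z0 by (intro exI [of _ "Z \<inter> T"] exI [of _ \<tau>] exI [of _ \<sigma>]) auto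
qed

lemma maximal_immersion_chart:
  assumes m: "maximal_surface S" and n: "nonpositive_curvature S" and ch: "surface_chart S U \<phi>"
  shows "maximal_immersion U \<phi>"
proof -
  have sp: "spacelike_surface S" using m unfolding maximal_surface_def by blast
  interpret spacelike_immersion U \<phi>
    using ch sp unfolding surface_chart_def spacelike_surface_def by unfold_locales blast+
  show ?thesis
  proof
    fix u assume u: "u \<in> U"
    have "trace (matrix (shape_operator \<phi> (normal \<phi>) u)) = 0"
      using m ch unit_normal_field_normal u unfolding maximal_surface_def by blast
    then show "g22 \<phi> u * b11 \<phi> u - 2 * g12 \<phi> u * b12 \<phi> u + g11 \<phi> u * b22 \<phi> u = 0"
      using trace_shape_operator [OF u] by simp
    have "gauss_curvature (induced_metric \<phi>) u \<le> 0"
      using n ch u unfolding nonpositive_curvature_def by blast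
    then show "curv \<phi> u \<le> 1" unfolding gauss_equation [OF u] by simp
  qed
qed

section \<open>Independence of the chart\<close>

locale maximal_surface_nonpos =
  fixes S
  assumes maximal: "maximal_surface S" and nonpos: "nonpositive_curvature S"
begin

lemma immersion: "surface_chart S U \<phi> \<Longrightarrow> maximal_immersion U \<phi>"
  using maximal_immersion_chart maximal nonpos by blast

lemma spacelike_immersion: "surface_chart S U \<phi> \<Longrightarrow> spacelike_immersion U \<phi>"
  using immersion maximal_immersion.axioms(1) by blast

lemma chart_at: "p \<in> S \<Longrightarrow> \<exists>U \<phi> u. surface_chart S U \<phi> \<and> u \<in> U \<and> proj (\<phi> u) = p"
  using maximal unfolding maximal_surface_def spacelike_surface_def smooth_embedded_surface_def by fastforce

lemma chart_in_lifted:
  assumes "surface_chart S U \<phi>" "u \<in> U"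
  shows "\<phi> u \<in> lifted S"
proof -
  have "embedding_map (top_of_set U) (subtopology RP3 S) (proj \<circ> \<phi>)" "form22 (\<phi> u) (\<phi> u) = -1"
    using assms unfolding surface_chart_def by auto
  then have "(proj \<circ> \<phi>) ` U = topspace (subtopology RP3 S) \<inter> (proj \<circ> \<phi>) ` U"
    using homeomorphic_imp_surjective_map unfolding embedding_map_def by fastforce
  then have "(proj \<circ> \<phi>) ` U \<subseteq> S" by auto
  then show ?thesis using assms \<open>form22 (\<phi> u) (\<phi> u) = -1\<close> unfolding lifted_def by auto
qed

text \<open>\<open>dd \<tau> z\<close> is injective because the derivative of the first chart is,
  and then surjective by equality of dimensions.\<close>

lemma transition:
  assumes c1: "surface_chart S U1 \<phi>1" and c2: "surface_chart S U2 \<phi>2" and u1: "u1 \<in> U1" and u2: "u2 \<in> U2"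
    and p: "proj (\<phi>1 u1) = proj (\<phi>2 u2)"
  obtains T \<tau> \<sigma> where "open T" "u1 \<in> T" "T \<subseteq> U1" "\<sigma> = 1 \<or> \<sigma> = (-1::real)" "continuous_on T \<tau>" "\<tau> u1 = u2"
    "\<And>z. z \<in> T \<Longrightarrow> \<tau> z \<in> U2" "\<And>z. z \<in> T \<Longrightarrow> \<phi>1 z = \<sigma> *\<^sub>R \<phi>2 (\<tau> z)" "\<And>z. z \<in> T \<Longrightarrow> \<tau> differentiable (at z)"
    "\<And>z v. z \<in> T \<Longrightarrow> dd \<phi>1 z v = \<sigma> *\<^sub>R dd \<phi>2 (\<tau> z) (dd \<tau> z v)" "\<And>z v. z \<in> T \<Longrightarrow> dd \<tau> z v = 0 \<Longrightarrow> v = 0" "\<And>z. z \<in> T \<Longrightarrow> surj (dd \<tau> z)"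
proof -
  interpret m1: maximal_immersion U1 \<phi>1 by (rule immersion [OF c1])
  interpret m2: maximal_immersion U2 \<phi>2 by (rule immersion [OF c2])
  obtain T \<tau> \<sigma> where T: "open T" "u1 \<in> T" "T \<subseteq> U1" "\<sigma> = 1 \<or> \<sigma> = (-1::real)" "continuous_on T \<tau>" "\<tau> u1 = u2"
    and 1: "\<And>z. z \<in> T \<Longrightarrow> \<tau> z \<in> U2 \<and> \<phi>1 z = \<sigma> *\<^sub>R \<phi>2 (\<tau> z)"
    and 2: "\<And>z. z \<in> T \<Longrightarrow> \<phi>1 differentiable (at z) \<Longrightarrow> \<tau> differentiable (at z) \<and> (\<forall>v. dd \<phi>1 z v = \<sigma> *\<^sub>R dd \<phi>2 (\<tau> z) (dd \<tau> z v))"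
    using chart_lift_differentiable [OF c2 m1.open_U smooth_on_continuous [OF m1.smooth_\<phi>] chart_in_lifted [OF c1] u1 u2 p] by metis
  have "\<tau> z \<in> U2 \<and> \<phi>1 z = \<sigma> *\<^sub>R \<phi>2 (\<tau> z) \<and> \<tau> differentiable (at z) \<and>
      (\<forall>v. dd \<phi>1 z v = \<sigma> *\<^sub>R dd \<phi>2 (\<tau> z) (dd \<tau> z v)) \<and> (\<forall>v. dd \<tau> z v = 0 \<longrightarrow> v = 0) \<and> surj (dd \<tau> z)"
    if z: "z \<in> T" for z
  proof -
    have zU: "z \<in> U1" using z T by blast
    have d: "\<tau> differentiable (at z)" "\<And>v. dd \<phi>1 z v = \<sigma> *\<^sub>R dd \<phi>2 (\<tau> z) (dd \<tau> z v)"
      using 2 [OF z smooth_on_differentiable [OF m1.smooth_\<phi> zU]] by auto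
    have lin: "linear (dd \<tau> z)" by (rule linear_dd [OF d(1)])
    have ker: "v = 0" if "dd \<tau> z v = 0" for v
    proof -
      have "dd \<phi>1 z v = dd \<phi>1 z 0"
        unfolding d(2) that linear_0 [OF lin] ..
      then show ?thesis by (rule m1.inj_d\<phi> [OF zU])
    qed
    then have "inj (dd \<tau> z)" using linear_injective_0 [OF lin] by blast
    then have "surj (dd \<tau> z)" using linear_injective_imp_surjective [OF lin] by blast
    then show ?thesis using 1 [OF z] d ker by blast
  qed
  note A = this
  show thesis by (rule that [OF T]) (use A in blast)+
qed

text \<open>The sign relating the two normals is locally constant, so the relation can be differentiated.\<close>

lemma transition_normal:
  assumes m1: "spacelike_immersion U1 \<phi>1" and m2: "spacelike_immersion U2 \<phi>2" and \<nu>: "unit_normal_field U1 \<phi>1 \<nu>"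
    and T: "open T" "T \<subseteq> U1" "\<sigma> = 1 \<or> \<sigma> = (-1::real)" "continuous_on T \<tau>"
    and t: "\<And>z. z \<in> T \<Longrightarrow> \<tau> z \<in> U2" "\<And>z. z \<in> T \<Longrightarrow> \<phi>1 z = \<sigma> *\<^sub>R \<phi>2 (\<tau> z)" "\<And>z. z \<in> T \<Longrightarrow> \<tau> differentiable (at z)"
      "\<And>z v. z \<in> T \<Longrightarrow> dd \<phi>1 z v = \<sigma> *\<^sub>R dd \<phi>2 (\<tau> z) (dd \<tau> z v)" "\<And>z. z \<in> T \<Longrightarrow> surj (dd \<tau> z)"
    and u: "u \<in> T"
  shows "\<exists>s. (s = 1 \<or> s = -1) \<and> \<nu> u = s *\<^sub>R normal \<phi>2 (\<tau> u) \<and>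
    (\<forall>v. dd \<nu> u v = s *\<^sub>R dd (normal \<phi>2) (\<tau> u) (dd \<tau> u v))"
proof -
  interpret m1: spacelike_immersion U1 \<phi>1 by fact
  interpret m2: spacelike_immersion U2 \<phi>2 by fact
  have s\<nu>: "smooth_on U1 \<nu>" using \<nu> unfolding unit_normal_field_def by blast
  define s where "s = (\<lambda>z. - form22 (\<nu> z) (normal \<phi>2 (\<tau> z)))"
  have pm: "\<nu> z = s z *\<^sub>R normal \<phi>2 (\<tau> z) \<and> (s z = 1 \<or> s z = -1)" if z: "z \<in> T" for z
  proof -
    have zU: "z \<in> U1" using z T by blast
    have n: "form22 (\<nu> z) (\<nu> z) = -1" "form22 (\<nu> z) (\<phi>1 z) = 0" "\<And>v. form22 (\<nu> z) (dd \<phi>1 z v) = 0"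
      using \<nu> zU unfolding unit_normal_field_def by auto
    have "form22 (\<nu> z) (dd \<phi>2 (\<tau> z) w) = 0" for w
    proof -
      obtain v where "w = dd \<tau> z v" using t(5) [OF z] by (metis surjD)
      then show ?thesis using n(3) [of v] T(3) unfolding t(4) [OF z] by auto
    qed
    moreover have "form22 (\<nu> z) (\<phi>2 (\<tau> z)) = 0" using n(2) T(3) unfolding t(2) [OF z] by auto
    ultimately have "\<nu> z = normal \<phi>2 (\<tau> z) \<or> \<nu> z = - normal \<phi>2 (\<tau> z)"
      using m2.unit_normal_unique [OF t(1) [OF z] n(1) _ _ m2.normal_orthogonal [OF t(1) [OF z]]] by blast
    then show ?thesis using m2.normal_orthogonal(1) [OF t(1) [OF z]] unfolding s_def by auto
  qed
  have "continuous_on T (\<lambda>z. normal \<phi>2 (\<tau> z))"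
    by (rule continuous_on_compose2 [OF smooth_on_continuous [OF m2.smooth_basic(7)] T(4)]) (use t in auto)
  then have sc: "continuous_on T (\<lambda>z. s z * s u)"
    unfolding s_def
    by (intro continuous_intros bounded_bilinear.continuous_on [OF bounded_bilinear_form22]
      continuous_on_subset [OF smooth_on_continuous [OF s\<nu>]] T)
  define T1 where "T1 = T \<inter> (\<lambda>z. s z * s u) -` {0<..}"
  have T1: "open T1" unfolding T1_def by (rule continuous_open_preimage [OF sc T(1) open_greaterThan])
  have uT1: "u \<in> T1" unfolding T1_def using u pm [OF u] by auto
  have same: "\<nu> z = s u *\<^sub>R normal \<phi>2 (\<tau> z)" if "z \<in> T1" for z
  proof -
    have "s z * s u > 0" "z \<in> T" using that unfolding T1_def by auto
    then have "s z = s u" using pm [of z] pm [OF u] by auto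
    then show ?thesis using pm [OF \<open>z \<in> T\<close>] by simp
  qed
  have "((\<lambda>z. s u *\<^sub>R normal \<phi>2 (\<tau> z)) has_derivative (\<lambda>v. s u *\<^sub>R dd (normal \<phi>2) (\<tau> u) (dd \<tau> u v))) (at u)"
    by (rule has_derivative_scaleR_right [OF has_derivative_compose [OF has_derivative_dd [OF t(3) [OF u]]
       smooth_on_has_derivative [OF m2.smooth_basic(7) t(1) [OF u]]]])
  from dd_eqI [OF this] dd_cong_open [OF T1 uT1 same]
  have "dd \<nu> u v = s u *\<^sub>R dd (normal \<phi>2) (\<tau> u) (dd \<tau> u v)" for v by simp
  then show ?thesis using pm [OF u] by blast
qed

text \<open>The sign of the lift and the sign relating the two normals can only change
  \<open>k\<close> to \<open>- k\<close>, so its square survives the change of chart.\<close>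

lemma transition_eigenvalue:
  assumes c1: "surface_chart S U1 \<phi>1" and c2: "surface_chart S U2 \<phi>2" and u1: "u1 \<in> U1" and u2: "u2 \<in> U2"
    and p: "proj (\<phi>1 u1) = proj (\<phi>2 u2)" and \<nu>: "unit_normal_field U1 \<phi>1 \<nu>"
    and v: "v \<noteq> 0" "dd \<nu> u1 v = k *\<^sub>R dd \<phi>1 u1 v"
  shows "k^2 = curv \<phi>2 u2"
proof -
  interpret m2: maximal_immersion U2 \<phi>2 by (rule immersion [OF c2])
  obtain T \<tau> \<sigma> where T: "open T" "u1 \<in> T" "T \<subseteq> U1" "\<sigma> = 1 \<or> \<sigma> = (-1::real)" "continuous_on T \<tau>" "\<tau> u1 = u2"
    and t: "\<And>z. z \<in> T \<Longrightarrow> \<tau> z \<in> U2" "\<And>z. z \<in> T \<Longrightarrow> \<phi>1 z = \<sigma> *\<^sub>R \<phi>2 (\<tau> z)" "\<And>z. z \<in> T \<Longrightarrow> \<tau> differentiable (at z)"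
      "\<And>z v. z \<in> T \<Longrightarrow> dd \<phi>1 z v = \<sigma> *\<^sub>R dd \<phi>2 (\<tau> z) (dd \<tau> z v)" "\<And>z v. z \<in> T \<Longrightarrow> dd \<tau> z v = 0 \<Longrightarrow> v = 0" "\<And>z. z \<in> T \<Longrightarrow> surj (dd \<tau> z)"
    by (rule transition [OF c1 c2 u1 u2 p]) (rule that)
  obtain s where s: "s = 1 \<or> s = (-1::real)" "\<And>v. dd \<nu> u1 v = s *\<^sub>R dd (normal \<phi>2) (\<tau> u1) (dd \<tau> u1 v)"
    using transition_normal [OF spacelike_immersion [OF c1] spacelike_immersion [OF c2] \<nu> T(1,3,4,5) t(1,2,3,4,6) T(2)] by blast
  define w where "w = dd \<tau> u1 v"
  have w: "w \<noteq> 0" unfolding w_def using t(5) [OF T(2)] v by blast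
  have "s *\<^sub>R dd (normal \<phi>2) u2 w = (k * \<sigma>) *\<^sub>R dd \<phi>2 u2 w"
    using v(2) unfolding s(2) t(4) [OF T(2)] T(6) w_def by simp
  then have "dd (normal \<phi>2) u2 w = (s * k * \<sigma>) *\<^sub>R dd \<phi>2 u2 w"
    using s(1) by (auto simp: minus_equation_iff [of "dd (normal \<phi>2) u2 w"])
  from m2.shape_eigenvalue [OF u2 w this] have "(s * k * \<sigma>)^2 = curv \<phi>2 u2" .
  moreover have "(s * k * \<sigma>)^2 = k^2" using s(1) T(4) by auto
  ultimately show ?thesis by simp
qed

lemma curv_invariant:
  assumes c1: "surface_chart S U1 \<phi>1" and c2: "surface_chart S U2 \<phi>2" and u1: "u1 \<in> U1" and u2: "u2 \<in> U2"
    and p: "proj (\<phi>1 u1) = proj (\<phi>2 u2)"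
  shows "curv \<phi>1 u1 = curv \<phi>2 u2"
proof -
  interpret m1: maximal_immersion U1 \<phi>1 by (rule immersion [OF c1])
  obtain v where "v \<noteq> 0" "dd (normal \<phi>1) u1 v = sqrt (curv \<phi>1 u1) *\<^sub>R dd \<phi>1 u1 v"
    using m1.shape_eigenvector_exists [OF u1] by blast
  from transition_eigenvalue [OF c1 c2 u1 u2 p m1.unit_normal_field_normal this]
  show ?thesis using m1.curv_nonneg [OF u1] by simp
qed

text \<open>By \<open>transition_eigenvalue\<close> the principal curvatures from all charts and all
  unit normals at this point have the same square, so exactly one nonnegative number qualifies and
  the \<open>THE\<close> is meaningful.\<close>

lemma nonneg_principal_curvature_eq:
  assumes c: "surface_chart S U \<phi>" and u: "u \<in> U"
  shows "nonneg_principal_curvature S (proj (\<phi> u)) = sqrt (curv \<phi> u)"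
  unfolding nonneg_principal_curvature_def
proof (rule the_equality, intro conjI)
  interpret m: maximal_immersion U \<phi> by (rule immersion [OF c])
  show "sqrt (curv \<phi> u) \<ge> 0" using m.curv_nonneg [OF u] by simp
  obtain v where v: "v \<noteq> 0" "dd (normal \<phi>) u v = sqrt (curv \<phi> u) *\<^sub>R dd \<phi> u v"
    using m.shape_eigenvector_exists [OF u] by blast
  then have "shape_operator \<phi> (normal \<phi>) u v = sqrt (curv \<phi> u) *\<^sub>R v"
    unfolding m.shape_operator_eq_iff [OF m.unit_normal_field_normal u]
    by (simp add: linear_scale [OF m.linear_d\<phi> [OF u]])
  then show "is_principal_curvature S (proj (\<phi> u)) (sqrt (curv \<phi> u))"
    unfolding is_principal_curvature_def using c u v m.unit_normal_field_normal by blast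
next
  fix k assume k: "0 \<le> k \<and> is_principal_curvature S (proj (\<phi> u)) k"
  then obtain U' \<phi>' \<nu> u' v where c': "surface_chart S U' \<phi>'" and n: "unit_normal_field U' \<phi>' \<nu>" and u': "u' \<in> U'"
    and p: "proj (\<phi>' u') = proj (\<phi> u)" and v: "v \<noteq> 0" "shape_operator \<phi>' \<nu> u' v = k *\<^sub>R v"
    unfolding is_principal_curvature_def by blast
  interpret m': maximal_immersion U' \<phi>' by (rule immersion [OF c'])
  have "dd \<nu> u' v = k *\<^sub>R dd \<phi>' u' v"
    using v(2) unfolding m'.shape_operator_eq_iff [OF n u'] by (simp add: linear_scale [OF m'.linear_d\<phi> [OF u']])
  from transition_eigenvalue [OF c' c u' u p n v(1) this] k
  show "k = sqrt (curv \<phi> u)" by (metis real_sqrt_abs abs_of_nonneg)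
qed

text \<open>The differential of the transition map carries gradient to gradient.
  \<open>gradsq_eqI\<close> recognizes the image by duality, and surjectivity of the differential
  supplies all the test vectors.\<close>

lemma gradsq_invariant:
  assumes c1: "surface_chart S U1 \<phi>1" and c2: "surface_chart S U2 \<phi>2" and u1: "u1 \<in> U1" and u2: "u2 \<in> U2"
    and p: "proj (\<phi>1 u1) = proj (\<phi>2 u2)"
  shows "gradsq \<phi>1 u1 = gradsq \<phi>2 u2"
proof -
  interpret m1: maximal_immersion U1 \<phi>1 by (rule immersion [OF c1])
  interpret m2: maximal_immersion U2 \<phi>2 by (rule immersion [OF c2])
  obtain T \<tau> \<sigma> where T: "open T" "u1 \<in> T" "T \<subseteq> U1" "\<sigma> = 1 \<or> \<sigma> = (-1::real)" "continuous_on T \<tau>" "\<tau> u1 = u2"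
    and t: "\<And>z. z \<in> T \<Longrightarrow> \<tau> z \<in> U2" "\<And>z. z \<in> T \<Longrightarrow> \<phi>1 z = \<sigma> *\<^sub>R \<phi>2 (\<tau> z)" "\<And>z. z \<in> T \<Longrightarrow> \<tau> differentiable (at z)"
      "\<And>z v. z \<in> T \<Longrightarrow> dd \<phi>1 z v = \<sigma> *\<^sub>R dd \<phi>2 (\<tau> z) (dd \<tau> z v)" "\<And>z v. z \<in> T \<Longrightarrow> dd \<tau> z v = 0 \<Longrightarrow> v = 0" "\<And>z. z \<in> T \<Longrightarrow> surj (dd \<tau> z)"
    by (rule transition [OF c1 c2 u1 u2 p]) (rule that)
  have h: "curv \<phi>1 z = curv \<phi>2 (\<tau> z)" if "z \<in> T" for z
    by (rule curv_invariant [OF c1 c2]) (use that T t proj_scale_sign in auto)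
  have "((\<lambda>z. curv \<phi>2 (\<tau> z)) has_derivative (\<lambda>v. dd (curv \<phi>2) (\<tau> u1) (dd \<tau> u1 v))) (at u1)"
    by (rule has_derivative_compose [OF has_derivative_dd [OF t(3) [OF T(2)]]
       smooth_on_has_derivative [OF m2.smooth_second(4) t(1) [OF T(2)]]])
  from dd_eqI [OF this] dd_cong_open [OF T(1,2) h]
  have dh: "dd (curv \<phi>1) u1 v = dd (curv \<phi>2) u2 (dd \<tau> u1 v)" for v by (simp add: T(6))
  obtain z where z: "\<And>v. form22 (dd \<phi>1 u1 z) (dd \<phi>1 u1 v) = dd (curv \<phi>1) u1 v" "gradsq \<phi>1 u1 = dd (curv \<phi>1) u1 z"
    using m1.gradient_exists [OF u1] by blast
  have "form22 (dd \<phi>2 u2 (dd \<tau> u1 z)) (dd \<phi>2 u2 w) = dd (curv \<phi>2) u2 w" for w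
  proof -
    obtain v where w: "w = dd \<tau> u1 v" using t(6) [OF T(2)] by (metis surjD)
    show ?thesis using z(1) [of v] T(4) unfolding t(4) [OF T(2)] dh w T(6) by auto
  qed
  from m2.gradsq_eqI [OF u2 this] show ?thesis unfolding z(2) dh ..
qed

text \<open>The position and the normal change only by signs, and every term is a square.\<close>

lemma exhaustion_invariant:
  assumes c1: "surface_chart S U1 \<phi>1" and c2: "surface_chart S U2 \<phi>2" and u1: "u1 \<in> U1" and u2: "u2 \<in> U2"
    and p: "proj (\<phi>1 u1) = proj (\<phi>2 u2)"
  shows "exhaustion a b (\<phi>1 u1) (normal \<phi>1 u1) = exhaustion a b (\<phi>2 u2) (normal \<phi>2 u2)"
proof -
  interpret m1: maximal_immersion U1 \<phi>1 by (rule immersion [OF c1])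
  obtain T \<tau> \<sigma> where T: "open T" "u1 \<in> T" "T \<subseteq> U1" "\<sigma> = 1 \<or> \<sigma> = (-1::real)" "continuous_on T \<tau>" "\<tau> u1 = u2"
    and t: "\<And>z. z \<in> T \<Longrightarrow> \<tau> z \<in> U2" "\<And>z. z \<in> T \<Longrightarrow> \<phi>1 z = \<sigma> *\<^sub>R \<phi>2 (\<tau> z)" "\<And>z. z \<in> T \<Longrightarrow> \<tau> differentiable (at z)"
      "\<And>z v. z \<in> T \<Longrightarrow> dd \<phi>1 z v = \<sigma> *\<^sub>R dd \<phi>2 (\<tau> z) (dd \<tau> z v)" "\<And>z v. z \<in> T \<Longrightarrow> dd \<tau> z v = 0 \<Longrightarrow> v = 0" "\<And>z. z \<in> T \<Longrightarrow> surj (dd \<tau> z)"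
    by (rule transition [OF c1 c2 u1 u2 p]) (rule that)
  obtain s where s: "s = 1 \<or> s = (-1::real)" "normal \<phi>1 u1 = s *\<^sub>R normal \<phi>2 (\<tau> u1)"
    using transition_normal [OF spacelike_immersion [OF c1] spacelike_immersion [OF c2] m1.unit_normal_field_normal
       T(1,3,4,5) t(1,2,3,4,6) T(2)] by blast
  show ?thesis unfolding exhaustion_def s(2) t(2) [OF T(2)] T(6) using s(1) T(4) by auto
qed

lemma barrier_invariant:
  assumes "surface_chart S U1 \<phi>1" "surface_chart S U2 \<phi>2" "u1 \<in> U1" "u2 \<in> U2" "proj (\<phi>1 u1) = proj (\<phi>2 u2)"
  shows "barrier a b e \<alpha> \<phi>1 u1 = barrier a b e \<alpha> \<phi>2 u2"
  unfolding barrier_def curv_invariant [OF assms] gradsq_invariant [OF assms] exhaustion_invariant [OF assms] ..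

end

section \<open>Boundedness of the sublevel sets\<close>

context spacelike_immersion
begin

text \<open>The component of \<open>x\<close> tangent to the surface at \<open>\<phi> u\<close> has
  squared length \<open>-1 + c^2 + d^2 \<le> 2\<close>, and the metric is positive definite there;
  the other two coefficients are bounded by hypothesis.\<close>

lemma bounded_exhaustion:
  assumes u: "u \<in> U"
  shows "bounded {x. form22 x x = -1 \<and> form22 x (\<phi> u) ^ 2 + form22 x (normal \<phi> u) ^ 2 \<le> 3}"
proof -
  define W where "W = gdet \<phi> u"
  have W: "W > 0" unfolding W_def by (rule gdet_pos [OF u])
  define R where "R = (1 + 2 * g22 \<phi> u / W) * norm (\<phi>\<^sub>1 \<phi> u) + (1 + 2 * g11 \<phi> u / W) * norm (\<phi>\<^sub>2 \<phi> u)
     + 4 * norm (\<phi> u) + 4 * norm (normal \<phi> u)"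
  have "norm x \<le> R" if x: "form22 x x = -1" "form22 x (\<phi> u) ^ 2 + form22 x (normal \<phi> u) ^ 2 \<le> 3" for x
  proof -
    define A where "A = (g22 \<phi> u * form22 x (\<phi>\<^sub>1 \<phi> u) - g12 \<phi> u * form22 x (\<phi>\<^sub>2 \<phi> u)) / W"
    define B where "B = (g11 \<phi> u * form22 x (\<phi>\<^sub>2 \<phi> u) - g12 \<phi> u * form22 x (\<phi>\<^sub>1 \<phi> u)) / W"
    define c where "c = form22 x (\<phi> u)"
    define d where "d = form22 x (normal \<phi> u)"
    have ex: "x = A *\<^sub>R \<phi>\<^sub>1 \<phi> u + B *\<^sub>R \<phi>\<^sub>2 \<phi> u - c *\<^sub>R \<phi> u - d *\<^sub>R normal \<phi> u"
      unfolding A_def B_def c_def d_def W_def by (rule tangent_expansion [OF u normal_orthogonal [OF u]])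
    define v :: "real^2" where "v = vector [A, B]"
    have y: "x + c *\<^sub>R \<phi> u + d *\<^sub>R normal \<phi> u = dd \<phi> u v"
      unfolding d\<phi>_expansion [OF u] v_def using ex by (simp add: algebra_simps)
    have "form22 (dd \<phi> u v) (dd \<phi> u v) = -1 + c^2 + d^2"
      unfolding y [symmetric] using x(1) norm_\<phi> [OF u] normal_orthogonal(1,2) [OF u]
        form22_commute [of "\<phi> u" x] form22_commute [of "normal \<phi> u" x] form22_commute [of "\<phi> u" "normal \<phi> u"]
      by (simp add: c_def [symmetric] d_def [symmetric] power2_eq_square)
    then have q: "A * A * g11 \<phi> u + 2 * A * B * g12 \<phi> u + B * B * g22 \<phi> u \<le> 2"
      using x(2) unfolding metric_expansion [OF u] v_def c_def d_def by (simp add: algebra_simps)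
    \<comment> \<open>Completing the square in \<open>A\<close> bounds \<open>B\<close>, and
      completing it in \<open>B\<close> bounds \<open>A\<close>.\<close>
    have 1: "g11 \<phi> u * (A * A * g11 \<phi> u + 2 * A * B * g12 \<phi> u + B * B * g22 \<phi> u) = (g11 \<phi> u * A + g12 \<phi> u * B)^2 + W * B^2"
      "g22 \<phi> u * (A * A * g11 \<phi> u + 2 * A * B * g12 \<phi> u + B * B * g22 \<phi> u) = (g22 \<phi> u * B + g12 \<phi> u * A)^2 + W * A^2"
      unfolding W_def gdet_def by (simp_all add: power2_eq_square algebra_simps)
    have "W * B^2 \<le> g11 \<phi> u * 2" "W * A^2 \<le> g22 \<phi> u * 2"
      using mult_left_mono [OF q, of "g11 \<phi> u"] mult_left_mono [OF q, of "g22 \<phi> u"] g11_pos [OF u] g22_pos [OF u]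
        zero_le_power2 [of "g11 \<phi> u * A + g12 \<phi> u * B"] zero_le_power2 [of "g22 \<phi> u * B + g12 \<phi> u * A"]
      unfolding 1 by linarith+
    then have AB: "B^2 \<le> 2 * g11 \<phi> u / W" "A^2 \<le> 2 * g22 \<phi> u / W"
      using W by (simp_all add: pos_le_divide_eq mult.commute)
    have small: "\<bar>t\<bar> \<le> 1 + t^2" for t :: real
      using zero_le_power2 [of "\<bar>t\<bar> - 1"] by (simp add: power2_eq_square algebra_simps abs_if split: if_splits)
    have "\<bar>A\<bar> \<le> 1 + 2 * g22 \<phi> u / W" "\<bar>B\<bar> \<le> 1 + 2 * g11 \<phi> u / W"
      using AB small [of A] small [of B] by linarith+
    moreover have "\<bar>c\<bar> \<le> 4" "\<bar>d\<bar> \<le> 4"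
      using x(2) small [of c] small [of d] zero_le_power2 [of c] zero_le_power2 [of d] unfolding c_def d_def by linarith+
    ultimately have "\<bar>A\<bar> * norm (\<phi>\<^sub>1 \<phi> u) + \<bar>B\<bar> * norm (\<phi>\<^sub>2 \<phi> u) + \<bar>c\<bar> * norm (\<phi> u) + \<bar>d\<bar> * norm (normal \<phi> u) \<le> R"
      unfolding R_def by (intro add_mono mult_right_mono) auto
    moreover have "norm x \<le> \<bar>A\<bar> * norm (\<phi>\<^sub>1 \<phi> u) + \<bar>B\<bar> * norm (\<phi>\<^sub>2 \<phi> u) + \<bar>c\<bar> * norm (\<phi> u) + \<bar>d\<bar> * norm (normal \<phi> u)"
    proof -
      have "norm (p + q - r - s) \<le> norm p + norm q + norm r + norm s" for p q r s :: "real^4"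
        by (smt (verit) norm_triangle_ineq norm_triangle_ineq4)
      from this [of "A *\<^sub>R \<phi>\<^sub>1 \<phi> u" "B *\<^sub>R \<phi>\<^sub>2 \<phi> u" "c *\<^sub>R \<phi> u" "d *\<^sub>R normal \<phi> u"]
      show ?thesis unfolding ex [symmetric] norm_scaleR .
    qed
    ultimately show ?thesis by linarith
  qed
  then show ?thesis unfolding bounded_iff by blast
qed

lemma smooth_gradsq: "smooth_on U (gradsq \<phi>)"
proof -
  have "gdet \<phi> u \<noteq> 0" if "u \<in> U" for u using gdet_pos [OF that] by simp
  then show ?thesis unfolding gradsq_def [abs_def]
    by (intro smooth_on_divide smooth_intros open_U smooth_basic smooth_second)
qed

end

section \<open>The gradient estimate\<close>

text \<open>Only umbilics are delicate. There the factor \<open>q\<close> has the conventional value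
  0, and \<open>gradsq_le\<close> squeezes it between 0 and
  \<open>curv \<phi> u powr (\<alpha> / 2)\<close> times a continuous function, which tends to 0
  because \<open>\<alpha> > 0\<close>.\<close>

lemma (in maximal_immersion) continuous_barrier:
  assumes e: "e > 0" and \<alpha>: "\<alpha> > 0"
  shows "continuous_on U (barrier a b e \<alpha> \<phi>)"
proof -
  define q where "q u = curv \<phi> u powr (\<alpha> / 2) * (gradsq \<phi> u / (4 * curv \<phi> u))" for u
  define r where "r u = curv \<phi> u powr (\<alpha> / 2) * (gradbound u / 4)" for u
  have cc: "continuous_on U (curv \<phi>)" "continuous_on U (gradsq \<phi>)" "continuous_on U gradbound"
    by (intro smooth_on_continuous smooth_second smooth_gradsq smooth_gradbound)+
  have rc: "continuous_on U r"
    unfolding r_def using curv_nonneg \<alpha> by (intro continuous_intros continuous_on_powr' cc) auto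
  have qr: "0 \<le> q u" "q u \<le> r u" if u: "u \<in> U" for u
  proof -
    have h: "curv \<phi> u \<ge> 0" and g: "gradsq \<phi> u \<ge> 0" using curv_nonneg gradsq_nonneg u by auto
    then show "0 \<le> q u" unfolding q_def by simp
    show "q u \<le> r u"
    proof (cases "curv \<phi> u = 0")
      case True then show ?thesis unfolding q_def r_def by simp
    next
      case False
      then have "gradsq \<phi> u / (4 * curv \<phi> u) \<le> gradbound u / 4"
        using gradsq_le [OF u] h by (simp add: divide_simps mult.commute)
      then show ?thesis unfolding q_def r_def by (intro mult_left_mono) auto
    qed
  qed
  have "isCont q u" if u: "u \<in> U" for u
  proof (cases "curv \<phi> u = 0")
    case True
    have "(r \<longlongrightarrow> r u) (at u)"
      using rc open_U u continuous_on_eq_continuous_at isCont_def by metis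
    then have "(r \<longlongrightarrow> 0) (at u)" using True by (simp add: r_def)
    moreover have "\<forall>\<^sub>F v in at u. v \<in> U" using open_U u eventually_at_topological by blast
    then have "\<forall>\<^sub>F v in at u. 0 \<le> q v" "\<forall>\<^sub>F v in at u. q v \<le> r v"
      using qr by (auto elim: eventually_mono)
    ultimately have "(q \<longlongrightarrow> 0) (at u)"
      using tendsto_sandwich [of "\<lambda>_. 0" q "at u" r 0] by auto
    then show ?thesis unfolding isCont_def using True by (simp add: q_def)
  next
    case False
    have "isCont (curv \<phi>) u" "isCont (gradsq \<phi>) u"
      using cc open_U u continuous_on_eq_continuous_at by blast+
    then show ?thesis unfolding q_def isCont_def using False by (intro tendsto_intros) auto
  qed
  then have qc: "continuous_on U q" by (simp add: continuous_at_imp_continuous_on)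
  have "1 + e - curv \<phi> u \<noteq> 0" if "u \<in> U" for u using curv_le_1 [OF that] e by simp
  then show ?thesis
    unfolding barrier_def [abs_def] q_def [symmetric]
    by (intro continuous_intros qc cc smooth_on_continuous [OF smooth_exhaustion]) auto
qed

context maximal_surface_nonpos
begin

text \<open>The function on the surface that is given by \<open>Q\<close> in charts; meaningful only if \<open>Q\<close> does not
  depend on the chart.\<close>

definition chart_val :: "((real^2 \<Rightarrow> real^4) \<Rightarrow> real^2 \<Rightarrow> real) \<Rightarrow> real^4 \<Rightarrow> real" where
  "chart_val Q x = (SOME r. \<exists>U \<phi> u. surface_chart S U \<phi> \<and> u \<in> U \<and> proj (\<phi> u) = proj x \<and> r = Q \<phi> u)"

definition chart_invariant :: "((real^2 \<Rightarrow> real^4) \<Rightarrow> real^2 \<Rightarrow> real) \<Rightarrow> bool" where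
  "chart_invariant Q \<longleftrightarrow> (\<forall>U1 \<phi>1 U2 \<phi>2 u1 u2. surface_chart S U1 \<phi>1 \<longrightarrow> surface_chart S U2 \<phi>2 \<longrightarrow>
     u1 \<in> U1 \<longrightarrow> u2 \<in> U2 \<longrightarrow> proj (\<phi>1 u1) = proj (\<phi>2 u2) \<longrightarrow> Q \<phi>1 u1 = Q \<phi>2 u2)"

lemma chart_val_eq:
  assumes inv: "chart_invariant Q" and c: "surface_chart S U \<phi>" "u \<in> U" "proj (\<phi> u) = proj x"
  shows "chart_val Q x = Q \<phi> u"
  unfolding chart_val_def
proof (rule some_equality)
  show "\<exists>U' \<phi>' u'. surface_chart S U' \<phi>' \<and> u' \<in> U' \<and> proj (\<phi>' u') = proj x \<and> Q \<phi> u = Q \<phi>' u'"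
    using c by blast
  fix r assume "\<exists>U \<phi> u. surface_chart S U \<phi> \<and> u \<in> U \<and> proj (\<phi> u) = proj x \<and> r = Q \<phi> u"
  then show "r = Q \<phi> u" using inv c unfolding chart_invariant_def by metis
qed

text \<open>Near each point the inclusion of \<open>lifted S\<close> lifts to a chart up to sign,
  and the function becomes \<open>Q \<phi>\<close> composed with the continuous lift.\<close>

lemma continuous_chart_val:
  assumes inv: "chart_invariant Q" and cont: "\<And>U \<phi>. surface_chart S U \<phi> \<Longrightarrow> continuous_on U (Q \<phi>)"
  shows "continuous_on (lifted S) (chart_val Q)"
  unfolding continuous_on_eq_continuous_within
proof
  fix x assume x: "x \<in> lifted S"
  then obtain U \<phi> u where c: "surface_chart S U \<phi>" and u: "u \<in> U" "proj (\<phi> u) = proj x"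
    using chart_at [of "proj x"] unfolding lifted_def by blast
  obtain T \<tau> \<sigma> where T: "open T" "x \<in> T" "\<sigma> = 1 \<or> \<sigma> = (-1::real)" "continuous_on (lifted S \<inter> T) \<tau>"
    and t: "\<And>z. z\<in>lifted S \<inter> T \<Longrightarrow> \<tau> z \<in> U \<and> z = \<sigma> *\<^sub>R \<phi> (\<tau> z)"
    using chart_lift [OF c continuous_on_id _ x u(1) u(2) [symmetric]] by blast
  have eq: "chart_val Q z = Q \<phi> (\<tau> z)" if "z \<in> lifted S \<inter> T" for z
  proof (rule chart_val_eq [OF inv c])
    show "\<tau> z \<in> U" using t [OF that] by blast
    have "proj z = proj (\<sigma> *\<^sub>R \<phi> (\<tau> z))" using t [OF that] by simp
    then show "proj (\<phi> (\<tau> z)) = proj z" using proj_scale_sign [OF T(3)] by simp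
  qed
  have "continuous_on (lifted S \<inter> T) (\<lambda>z. Q \<phi> (\<tau> z))"
    by (rule continuous_on_compose2 [OF cont [OF c] T(4)]) (use t in blast)
  then have "continuous_on (lifted S \<inter> T) (chart_val Q)"
    using eq continuous_on_cong [of "lifted S \<inter> T" _ "chart_val Q" "\<lambda>z. Q \<phi> (\<tau> z)"] by blast
  then have "continuous (at x within (lifted S \<inter> T)) (chart_val Q)"
    using x T(2) continuous_on_eq_continuous_within by blast
  moreover have "at x within (lifted S \<inter> T) = at x within (lifted S)"
    by (rule at_within_nhd [OF T(2,1)]) blast
  ultimately show "continuous (at x within lifted S) (chart_val Q)" by simp
qed

text \<open>A limit point \<open>x\<close> still satisfies \<open>form22 x x = -1\<close>, so its
  line is not in \<open>AdS3_boundary\<close>, the only place where \<open>entire\<close> allows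
  limit points outside \<open>S\<close>.\<close>

lemma closed_lifted:
  assumes ent: "entire S"
  shows "closed (lifted S)"
proof -
  have "x \<in> lifted S" if x: "x \<in> closure (lifted S)" for x
  proof -
    have "closed {x. form22 x x = -1}"
      by (intro closed_Collect_eq continuous_intros bounded_bilinear.continuous_on [OF bounded_bilinear_form22])
    then have n: "form22 x x = -1"
      using x closure_minimal [of "lifted S" "{x. form22 x x = -1}"] unfolding lifted_def by blast
    then have x0: "x \<noteq> 0" by auto
    have "continuous_map (top_of_set (UNIV - {0})) RP3 proj"
      using quotient_map_proj quotient_imp_continuous_map by blast
    then have "proj ` ((UNIV - {0}) \<inter> closure (lifted S)) \<subseteq> RP3 closure_of (proj ` lifted S)"
    proof -
      have "(UNIV - {0}) \<inter> lifted S = lifted S" using lifted_nonzero by blast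
      then have "top_of_set (UNIV - {0}) closure_of lifted S = (UNIV - {0}) \<inter> closure (lifted S)"
        using closure_of_subtopology [of euclidean "UNIV - {0}" "lifted S"] by (metis euclidean_closure_of)
      then show ?thesis
        using continuous_map_image_closure_subset [OF \<open>continuous_map _ RP3 proj\<close>, of "lifted S"] by metis
    qed
    then have "proj x \<in> RP3 closure_of (proj ` lifted S)" using x x0 by (simp add: image_subset_iff)
    moreover have "proj ` lifted S \<subseteq> S" unfolding lifted_def by blast
    ultimately have "proj x \<in> RP3 closure_of S" using closure_of_mono subsetD by metis
    moreover have "proj x \<notin> AdS3_boundary"
    proof
      assume "proj x \<in> AdS3_boundary"
      then obtain y where "form22 y y = 0" "proj x = proj y" unfolding AdS3_boundary_def by blast
      then obtain c where "x = c *\<^sub>R y" using proj_eq_imp_scaleR by blast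
      then show False using n \<open>form22 y y = 0\<close> by simp
    qed
    ultimately have "proj x \<in> S" using ent unfolding entire_def by blast
    then show ?thesis using n unfolding lifted_def by blast
  qed
  then show ?thesis using closure_subset_eq by blast
qed

text \<open>The base frame is taken at the very point where the estimate is wanted, so the cutoff
  equals 1 there. The factor 296 is 4 * 74, since the squared gradient of \<open>curv\<close> is
  \<open>4 * curv\<close> times that of the principal curvature.\<close>

lemma gradient_estimate:
  assumes ent: "entire S" and c: "surface_chart S U \<phi>" and u: "u \<in> U"
  shows "gradsq \<phi> u \<le> 296 * curv \<phi> u * (1 - curv \<phi> u)^2"
proof (cases "curv \<phi> u = 0")
  case True
  interpret maximal_immersion U \<phi> by (rule immersion [OF c])
  show ?thesis using gradsq_le [OF u] True by simp
next
  case False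
  interpret m: maximal_immersion U \<phi> by (rule immersion [OF c])
  have h: "curv \<phi> u > 0" using False m.curv_nonneg [OF u] by simp
  define a where "a = \<phi> u"
  define b where "b = normal \<phi> u"
  have ab: "form22 a a = -1" "form22 b b = -1" "form22 b a = 0" "form22 a b = 0"
    unfolding a_def b_def using m.norm_\<phi> m.normal_orthogonal u form22_commute by metis+
  define Gc where "Gc = (\<lambda>\<phi> u. exhaustion a b (\<phi> u) (normal \<phi> u))"
  have Ginv: "chart_invariant Gc"
    unfolding chart_invariant_def Gc_def using exhaustion_invariant by blast
  have Gcont: "continuous_on U' (Gc \<phi>')" if "surface_chart S U' \<phi>'" for U' \<phi>'
    unfolding Gc_def using smooth_on_continuous [OF maximal_immersion.smooth_exhaustion [OF immersion [OF that]]] .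
  define K where "K = {x \<in> lifted S. chart_val Gc x \<le> 3}"
  have cl: "closed K"
    using continuous_closed_preimage [OF continuous_chart_val [OF Ginv Gcont] closed_lifted [OF ent] closed_atMost [of 3]]
    unfolding K_def by (simp add: vimage_def Int_def)
  \<comment> \<open>Dropping the two terms with the normal from \<open>G\<close> leads to the set of
    \<open>bounded_exhaustion\<close>.\<close>
  have "K \<subseteq> {x. form22 x x = -1 \<and> form22 x a ^ 2 + form22 x b ^ 2 \<le> 3}"
  proof
    fix x assume x: "x \<in> K"
    then have xl: "x \<in> lifted S" unfolding K_def by blast
    then obtain U' \<phi>' u' where c': "surface_chart S U' \<phi>'" "u' \<in> U'" "proj (\<phi>' u') = proj x"
      using chart_at [of "proj x"] unfolding lifted_def by blast
    have "chart_val Gc x = Gc \<phi>' u'" by (rule chart_val_eq [OF Ginv c'])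
    moreover have "x = \<phi>' u' \<or> x = - \<phi>' u'"
      using proj_eq_normalized [OF c'(3) [symmetric]] xl chart_in_lifted [OF c'(1,2)] unfolding lifted_def by auto
    then have "form22 x a ^ 2 + form22 x b ^ 2 = form22 (\<phi>' u') a ^ 2 + form22 (\<phi>' u') b ^ 2" by auto
    moreover have "form22 (\<phi>' u') a ^ 2 + form22 (\<phi>' u') b ^ 2 \<le> Gc \<phi>' u'"
      unfolding Gc_def exhaustion_def by simp
    ultimately show "x \<in> {x. form22 x x = -1 \<and> form22 x a ^ 2 + form22 x b ^ 2 \<le> 3}"
      using x xl unfolding K_def lifted_def by auto
  qed
  then have "bounded K"
    using bounded_subset [OF m.bounded_exhaustion [OF u]] unfolding a_def b_def by blast
  then have K: "compact K" using cl compact_eq_bounded_closed by blast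
  have G2: "Gc \<phi> u = 2"
    unfolding Gc_def exhaustion_def a_def [symmetric] b_def [symmetric] using ab by simp
  have aK: "a \<in> K"
    unfolding K_def using chart_in_lifted [OF c u] chart_val_eq [OF Ginv c u, of a] G2 by (simp add: a_def)
  have bound: "curv \<phi> u powr (\<alpha> / 2) * (gradsq \<phi> u / (4 * curv \<phi> u)) \<le> 74 * (1 + e - curv \<phi> u)^2"
    if e: "e > 0" and \<alpha>: "0 < \<alpha>" "\<alpha> \<le> 1" for e \<alpha> :: real
  proof -
    have inv: "chart_invariant (barrier a b e \<alpha>)"
      unfolding chart_invariant_def using barrier_invariant by blast
    have cont: "continuous_on U' (barrier a b e \<alpha> \<phi>')" if "surface_chart S U' \<phi>'" for U' \<phi>'
      by (rule maximal_immersion.continuous_barrier [OF immersion [OF that] e \<alpha>(1)])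
    have "continuous_on K (chart_val (barrier a b e \<alpha>))"
      by (rule continuous_on_subset [OF continuous_chart_val [OF inv cont]]) (auto simp: K_def)
    then obtain x where x: "x \<in> K" and max: "\<And>y. y \<in> K \<Longrightarrow> chart_val (barrier a b e \<alpha>) y \<le> chart_val (barrier a b e \<alpha>) x"
      using continuous_attains_sup [OF K] aK by blast
    obtain U' \<phi>' u' where c': "surface_chart S U' \<phi>'" "u' \<in> U'" "proj (\<phi>' u') = proj x"
      using x chart_at [of "proj x"] unfolding lifted_def K_def by blast
    interpret m': maximal_immersion U' \<phi>' by (rule immersion [OF c'(1)])
    have val: "chart_val (barrier a b e \<alpha>) x = barrier a b e \<alpha> \<phi>' u'" by (rule chart_val_eq [OF inv c'])
    have Gx: "Gc \<phi>' u' \<le> 3" using x chart_val_eq [OF Ginv c'] unfolding K_def by simp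
    have h': "0 \<le> curv \<phi>' u'" "curv \<phi>' u' \<le> 1" and g': "0 \<le> gradsq \<phi>' u'"
      using m'.curv_nonneg m'.curv_le_1 m'.gradsq_nonneg c' by auto
    \<comment> \<open>If the condition fails, the barrier vanishes at its maximum: at an umbilic, at
      a critical point of \<open>curv\<close>, or where \<open>G = 3\<close>.\<close>
    have le74: "barrier a b e \<alpha> \<phi>' u' \<le> 74"
    proof (cases "curv \<phi>' u' > 0 \<and> gradsq \<phi>' u' > 0 \<and> Gc \<phi>' u' < 3")
      case True
      have "gradsq \<phi>' u' / (4 * curv \<phi>' u') * (3 - exhaustion a b (\<phi>' u') (normal \<phi>' u'))^2 \<le> 74 * (1 + e - curv \<phi>' u')^2"
      proof (rule m'.chart_bernstein [where N = U' and \<alpha> = \<alpha>])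
        fix v assume v: "v \<in> U'" "exhaustion a b (\<phi>' v) (normal \<phi>' v) \<le> 3"
        have "chart_val Gc (\<phi>' v) = Gc \<phi>' v" by (rule chart_val_eq [OF Ginv c'(1) v(1)]) simp
        then have "\<phi>' v \<in> K" using v chart_in_lifted [OF c'(1) v(1)] unfolding K_def Gc_def by simp
        moreover have "chart_val (barrier a b e \<alpha>) (\<phi>' v) = barrier a b e \<alpha> \<phi>' v"
          by (rule chart_val_eq [OF inv c'(1) v(1)]) simp
        ultimately show "barrier a b e \<alpha> \<phi>' v \<le> barrier a b e \<alpha> \<phi>' u'" using max val by metis
      qed (use True c' ab e \<alpha> m'.open_U in \<open>auto simp: Gc_def\<close>)
      \<comment> \<open>The power of \<open>curv\<close> is at most 1, so it can be put
        back.\<close>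
      then have "curv \<phi>' u' powr (\<alpha> / 2) * (gradsq \<phi>' u' / (4 * curv \<phi>' u') * (3 - exhaustion a b (\<phi>' u') (normal \<phi>' u'))^2)
         \<le> 1 * (74 * (1 + e - curv \<phi>' u')^2)"
        using h' g' \<alpha> by - (rule mult_mono, auto intro: powr_le1)
      then have "curv \<phi>' u' powr (\<alpha> / 2) * (gradsq \<phi>' u' / (4 * curv \<phi>' u')) * (3 - exhaustion a b (\<phi>' u') (normal \<phi>' u'))^2
         \<le> 74 * (1 + e - curv \<phi>' u')^2" by (simp only: mult.assoc mult_1)
      moreover have "(1 + e - curv \<phi>' u')^2 > 0" using h' e by simp
      ultimately show ?thesis unfolding barrier_def using pos_divide_le_eq by blast
    next
      case False
      then have "barrier a b e \<alpha> \<phi>' u' = 0" unfolding barrier_def using h' g' Gx unfolding Gc_def by auto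
      then show ?thesis by simp
    qed
    have "chart_val (barrier a b e \<alpha>) a = barrier a b e \<alpha> \<phi> u"
      by (rule chart_val_eq [OF inv c u]) (simp add: a_def)
    then have "barrier a b e \<alpha> \<phi> u \<le> 74" using max [OF aK] val le74 by simp
    then have "curv \<phi> u powr (\<alpha> / 2) * (gradsq \<phi> u / (4 * curv \<phi> u)) / (1 + e - curv \<phi> u)^2 \<le> 74"
      using G2 unfolding barrier_def Gc_def by simp
    moreover have "(1 + e - curv \<phi> u)^2 > 0" using m.curv_le_1 [OF u] e by simp
    ultimately show ?thesis using pos_divide_le_eq by blast
  qed
  \<comment> \<open>Both regularizations are removed at once, with \<open>e\<close> and
    \<open>\<alpha>\<close> equal to \<open>1 / (n + 1)\<close>; since
    \<open>curv \<phi> u > 0\<close>, the power tends to 1.\<close>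
  have "(\<lambda>n. curv \<phi> u powr (inverse (real (Suc n)) / 2) * (gradsq \<phi> u / (4 * curv \<phi> u))) \<longlonglongrightarrow>
     curv \<phi> u powr (0 / 2) * (gradsq \<phi> u / (4 * curv \<phi> u))"
    using h by (intro tendsto_intros LIMSEQ_inverse_real_of_nat) auto
  moreover have "(\<lambda>n. 74 * (1 + inverse (real (Suc n)) - curv \<phi> u)^2) \<longlonglongrightarrow> 74 * (1 + 0 - curv \<phi> u)^2"
    by (intro tendsto_intros LIMSEQ_inverse_real_of_nat)
  moreover have "curv \<phi> u powr (inverse (real (Suc n)) / 2) * (gradsq \<phi> u / (4 * curv \<phi> u))
     \<le> 74 * (1 + inverse (real (Suc n)) - curv \<phi> u)^2" for n
    by (rule bound) (auto simp: field_simps)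
  ultimately have "curv \<phi> u powr (0 / 2) * (gradsq \<phi> u / (4 * curv \<phi> u)) \<le> 74 * (1 + 0 - curv \<phi> u)^2"
    using LIMSEQ_le by blast
  then show ?thesis using h by (simp add: pos_divide_le_eq algebra_simps)
qed

end

section \<open>Integration along curves\<close>

text \<open>On each half the joined path is an affine reparametrization with doubled speed, apart
  from finitely many parameters, which integrability ignores.\<close>

lemma speed_join_integrable:
  assumes c1: "valid_path c1" "speed c1 integrable_on {0..1}"
    and c2: "valid_path c2" "speed c2 integrable_on {0..1}"
  shows "speed (c1 +++ c2) integrable_on {0..1}"
proof (rule Henstock_Kurzweil_Integration.integrable_combine [where a = 0 and c = "1/2" and b = 1])
  obtain s1 s2 where s1: "finite s1" "\<And>x. x \<in> {0..1} - s1 \<Longrightarrow> c1 differentiable at x"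
    and s2: "finite s2" "\<And>x. x \<in> {0..1} - s2 \<Longrightarrow> c2 differentiable at x"
    using c1(1) c2(1) by (auto simp: valid_path_def piecewise_C1_differentiable_on_def C1_differentiable_on_eq)
  have sc: "sqrt (form22 (2 *\<^sub>R v) (2 *\<^sub>R v)) = 2 * sqrt (form22 v v)" for v
    by (simp add: real_sqrt_mult mult.assoc [symmetric])
  have i1: "(\<lambda>x. 2 * speed c1 (2 * x)) integrable_on {0..1/2}"
  proof -
    obtain i where "(speed c1 has_integral i) (cbox 0 1)" using c1(2) by (auto simp: integrable_on_def)
    from has_integral_affinity' [OF this, of 2 0]
    have "((\<lambda>x. speed c1 (2 * x)) has_integral (i / 2)) {0..1/2}" by simp
    from has_integral_mult_right [OF this, of 2] show ?thesis by (rule has_integral_integrable)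
  qed
  show "speed (c1 +++ c2) integrable_on {0..1/2}"
  proof (rule integrable_spike_finite [OF _ _ i1])
    show "finite (insert 0 (insert (1/2) ((*) 2 -` s1)))"
      using s1 by (force intro: finite_vimageI [where h = "(*)2"] inj_onI)
    fix z :: real assume z: "z \<in> {0..1/2} - insert 0 (insert (1/2) ((*) 2 -` s1))"
    have "vector_derivative (c1 +++ c2) (at z) = 2 *\<^sub>R vector_derivative c1 (at (2 * z))"
    proof (rule vector_derivative_at, rule has_vector_derivative_transform_within_open)
      have "((*) 2 has_vector_derivative 2) (at z)"
        by (simp add: has_vector_derivative_def has_derivative_def bounded_linear_mult_left)
      moreover have "(c1 has_vector_derivative vector_derivative c1 (at (2 * z))) (at (2 * z))"
        using s1 z by (auto simp: vector_derivative_works)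
      ultimately show "((\<lambda>x. c1 (2 * x)) has_vector_derivative 2 *\<^sub>R vector_derivative c1 (at (2 * z))) (at z)"
        by (intro vector_diff_chain_at [simplified o_def])
      show "open {0<..<1/2::real}" "z \<in> {0<..<1/2}" using z by auto
    qed (auto simp: joinpaths_def)
    then show "speed (c1 +++ c2) z = 2 * speed c1 (2 * z)" unfolding speed_def by (simp only: sc)
  qed
  have i2: "(\<lambda>x. 2 * speed c2 (2 * x - 1)) integrable_on {1/2..1}"
  proof -
    obtain i where "(speed c2 has_integral i) (cbox 0 1)" using c2(2) by (auto simp: integrable_on_def)
    from has_integral_affinity' [OF this, of 2 "-1"]
    have "((\<lambda>x. speed c2 (2 * x - 1)) has_integral (i / 2)) {1/2..1}" by simp
    from has_integral_mult_right [OF this, of 2] show ?thesis by (rule has_integral_integrable)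
  qed
  show "speed (c1 +++ c2) integrable_on {1/2..1}"
  proof (rule integrable_spike_finite [OF _ _ i2])
    show "finite (insert 1 (insert (1/2) ((\<lambda>x. 2 * x - 1) -` s2)))"
      using s2 by (force intro: finite_vimageI [where h = "\<lambda>x. 2*x-1"] inj_onI)
    fix z :: real assume z: "z \<in> {1/2..1} - insert 1 (insert (1/2) ((\<lambda>x. 2 * x - 1) -` s2))"
    have "vector_derivative (c1 +++ c2) (at z) = 2 *\<^sub>R vector_derivative c2 (at (2 * z - 1))"
    proof (rule vector_derivative_at, rule has_vector_derivative_transform_within_open)
      have "((\<lambda>x. 2 * x - 1) has_vector_derivative 2) (at z)"
        by (simp add: has_vector_derivative_def has_derivative_def bounded_linear_mult_left)
      moreover have "(c2 has_vector_derivative vector_derivative c2 (at (2 * z - 1))) (at (2 * z - 1))"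
        using s2 z by (auto simp: vector_derivative_works)
      ultimately show "((\<lambda>x. c2 (2 * x - 1)) has_vector_derivative 2 *\<^sub>R vector_derivative c2 (at (2 * z - 1))) (at z)"
        by (intro vector_diff_chain_at [simplified o_def])
      show "open {1/2<..<1::real}" "z \<in> {1/2<..<1}" using z by auto
    qed (auto simp: joinpaths_def)
    then show "speed (c1 +++ c2) z = 2 * speed c2 (2 * z - 1)" unfolding speed_def by (simp only: sc)
  qed
qed auto

lemma speed_uminus: 
  assumes "valid_path c"
  shows "valid_path (\<lambda>t. - c t)" "speed c integrable_on {0..1} \<Longrightarrow> speed (\<lambda>t. - c t) integrable_on {0..1}"
proof -
  show "valid_path (\<lambda>t. - c t)" 
    using linear_image_valid_path [OF assms, of uminus] by (simp add: o_def linear_uminus)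
  obtain s where s: "finite s" "\<And>x. x \<in> {0..1} - s \<Longrightarrow> c differentiable at x"
    using assms by (auto simp: valid_path_def piecewise_C1_differentiable_on_def C1_differentiable_on_eq)
  have eq: "speed (\<lambda>t. - c t) z = speed c z" if "z \<in> {0..1} - s" for z
  proof -
    have "((\<lambda>t. - c t) has_vector_derivative - vector_derivative c (at z)) (at z)"
      using s(2) [OF that] has_vector_derivative_minus vector_derivative_works by blast
    from vector_derivative_at [OF this] show ?thesis by (simp add: speed_def)
  qed
  show "speed (\<lambda>t. - c t) integrable_on {0..1}" if "speed c integrable_on {0..1}"
    by (rule integrable_spike_finite [OF s(1) eq that])
qed

text \<open>Two lifts meet only up to sign. If they meet at antipodal points, the second is replaced
  by its negative, which projects to the same curve.\<close>

lemma surface_curve_join: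
  assumes c1: "surface_curve S p q c1" and c2: "surface_curve S q r c2"
  shows "\<exists>c. surface_curve S p r c"
proof -
  have v: "valid_path c1" "valid_path c2" and i: "speed c1 integrable_on {0..1}" "speed c2 integrable_on {0..1}"
    and l: "\<And>t. t \<in> {0..1} \<Longrightarrow> c1 t \<in> lifted S" "\<And>t. t \<in> {0..1} \<Longrightarrow> c2 t \<in> lifted S"
    and e: "proj (c1 0) = p" "proj (c1 1) = q" "proj (c2 0) = q" "proj (c2 1) = r"
    using c1 c2 unfolding surface_curve_def lifted_def by auto
  have join: "surface_curve S p r (c1 +++ c2')"
    if v': "valid_path c2'" "speed c2' integrable_on {0..1}" and l': "\<And>t. t \<in> {0..1} \<Longrightarrow> c2' t \<in> lifted S"
      and e': "c1 1 = c2' 0" "proj (c2' 1) = r" for c2'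
    unfolding surface_curve_def
  proof (intro conjI ballI)
    show "valid_path (c1 +++ c2')" using v v' e' by (intro valid_path_join) (auto simp: pathfinish_def pathstart_def)
    show "speed (c1 +++ c2') integrable_on {0..1}" by (rule speed_join_integrable [OF v(1) i(1) v'])
    show "proj ((c1 +++ c2') 0) = p" "proj ((c1 +++ c2') 1) = r" using e e' by (auto simp: joinpaths_def)
    fix t :: real assume "t \<in> {0..1}"
    then have "(c1 +++ c2') t \<in> lifted S" using l(1) [of "2 * t"] l' [of "2 * t - 1"] by (auto simp: joinpaths_def)
    then show "form22 ((c1 +++ c2') t) ((c1 +++ c2') t) = -1" "proj ((c1 +++ c2') t) \<in> S" unfolding lifted_def by auto
  qed
  have "c1 1 = c2 0 \<or> c1 1 = - c2 0"
    using proj_eq_normalized [of "c1 1" "c2 0"] l(1) [of 1] l(2) [of 0] e unfolding lifted_def by auto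
  then show ?thesis
  proof
    assume "c1 1 = c2 0"
    then show ?thesis using join [OF v(2) i(2) l(2)] e by blast
  next
    assume "c1 1 = - c2 0"
    moreover have "- c2 t \<in> lifted S" if "t \<in> {0..1}" for t
      using l(2) [OF that] unfolding lifted_def by (simp add: proj_uminus)
    ultimately show ?thesis using join [OF speed_uminus [OF v(2)]] i(2) e by (auto simp: proj_uminus)
  qed
qed

context maximal_surface_nonpos
begin

lemma chart_segment_curve:
  assumes c: "surface_chart S U \<phi>" and B: "ball w d \<subseteq> U" and uv: "u \<in> ball w d" "v \<in> ball w d"
  shows "surface_curve S (proj (\<phi> u)) (proj (\<phi> v)) (\<lambda>t. \<phi> (linepath u v t))"
proof -
  have s: "smooth_on U \<phi>" and U: "open U" using c unfolding surface_chart_def by auto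
  interpret m: maximal_immersion U \<phi> by (rule immersion [OF c])
  have inU: "linepath u v t \<in> U" if "t \<in> {0..1}" for t
    using that uv B convex_contains_segment [of "ball w d"] convex_ball linepath_in_path by blast
  define D where "D = (\<lambda>t. dd \<phi> (linepath u v t) (v - u))"
  have D: "((\<lambda>t. \<phi> (linepath u v t)) has_vector_derivative D t) (at t)" if "t \<in> {0..1}" for t
  proof -
    have "(linepath u v has_derivative (\<lambda>h. h *\<^sub>R (v - u))) (at t)"
      using has_vector_derivative_linepath_within [of u v t UNIV] by (simp add: has_vector_derivative_def)
    from has_derivative_compose [OF this smooth_on_has_derivative [OF s inU [OF that]]]
    show ?thesis unfolding has_vector_derivative_def D_def
      by (simp add: linear_scale [OF m.linear_d\<phi> [OF inU [OF that]]])
  qed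
  have cD: "continuous_on {0..1} D"
    unfolding D_def
    by (rule continuous_on_compose2 [OF smooth_on_continuous [OF smooth_on_dd [OF s]] continuous_on_linepath])
      (use inU in auto)
  show ?thesis unfolding surface_curve_def
  proof (intro conjI ballI)
    have "(\<lambda>t. \<phi> (linepath u v t)) C1_differentiable_on {0..1}"
      unfolding C1_differentiable_on_def using D cD by blast
    then show "valid_path (\<lambda>t. \<phi> (linepath u v t))"
      unfolding valid_path_def by (rule C1_differentiable_imp_piecewise)
    have "speed (\<lambda>t. \<phi> (linepath u v t)) t = sqrt (form22 (D t) (D t))" if "t \<in> {0..1}" for t
      unfolding speed_def vector_derivative_at [OF D [OF that]] ..
    moreover have "continuous_on {0..1} (\<lambda>t. sqrt (form22 (D t) (D t)))"
      by (intro continuous_intros bounded_bilinear.continuous_on [OF bounded_bilinear_form22] cD)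
    ultimately have "continuous_on {0..1} (speed (\<lambda>t. \<phi> (linepath u v t)))"
      using continuous_on_cong by (metis (no_types, lifting))
    then show "speed (\<lambda>t. \<phi> (linepath u v t)) integrable_on {0..1}"
      by (rule integrable_continuous_interval)
    fix t :: real assume "t \<in> {0..1}"
    then show "form22 (\<phi> (linepath u v t)) (\<phi> (linepath u v t)) = -1" "proj (\<phi> (linepath u v t)) \<in> S"
      using chart_in_lifted [OF c inU] unfolding lifted_def by auto
  qed (auto simp: linepath_def)
qed

lemma openin_chart_image:
  assumes c: "surface_chart S U \<phi>" and V: "open V" "V \<subseteq> U"
  shows "openin (subtopology RP3 S) ((proj \<circ> \<phi>) ` V)"
proof -
  have h: "homeomorphic_map (top_of_set U) (subtopology (subtopology RP3 S) ((proj \<circ> \<phi>) ` U)) (proj \<circ> \<phi>)"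
    and o: "openin (subtopology RP3 S) ((proj \<circ> \<phi>) ` U)" and U: "open U"
    using c unfolding surface_chart_def embedding_map_def by auto
  have "openin (top_of_set U) V" using V U openin_open_eq by blast
  then have "openin (subtopology (subtopology RP3 S) ((proj \<circ> \<phi>) ` U)) ((proj \<circ> \<phi>) ` V)"
    using homeomorphic_map_openness [OF h, of V] V by auto
  then show ?thesis using openin_trans_full o by blast
qed

text \<open>Ensures that the infimum in \<open>surface_dist\<close> is over a nonempty set. The
  points reachable from \<open>p\<close> and the remaining ones both form open sets, and the surface
  is connected, being homeomorphic to a disc.\<close>

lemma curve_exists:
  assumes ent: "entire S" and p: "p \<in> S" and q: "q \<in> S"
  shows "\<exists>c. surface_curve S p q c"
proof -
  define X where "X = subtopology RP3 S"
  have "topspace RP3 = proj ` (UNIV - {0})" by (rule topspace_RP3)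
  moreover have "S \<subseteq> proj ` (UNIV - {0})"
  proof
    fix r assume "r \<in> S"
    then obtain U \<phi> u where "surface_chart S U \<phi>" "u \<in> U" "proj (\<phi> u) = r" using chart_at by blast
    then show "r \<in> proj ` (UNIV - {0})" using chart_in_lifted lifted_nonzero by blast
  qed
  ultimately have tX: "topspace X = S" unfolding X_def by auto
  have "connected_space (top_of_set (ball (0::real^2) 1))"
    using connectedin_iff_connected connectedin_def connected_ball by blast
  then have conn: "connected_space X"
    using ent homeomorphic_connected_space unfolding entire_def X_def by blast
  define A where "A = {r \<in> S. \<exists>c. surface_curve S p r c}"
  \<comment> \<open>Any two points of such a neighbourhood are joined, in either order, so it serves
    for the openness of both sets.\<close>
  have nb: "\<exists>N. openin X N \<and> r \<in> N \<and> (\<forall>s\<in>N. \<forall>s'\<in>N. \<exists>c. surface_curve S s s' c)" if r: "r \<in> S" for r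
  proof -
    obtain U \<phi> u where c: "surface_chart S U \<phi>" "u \<in> U" "proj (\<phi> u) = r" using chart_at [OF r] by blast
    have "open U" using c unfolding surface_chart_def by blast
    then obtain d where d: "d > 0" "ball u d \<subseteq> U" using c open_contains_ball by blast
    show ?thesis
    proof (intro exI [of _ "(proj \<circ> \<phi>) ` ball u d"] conjI ballI)
      show "openin X ((proj \<circ> \<phi>) ` ball u d)" unfolding X_def by (rule openin_chart_image [OF c(1) _ d(2)]) simp
      show "r \<in> (proj \<circ> \<phi>) ` ball u d" using c d by (auto intro!: image_eqI [of _ _ u])
      fix s s' assume "s \<in> (proj \<circ> \<phi>) ` ball u d" "s' \<in> (proj \<circ> \<phi>) ` ball u d"
      then show "\<exists>c. surface_curve S s s' c" using chart_segment_curve [OF c(1) d(2)] by fastforce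
    qed
  qed
  have "openin X A"
  proof (subst openin_subopen, intro ballI)
    fix r assume r: "r \<in> A"
    then obtain N where N: "openin X N" "r \<in> N" "\<And>s s'. s \<in> N \<Longrightarrow> s' \<in> N \<Longrightarrow> \<exists>c. surface_curve S s s' c"
      using nb [of r] unfolding A_def by blast
    have "N \<subseteq> A" using r N surface_curve_join openin_subset [OF N(1)] tX unfolding A_def by blast
    then show "\<exists>T. openin X T \<and> r \<in> T \<and> T \<subseteq> A" using N by blast
  qed
  moreover have "openin X (S - A)"
  proof (subst openin_subopen, intro ballI)
    fix r assume r: "r \<in> S - A"
    then obtain N where N: "openin X N" "r \<in> N" "\<And>s s'. s \<in> N \<Longrightarrow> s' \<in> N \<Longrightarrow> \<exists>c. surface_curve S s s' c"
      using nb [of r] by blast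
    have "N \<subseteq> S - A" using r N surface_curve_join openin_subset [OF N(1)] tX unfolding A_def by blast
    then show "\<exists>T. openin X T \<and> r \<in> T \<and> T \<subseteq> S - A" using N by blast
  qed
  moreover have "p \<in> A"
    using nb [OF p] p unfolding A_def by blast
  moreover have "A \<subseteq> S" unfolding A_def by blast
  ultimately have "S - A = {}"
    using conn unfolding connected_space_def tX by blast
  then show ?thesis using q unfolding A_def by blast
qed

section \<open>From the gradient estimate to the exponential bound\<close>

lemma curv_chart_invariant: "chart_invariant curv"
  unfolding chart_invariant_def using curv_invariant by blast

abbreviation "h \<equiv> chart_val curv"

lemma continuous_h: "continuous_on (lifted S) h"
  by (rule continuous_chart_val [OF curv_chart_invariant])
    (use spacelike_immersion.smooth_second(4) [OF spacelike_immersion] smooth_on_continuous in blast)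

lemma h_eq:
  assumes "x \<in> lifted S"
  shows "nonneg_principal_curvature S (proj x) = sqrt (h x)" "0 \<le> h x" "h x \<le> 1"
proof -
  obtain U \<phi> u where c: "surface_chart S U \<phi>" "u \<in> U" "proj (\<phi> u) = proj x"
    using chart_at [of "proj x"] assms unfolding lifted_def by blast
  interpret m: maximal_immersion U \<phi> by (rule immersion [OF c(1)])
  show "nonneg_principal_curvature S (proj x) = sqrt (h x)" "0 \<le> h x" "h x \<le> 1"
    using nonneg_principal_curvature_eq [OF c(1,2)] c m.curv_nonneg m.curv_le_1
    unfolding chart_val_eq [OF curv_chart_invariant c] by auto
qed

text \<open>Since \<open>1 - k^2 \<le> 2 * (1 - k)\<close>, the gradient estimate gives the constant
  4 * 296 = 1184, rounded up to 1296 = 36^2.\<close>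

lemma differential_bound:
  assumes ent: "entire S" and c: "surface_chart S U \<phi>" and u: "u \<in> U"
  shows "\<bar>dd (curv \<phi>) u v\<bar> \<le> 36 * sqrt (curv \<phi> u) * (1 - sqrt (curv \<phi> u)) * sqrt (form22 (dd \<phi> u v) (dd \<phi> u v))"
proof -
  interpret m: maximal_immersion U \<phi> by (rule immersion [OF c])
  define k where "k = sqrt (curv \<phi> u)"
  have h: "0 \<le> curv \<phi> u" "curv \<phi> u \<le> 1" using m.curv_nonneg m.curv_le_1 u by auto
  then have k: "0 \<le> k" "k \<le> 1" "curv \<phi> u = k^2" unfolding k_def by auto
  have g: "form22 (dd \<phi> u v) (dd \<phi> u v) \<ge> 0"
    using m.spacelike [OF u, of v] by (cases "v = 0") (auto simp: linear_0 [OF m.linear_d\<phi> [OF u]])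
  have "(1 - k^2)^2 = ((1 - k) * (1 + k))^2" by (simp add: algebra_simps power2_eq_square)
  also have "\<dots> \<le> ((1 - k) * 2)^2" using k by (intro power_mono mult_left_mono mult_nonneg_nonneg) auto
  finally have 1: "(1 - k^2)^2 \<le> 4 * (1 - k)^2" by (simp only: power_mult_distrib) simp
  have "(dd (curv \<phi>) u v)^2 \<le> gradsq \<phi> u * form22 (dd \<phi> u v) (dd \<phi> u v)"
    by (rule m.gradient_cauchy_schwarz [OF u])
  also have "\<dots> \<le> 296 * k^2 * (1 - k^2)^2 * form22 (dd \<phi> u v) (dd \<phi> u v)"
    using gradient_estimate [OF ent c u] g unfolding k by (intro mult_right_mono) auto
  also have "\<dots> \<le> 296 * k^2 * (4 * (1 - k)^2) * form22 (dd \<phi> u v) (dd \<phi> u v)"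
    using 1 g by (intro mult_right_mono mult_left_mono) auto
  also have "\<dots> \<le> 1296 * k^2 * (1 - k)^2 * form22 (dd \<phi> u v) (dd \<phi> u v)"
    using g by (simp add: mult_right_mono)
  also have "\<dots> = (36 * k * (1 - k) * sqrt (form22 (dd \<phi> u v) (dd \<phi> u v)))^2"
    using g by (simp add: power_mult_distrib)
  finally have "\<bar>dd (curv \<phi>) u v\<bar> \<le> \<bar>36 * k * (1 - k) * sqrt (form22 (dd \<phi> u v) (dd \<phi> u v))\<bar>"
    using abs_le_square_iff by blast
  also have "\<dots> = 36 * k * (1 - k) * sqrt (form22 (dd \<phi> u v) (dd \<phi> u v))"
    using k g by (intro abs_of_nonneg) simp
  finally show ?thesis unfolding k_def .
qed

text \<open>Near \<open>t\<close> the curve is lifted to a chart; the sign of the lift affects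
  neither \<open>h\<close> nor the speed. The bound is for \<open>h\<close> and not for its square
  root, which need not be differentiable at umbilics.\<close>

lemma h_along_curve:
  assumes ent: "entire S" and c: "continuous_on {0<..<1} c" "\<And>t. t \<in> {0<..<1} \<Longrightarrow> c t \<in> lifted S"
    and t: "t \<in> {0<..<1::real}" and d: "c differentiable (at t)"
  shows "\<exists>D. ((\<lambda>t. h (c t)) has_real_derivative D) (at t) \<and>
     \<bar>D\<bar> \<le> 36 * sqrt (h (c t)) * (1 - sqrt (h (c t))) * speed c t \<and> 0 \<le> speed c t"
proof -
  obtain U \<phi> u where ch: "surface_chart S U \<phi>" "u \<in> U" "proj (\<phi> u) = proj (c t)"
    using chart_at [of "proj (c t)"] c(2) [OF t] unfolding lifted_def by blast
  interpret m: maximal_immersion U \<phi> by (rule immersion [OF ch(1)])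
  obtain T \<tau> \<sigma> where T: "open T" "t \<in> T" "\<sigma> = 1 \<or> \<sigma> = (-1::real)" "\<tau> t = u"
    and 1: "\<And>z. z \<in> T \<Longrightarrow> \<tau> z \<in> U \<and> c z = \<sigma> *\<^sub>R \<phi> (\<tau> z)"
    and 2: "\<And>z. z \<in> T \<Longrightarrow> c differentiable (at z) \<Longrightarrow> \<tau> differentiable (at z) \<and> (\<forall>v. dd c z v = \<sigma> *\<^sub>R dd \<phi> (\<tau> z) (dd \<tau> z v))"
    using chart_lift_differentiable [OF ch(1) open_greaterThanLessThan c t ch(2) ch(3) [symmetric]] by metis
  have hc: "h (c z) = curv \<phi> (\<tau> z)" if "z \<in> T" for z
    by (rule chart_val_eq [OF curv_chart_invariant ch(1)]) (use 1 [OF that] proj_scale_sign [OF T(3)] in auto)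
  define w where "w = dd \<tau> t 1"
  have d\<tau>: "(\<tau> has_derivative dd \<tau> t) (at t)" and dc: "dd c t v = \<sigma> *\<^sub>R dd \<phi> u (dd \<tau> t v)" for v
    using 2 [OF T(2) d] has_derivative_dd T(4) by auto
  have "((\<lambda>z. curv \<phi> (\<tau> z)) has_derivative (\<lambda>r. dd (curv \<phi>) u (dd \<tau> t r))) (at t)"
    using has_derivative_compose [OF d\<tau>, of "curv \<phi>" "dd (curv \<phi>) u"] smooth_on_has_derivative [OF m.smooth_second(4) ch(2)] T(4) by simp
  then have "((\<lambda>z. h (c z)) has_derivative (\<lambda>r. dd (curv \<phi>) u (dd \<tau> t r))) (at t)"
    by (rule has_derivative_transform_within_open [OF _ T(1,2)]) (simp add: hc)
  moreover have "dd (curv \<phi>) u (dd \<tau> t r) = dd (curv \<phi>) u w * r" for r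
    using linear_scale [OF has_derivative_linear [OF d\<tau>], of r 1] linear_scale [OF m.linear_dh [OF ch(2)], of r w]
    unfolding w_def by simp
  ultimately have D: "((\<lambda>z. h (c z)) has_real_derivative dd (curv \<phi>) u w) (at t)"
    unfolding has_field_derivative_def by (simp add: fun_eq_iff)
  have "(c has_vector_derivative dd c t 1) (at t)"
  proof -
    have "dd c t r = r *\<^sub>R dd c t 1" for r
      using linear_scale [OF linear_dd [OF d], of r 1] by simp
    then have "dd c t = (\<lambda>r. r *\<^sub>R dd c t 1)" by (rule ext)
    then show ?thesis using has_derivative_dd [OF d] unfolding has_vector_derivative_def by metis
  qed
  then have "vector_derivative c (at t) = \<sigma> *\<^sub>R dd \<phi> u w"
    unfolding dc w_def by (rule vector_derivative_at)
  then have "speed c t = sqrt (form22 (dd \<phi> u w) (dd \<phi> u w))" using T(3) unfolding speed_def by auto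
  moreover have "form22 (dd \<phi> u w) (dd \<phi> u w) \<ge> 0"
    using m.spacelike [OF ch(2), of w] by (cases "w = 0") (auto simp: linear_0 [OF m.linear_d\<phi> [OF ch(2)]])
  ultimately show ?thesis using D differential_bound [OF ent ch(1,2), of w] hc [OF T(2)] T(4) by auto
qed

text \<open>Here \<open>\<epsilon>\<close> regularizes both the square root at umbilics and the logarithm at \<open>\<lambda> = 1\<close>.\<close>

lemma curve_estimate_regularized:
  assumes ent: "entire S" and c: "surface_curve S p q c" and e: "\<epsilon> > 0"
  shows "1 + 2 * \<epsilon> - sqrt (h (c 1) + \<epsilon>^2) \<le> exp (18 * integral {0..1} (speed c)) * (1 + 2 * \<epsilon> - sqrt (h (c 0) + \<epsilon>^2))"
proof -
  have v: "valid_path c" and i: "speed c integrable_on {0..1}" and l: "\<And>t. t \<in> {0..1} \<Longrightarrow> c t \<in> lifted S"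
    using c unfolding surface_curve_def lifted_def by auto
  have cc: "continuous_on {0..1} c" using valid_path_imp_path [OF v] by (simp add: path_def)
  obtain s where s: "finite s" "\<And>x. x \<in> {0..1} - s \<Longrightarrow> c differentiable at x"
    using v by (auto simp: valid_path_def piecewise_C1_differentiable_on_def C1_differentiable_on_eq)
  define r where "r = (\<lambda>t. sqrt (h (c t) + \<epsilon>^2))"
  \<comment> \<open>\<open>1 + 2 * \<epsilon> - r t\<close> is at least
    \<open>1 - sqrt (h (c t)) + \<epsilon>\<close>. This keeps the logarithm defined and, as
    \<open>r t\<close> is at least \<open>sqrt (h (c t))\<close>, lets
    \<open>r t * (1 + 2 * \<epsilon> - r t)\<close> dominate the corresponding product for
    \<open>sqrt (h (c t))\<close>.\<close>
  define g where "g = (\<lambda>t. ln (1 + 2 * \<epsilon> - r t))"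
  have r: "r t \<le> sqrt (h (c t)) + \<epsilon>" "sqrt (h (c t)) \<le> r t" "r t > 0" "1 + 2 * \<epsilon> - r t > 0" if "t \<in> {0..1}" for t
  proof -
    have hh: "0 \<le> h (c t)" "h (c t) \<le> 1" using h_eq [OF l [OF that]] by auto
    show 1: "r t \<le> sqrt (h (c t)) + \<epsilon>"
      unfolding r_def using hh e by (intro real_le_lsqrt) (auto simp: power2_eq_square algebra_simps)
    show "sqrt (h (c t)) \<le> r t" unfolding r_def by simp
    show "r t > 0" unfolding r_def using hh e by (simp add: add_nonneg_pos)
    have "sqrt (h (c t)) \<le> 1" using hh by simp
    then show "1 + 2 * \<epsilon> - r t > 0" using 1 e by linarith
  qed
  have hcc: "continuous_on {0..1} (\<lambda>t. h (c t))"
    by (rule continuous_on_compose2 [OF continuous_h cc]) (use l in auto)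
  have gc: "continuous_on {0..1} g"
    unfolding g_def
  proof (rule continuous_on_ln)
    show "continuous_on {0..1} (\<lambda>t. 1 + 2 * \<epsilon> - r t)" unfolding r_def by (intro continuous_intros hcc)
    show "\<forall>t\<in>{0..1}. 1 + 2 * \<epsilon> - r t \<noteq> 0" using r(4) by force
  qed
  \<comment> \<open>18 is half of 36, because differentiating the square root brings the factor
    \<open>1 / (2 * r t)\<close>.\<close>
  have "\<exists>D. (g has_real_derivative D) (at t) \<and> D \<le> 18 * speed c t" if t: "t \<in> {0<..<1} - s" for t
  proof -
    have t01: "t \<in> {0..1}" using t by auto
    have "\<exists>D. ((\<lambda>t. h (c t)) has_real_derivative D) (at t) \<and>
       \<bar>D\<bar> \<le> 36 * sqrt (h (c t)) * (1 - sqrt (h (c t))) * speed c t \<and> 0 \<le> speed c t"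
      by (rule h_along_curve [OF ent continuous_on_subset [OF cc]]) (use l t s(2) in auto)
    then obtain D where D: "((\<lambda>t. h (c t)) has_real_derivative D) (at t)"
      "\<bar>D\<bar> \<le> 36 * sqrt (h (c t)) * (1 - sqrt (h (c t))) * speed c t" and s0: "0 \<le> speed c t" by blast
    define k where "k = sqrt (h (c t))"
    have hh: "0 \<le> h (c t)" "h (c t) \<le> 1" using h_eq [OF l [OF t01]] by auto
    then have k: "0 \<le> k" "k \<le> 1" unfolding k_def by auto
    have pos: "h (c t) + \<epsilon>^2 > 0" using hh e by (simp add: add_nonneg_pos)
    note rt = r [OF t01, folded k_def]
    have rd: "(r has_real_derivative D / (2 * r t)) (at t)"
      unfolding r_def using pos by (auto intro!: derivative_eq_intros D(1) simp: field_simps)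
    have gd: "(g has_real_derivative - (D / (2 * r t)) / (1 + 2 * \<epsilon> - r t)) (at t)"
      unfolding g_def using rt(4) by (auto intro!: derivative_eq_intros rd)
    have "- D \<le> 36 * (k * (1 - k)) * speed c t" using D(2) unfolding k_def by (simp add: mult.assoc)
    also have "\<dots> \<le> 36 * (r t * (1 + 2 * \<epsilon> - r t)) * speed c t"
      using k rt e s0 by (intro mult_right_mono mult_left_mono mult_mono) auto
    finally have "- D \<le> 18 * speed c t * (2 * r t * (1 + 2 * \<epsilon> - r t))" by (simp add: algebra_simps)
    moreover have "2 * r t * (1 + 2 * \<epsilon> - r t) > 0" using rt by simp
    ultimately have "- D / (2 * r t * (1 + 2 * \<epsilon> - r t)) \<le> 18 * speed c t"
      using pos_divide_le_eq by blast
    then have "- (D / (2 * r t)) / (1 + 2 * \<epsilon> - r t) \<le> 18 * speed c t" by (simp add: divide_divide_eq_left)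
    then show ?thesis using gd by blast
  qed
  then obtain D where D: "\<And>t. t \<in> {0<..<1} - s \<Longrightarrow> (g has_real_derivative D t) (at t)"
     "\<And>t. t \<in> {0<..<1} - s \<Longrightarrow> D t \<le> 18 * speed c t" by metis
  have "(D has_integral (g 1 - g 0)) {0..1}"
    by (rule fundamental_theorem_of_calculus_interior_strong [OF s(1)])
      (use D(1) gc in \<open>auto simp: has_real_derivative_iff_has_vector_derivative\<close>)
  \<comment> \<open>At the finitely many exceptional parameters \<open>D\<close> is arbitrary; there
    it is replaced by the bound itself, so that the integrands can be compared at every
    point.\<close>
  then have "((\<lambda>t. if t \<in> insert 0 (insert 1 s) then 18 * speed c t else D t) has_integral (g 1 - g 0)) {0..1}"
    by (rule has_integral_spike_finite [of "insert 0 (insert 1 s)", rotated 2]) (use s in auto)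
  moreover have "((\<lambda>t. 18 * speed c t) has_integral (18 * integral {0..1} (speed c))) {0..1}"
    by (intro has_integral_mult_right integrable_integral i)
  ultimately have "g 1 - g 0 \<le> 18 * integral {0..1} (speed c)"
    by (rule has_integral_le) (use D(2) in auto)
  then have "g 1 \<le> 18 * integral {0..1} (speed c) + g 0" by simp
  then have "exp (g 1) \<le> exp (18 * integral {0..1} (speed c)) * exp (g 0)"
    unfolding exp_add [symmetric] by simp
  then show ?thesis unfolding g_def using r(4) [of 0] r(4) [of 1] by (simp add: r_def)
qed

lemma curve_estimate:
  assumes ent: "entire S" and c: "surface_curve S p q c"
  shows "1 - nonneg_principal_curvature S q \<le> exp (18 * integral {0..1} (speed c)) * (1 - nonneg_principal_curvature S p)"
proof -
  define E where "E = exp (18 * integral {0..1} (speed c))"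
  have l: "c 0 \<in> lifted S" "c 1 \<in> lifted S" and e: "proj (c 0) = p" "proj (c 1) = q"
    using c unfolding surface_curve_def lifted_def by auto
  have lim: "(\<lambda>n. 1 + 2 * inverse (real (Suc n)) - sqrt (a + (inverse (real (Suc n)))^2)) \<longlonglongrightarrow> 1 + 2 * 0 - sqrt (a + 0^2)" for a
    by (intro tendsto_intros LIMSEQ_inverse_real_of_nat)
  have "1 + 2 * 0 - sqrt (h (c 1) + 0^2) \<le> E * (1 + 2 * 0 - sqrt (h (c 0) + 0^2))"
  proof (rule LIMSEQ_le [OF lim tendsto_mult_left [OF lim]], intro exI allI impI)
    fix n
    show "1 + 2 * inverse (real (Suc n)) - sqrt (h (c 1) + (inverse (real (Suc n)))\<^sup>2)
       \<le> E * (1 + 2 * inverse (real (Suc n)) - sqrt (h (c 0) + (inverse (real (Suc n)))\<^sup>2))"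
      unfolding E_def by (rule curve_estimate_regularized [OF ent c]) simp
  qed
  then show ?thesis using h_eq(1) [OF l(1)] h_eq(1) [OF l(2)] e unfolding E_def by simp
qed

text \<open>Solved for the length, the estimate along each curve becomes a lower bound for that
  length, and lower bounds pass to the infimum. Taking logarithms needs \<open>P\<close> and
  \<open>Q\<close> positive; for \<open>Q \<le> 0\<close> the claim follows from
  \<open>P \<ge> 0\<close>.\<close>

lemma distance_estimate:
  assumes ent: "entire S" and p: "p \<in> S" and q: "q \<in> S"
  shows "1 - nonneg_principal_curvature S q \<le> exp (18 * surface_dist S p q) * (1 - nonneg_principal_curvature S p)"
proof -
  define P where "P = 1 - nonneg_principal_curvature S p"
  define Q where "Q = 1 - nonneg_principal_curvature S q"
  have est: "Q \<le> exp (18 * integral {0..1} (speed c)) * P" if "surface_curve S p q c" for c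
    unfolding P_def Q_def by (rule curve_estimate [OF ent that])
  obtain c0 where c0: "surface_curve S p q c0" using curve_exists [OF ent p q] by blast
  have "c0 0 \<in> lifted S" "proj (c0 0) = p" using c0 unfolding surface_curve_def lifted_def by auto
  then have P0: "P \<ge> 0" using h_eq [of "c0 0"] unfolding P_def by auto
  show ?thesis
  proof (cases "Q \<le> 0")
    case True
    have "0 \<le> exp (18 * surface_dist S p q) * P" using P0 by simp
    then show ?thesis using True unfolding P_def Q_def by linarith
  next
    case False
    then have Q: "Q > 0" by simp
    have "P \<noteq> 0" using est [OF c0] Q by auto
    then have P: "P > 0" using P0 by simp
    have "ln (Q / P) / 18 \<le> surface_dist S p q"
      unfolding surface_dist_def
    proof (rule cInf_greatest)
      show "{integral {0..1} (speed c) |c. surface_curve S p q c} \<noteq> {}" using c0 by blast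
      fix x assume "x \<in> {integral {0..1} (speed c) |c. surface_curve S p q c}"
      then obtain c where c: "surface_curve S p q c" "x = integral {0..1} (speed c)" by blast
      have "Q / P \<le> exp (18 * x)" using est [OF c(1)] P unfolding c(2) by (simp add: pos_divide_le_eq)
      then have "ln (Q / P) \<le> 18 * x" using P Q by (metis divide_pos_pos exp_le_cancel_iff exp_ln)
      then show "ln (Q / P) / 18 \<le> x" by simp
    qed
    then have "ln (Q / P) \<le> 18 * surface_dist S p q" by simp
    then have "Q / P \<le> exp (18 * surface_dist S p q)" using P Q by (metis divide_pos_pos exp_le_cancel_iff exp_ln)
    then show ?thesis using P unfolding P_def [symmetric] Q_def [symmetric] by (simp add: pos_divide_le_eq)
  qed
qed

end

theorem proposition2:
  shows "\<exists>M::real. \<forall>S. entire S \<and> maximal_surface S \<and> nonpositive_curvature S \<longrightarrow>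
    (\<forall>p\<in>S. \<forall>q\<in>S.
       1 - nonneg_principal_curvature S q
         \<le> exp (M * surface_dist S p q) * (1 - nonneg_principal_curvature S p))"
  using maximal_surface_nonpos.distance_estimate maximal_surface_nonpos.intro by blast

end
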